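(* Let $(X,d)$ be a metric space such that $c^2(X)<\infty$, where $$c^2(X)=\int_{\mathcal{T}_\infty(X)} c(z_1,z_2,z_3)^2\, d(\mathcal{H}^1)^3(z_1,z_2,z_3)$$ is the integral of the squared Menger curvature over triples of pairwise distinct points of $X$. Then $X$ is rectifiable, that is, there are a set $E\subset\mathbb{R}$ and a Lipschitz function $f:E\to X$ such that $\mathcal{H}^1(X\setminus f(E))=0$.
   Context: $\mathcal{H}^1$ denotes the 1-dimensional Hausdorff measure on $X$. For pairwise distinct points $z_1,z_2,z_3$ of a metric space $(X,d)$, the Menger curvature is $$c(z_1,z_2,z_3)=\frac{2\sin\sphericalangle z_1z_2z_3}{d(z_1,z_3)},\qquad \sphericalangle z_1z_2z_3=\arccos\frac{d(z_1,z_2)^2+d(z_2,z_3)^2-d(z_1,z_3)^2}{2d(z_1,z_2)d(z_2,z_3)}.$$ (It is the reciprocal of the radius of the circle through an isometric copy of $\{z_1,z_2,z_3\}$ in $\mathbb{R}^2$, hence symmetric in its arguments.) For $K\in[1,\infty]$, $$\mathcal{T}_K(X)=\{(z_1,z_2,z_3)\in X^3 : d(z_i,z_j)<K\,d(z_k,z_l)\ \text{for all } i,j,k,l\in\{1,2,3\},\ k\neq l\},$$ with $\infty\cdot 0=0$, so that $\mathcal{T}_\infty(X)$ is the set of triples of pairwise distinct points. The integral with respect to $(\mathcal{H}^1)^3$ is understood as the iterated integral $\int_X\int_X\int_X \cdots\, d\mathcal{H}^1z_1\, d\mathcal{H}^1z_2\, d\mathcal{H}^1z_3$ (integrand set to $0$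 outside $\mathcal{T}_\infty(X)$); no $\sigma$-finiteness of $\mathcal{H}^1$ is assumed. *)

theory Defs
  imports "HOL-Analysis.Analysis"
begin

text \<open>
  Throughout, a metric space is a set \<open>X\<close> in a type of class \<^class>\<open>metric_space\<close>, with the
  induced metric. Taking \<open>X = UNIV\<close> gives the whole type; \<open>X = {}\<close> is allowed.
\<close>

subsection \<open>One-dimensional Hausdorff measure\<close>

text \<open>
  The covering sets may be arbitrary subsets of the ambient type: intersecting a covering of
  \<open>A\<close> with \<open>A\<close> does not increase diameters, so the value depends only on the metric of \<open>A\<close>.
  Boundedness is required because \<^const>\<open>diameter\<close> is unspecified on unbounded sets. No
  normalising constant occurs in dimension one. The infimum over no coverings is \<open>\<infinity>\<close>.
\<close>

definition hausdorff1_pre :: "real \<Rightarrow> 'a::metric_space set \<Rightarrow> ennreal" where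
  "hausdorff1_pre \<delta> A =
     (INF C \<in> {C :: nat \<Rightarrow> 'a set. A \<subseteq> (\<Union>n. C n) \<and> (\<forall>n. bounded (C n) \<and> diameter (C n) \<le> \<delta>)}.
        (\<Sum>n. ennreal (diameter (C n))))"

definition hausdorff1_outer :: "'a::metric_space set \<Rightarrow> ennreal" where
  "hausdorff1_outer A = (SUP \<delta> \<in> {0<..}. hausdorff1_pre \<delta> A)"

text \<open>
  The measure on \<open>X\<close>; its measurable sets are all sets that are measurable in the sense of
  Caratheodory with respect to the outer measure.
\<close>

definition hausdorff1 :: "'a::metric_space set \<Rightarrow> 'a measure" where
  "hausdorff1 X =
     measure_of X (lambda_system X (Pow X) hausdorff1_outer) hausdorff1_outer"

lemma hausdorff1_pre_mono: "A \<subseteq> B \<Longrightarrow> hausdorff1_pre \<delta> A \<le> hausdorff1_pre \<delta> B"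
  unfolding hausdorff1_pre_def by (rule INF_superset_mono) auto

lemma hausdorff1_pre_empty: "0 \<le> \<delta> \<Longrightarrow> hausdorff1_pre \<delta> {} = 0"
  unfolding hausdorff1_pre_def
  by (intro antisym INF_lower2[of "\<lambda>_. {}"]) auto

lemma hausdorff1_pre_UN:
  fixes A :: "nat \<Rightarrow> 'a::metric_space set"
  shows "hausdorff1_pre \<delta> (\<Union>i. A i) \<le> (\<Sum>i. hausdorff1_pre \<delta> (A i))"
proof (rule ennreal_le_epsilon)
  fix e :: real assume e: "0 < e" and fin: "(\<Sum>i. hausdorff1_pre \<delta> (A i)) < top"
  have lt: "hausdorff1_pre \<delta> (A n) < hausdorff1_pre \<delta> (A n) + e * (1/2)^Suc n" for n
    using e fin by (auto simp add: less_top dest!: ennreal_suminf_lessD)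
  have "\<exists>C :: nat \<Rightarrow> 'a set. A n \<subseteq> (\<Union>i. C i) \<and> (\<forall>i. bounded (C i) \<and> diameter (C i) \<le> \<delta>) \<and>
      (\<Sum>i. ennreal (diameter (C i))) < hausdorff1_pre \<delta> (A n) + e * (1/2)^Suc n" for n
    using lt[of n, unfolded hausdorff1_pre_def[of \<delta> "A n"] INF_less_iff]
    unfolding hausdorff1_pre_def[of \<delta> "A n"] by blast
  then obtain B :: "nat \<Rightarrow> nat \<Rightarrow> 'a set" where
    B: "\<And>n. A n \<subseteq> (\<Union>i. B n i)" "\<And>n i. bounded (B n i)" "\<And>n i. diameter (B n i) \<le> \<delta>"
    and Ble: "\<And>n. (\<Sum>i. ennreal (diameter (B n i))) < hausdorff1_pre \<delta> (A n) + e * (1/2)^Suc n"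
    by metis
  define C where "C = case_prod B \<circ> prod_decode"
  have AC: "(\<Union>i. A i) \<subseteq> (\<Union>i. C i)"
    using B(1) by (auto simp add: C_def subset_eq) (metis prod.case prod_encode_inverse)
  have "hausdorff1_pre \<delta> (\<Union>i. A i) \<le> (\<Sum>i. ennreal (diameter (C i)))"
    unfolding hausdorff1_pre_def using AC B(2,3)
    by (intro INF_lower) (auto simp: C_def split: prod.split)
  also have "\<dots> = (\<Sum>n. \<Sum>i. ennreal (diameter (B n i)))"
    unfolding C_def comp_def
    by (subst suminf_ennreal_2dimen[where f = "\<lambda>(n, i). ennreal (diameter (B n i))", symmetric])
       (auto simp: split_def comp_def)
  also have "\<dots> \<le> (\<Sum>n. hausdorff1_pre \<delta> (A n) + e * (1/2) ^ Suc n)"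
    using Ble by (intro suminf_le less_imp_le) auto
  also have "\<dots> = (\<Sum>n. hausdorff1_pre \<delta> (A n)) + (\<Sum>n. ennreal e * ennreal ((1/2) ^ Suc n))"
    using e by (subst suminf_add[symmetric])
      (auto simp del: ennreal_suminf_cmult simp add: ennreal_mult[symmetric])
  also have "\<dots> = (\<Sum>n. hausdorff1_pre \<delta> (A n)) + e"
    unfolding ennreal_suminf_cmult
    by (subst suminf_ennreal_eq[OF zero_le_power power_half_series]) auto
  finally show "hausdorff1_pre \<delta> (\<Union>i. A i) \<le> (\<Sum>n. hausdorff1_pre \<delta> (A n)) + e" .
qed

lemma outer_measure_space_hausdorff1: "outer_measure_space (Pow X) hausdorff1_outer"
proof -
  have "positive (Pow X) (hausdorff1_outer :: 'a set \<Rightarrow> _)"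
    unfolding positive_def hausdorff1_outer_def
    by (subst SUP_cong[OF refl hausdorff1_pre_empty]) auto
  moreover have "increasing (Pow X) (hausdorff1_outer :: 'a set \<Rightarrow> _)"
    unfolding increasing_def hausdorff1_outer_def
    by (auto intro!: SUP_mono' hausdorff1_pre_mono)
  moreover have "countably_subadditive (Pow X) (hausdorff1_outer :: 'a set \<Rightarrow> _)"
    unfolding countably_subadditive_def
  proof safe
    fix A :: "nat \<Rightarrow> 'a set"
    show "hausdorff1_outer (\<Union>i. A i) \<le> (\<Sum>i. hausdorff1_outer (A i))"
      unfolding hausdorff1_outer_def[of "\<Union>i. A i"]
    proof (rule SUP_least)
      fix \<delta> :: real assume "\<delta> \<in> {0<..}"
      then have "hausdorff1_pre \<delta> (A i) \<le> hausdorff1_outer (A i)" for i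
        unfolding hausdorff1_outer_def by (rule SUP_upper)
      then show "hausdorff1_pre \<delta> (\<Union>i. A i) \<le> (\<Sum>i. hausdorff1_outer (A i))"
        by (intro order_trans[OF hausdorff1_pre_UN] suminf_le) auto
    qed
  qed
  ultimately show ?thesis
    by (simp add: outer_measure_space_def)
qed

lemma measure_space_hausdorff1:
  "measure_space X (lambda_system X (Pow X) hausdorff1_outer) hausdorff1_outer"
  using sigma_algebra.caratheodory_lemma[OF sigma_algebra_Pow outer_measure_space_hausdorff1] .

lemma space_hausdorff1: "space (hausdorff1 X) = X"
  unfolding hausdorff1_def by (rule space_measure_of) (auto dest: lambda_system_sets)

lemma sets_hausdorff1: "sets (hausdorff1 X) = lambda_system X (Pow X) hausdorff1_outer"
  using measure_space_hausdorff1[of X] unfolding hausdorff1_def measure_space_def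
  by (intro sigma_algebra.sets_measure_of_eq) blast

lemma emeasure_hausdorff1:
  assumes "A \<in> sets (hausdorff1 X)"
  shows "emeasure (hausdorff1 X) A = hausdorff1_outer A"
  using measure_space_hausdorff1[of X] assms
  by (intro emeasure_measure_of[OF hausdorff1_def])
     (auto simp: measure_space_def sets_hausdorff1 dest: lambda_system_sets)

subsection \<open>Menger curvature\<close>

definition menger_angle :: "'a::metric_space \<Rightarrow> 'a \<Rightarrow> 'a \<Rightarrow> real" where
  "menger_angle z1 z2 z3 =
     arccos (((dist z1 z2)\<^sup>2 + (dist z2 z3)\<^sup>2 - (dist z1 z3)\<^sup>2) / (2 * dist z1 z2 * dist z2 z3))"

definition menger_curvature :: "'a::metric_space \<Rightarrow> 'a \<Rightarrow> 'a \<Rightarrow> real" where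
  "menger_curvature z1 z2 z3 = 2 * sin (menger_angle z1 z2 z3) / dist z1 z3"

text \<open>
  The set \<open>\<T>\<^sub>K(X)\<close>, for \<open>K \<in> [1, \<infinity>]\<close>. The condition \<open>k \<noteq> l\<close> is about indices, not points; in
  \<^typ>\<open>ennreal\<close> we have \<open>\<infinity> * 0 = 0\<close>.
\<close>

definition menger_triples :: "ennreal \<Rightarrow> 'a::metric_space set \<Rightarrow> ('a \<times> 'a \<times> 'a) set" where
  "menger_triples K X = {(z1, z2, z3). z1 \<in> X \<and> z2 \<in> X \<and> z3 \<in> X \<and>
     (let z = (\<lambda>i. [z1, z2, z3] ! i) in
        \<forall>i<3. \<forall>j<3. \<forall>k<3. \<forall>l<3. k \<noteq> l \<longrightarrow>
          ennreal (dist (z i) (z j)) < K * ennreal (dist (z k) (z l)))}"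

lemma menger_triples_top:
  "(z1, z2, z3) \<in> menger_triples \<infinity> X \<longleftrightarrow>
     z1 \<in> X \<and> z2 \<in> X \<and> z3 \<in> X \<and> z1 \<noteq> z2 \<and> z1 \<noteq> z3 \<and> z2 \<noteq> z3"
proof -
  have lt: "ennreal a < top * ennreal (dist x y) \<longleftrightarrow> x \<noteq> y" for a and x y :: 'a
    by (cases "x = y") (auto simp: ennreal_top_mult)
  have all3: "(\<forall>i<3. P i) \<longleftrightarrow> P 0 \<and> P 1 \<and> P (2::nat)" for P
    by (auto simp: numeral_eq_Suc less_Suc_eq)
  show ?thesis
    unfolding menger_triples_def Let_def infinity_ennreal_def lt all3 by auto
qed

text \<open>
  An iterated integral, with \<open>z1\<close> innermost; \<open>\<H>\<^sup>1\<close> need not be \<open>\<sigma>\<close>-finite, and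
  \<^const>\<open>nn_integral\<close> is defined for every integrand.
\<close>

definition menger_c2 :: "'a::metric_space set \<Rightarrow> ennreal" where
  "menger_c2 X =
     (\<integral>\<^sup>+ z3. (\<integral>\<^sup>+ z2. (\<integral>\<^sup>+ z1.
        ennreal ((menger_curvature z1 z2 z3)\<^sup>2) * indicator (menger_triples \<infinity> X) (z1, z2, z3)
      \<partial>hausdorff1 X) \<partial>hausdorff1 X) \<partial>hausdorff1 X)"

subsection \<open>Rectifiability\<close>

text \<open>
  The outer measure is used for the remainder, since \<open>f ` E\<close> need not be measurable for
  arbitrary \<open>E\<close>. A set of outer measure zero is always measurable with measure zero.
\<close>

definition rectifiable :: "'a::metric_space set \<Rightarrow> bool" where
  "rectifiable X \<longleftrightarrow>
     (\<exists>(E :: real set) (f :: real \<Rightarrow> 'a) L.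
        f ` E \<subseteq> X \<and> L-lipschitz_on E f \<and> hausdorff1_outer (X - f ` E) = 0)"

end

theory Submission
  imports Defs
begin

text \<open>
  The square of the Menger curvature of three points is at least their excess (perimeter minus twice
  the longest side) divided by the cube of the larger of the two distances from any one of them;
  only this kernel is used.

  Finite curvature makes \<open>X\<close> \<open>\<sigma>\<close>-finite: after removing countably many sets of finite length, almost
  all triples are collinear, so a thin annulus around a typical point is covered by two balls
  of its width. By exhaustion it then suffices to find, in each set of positive finite
  measure, a piece of positive measure with a bounded real function \<open>h\<close> such that
  \<open>dist x y \<le> 2 * \<bar>h x - h y\<bar>\<close>; countably many such pieces can be strung along the real line.

  To find the piece, pass to a density situation: a set of diameter at most \<open>L\<close> and length almost
  \<open>L\<close> in which no subset is much longer than its diameter and the curvature is tiny. Let \<open>h\<close> be the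
  distance from one end. Dyadic cells of \<open>h\<close> are discarded near places where they carry too little mass
  or where \<open>dist x y - \<bar>h x - h y\<bar>\<close> is on average too large between neighbouring cells. The first kind is
  controlled by the total mass. For the second, inserting points of the next scale between neighbours
  makes the averages telescope up to excesses, whose sum over all scales is bounded by the
  curvature integral. Hence the discarded cells have small total length, and what survives at all
  scales has positive measure.
\<close>

subsection \<open>Excess\<close>

text \<open>Flatness of all triples does not make a set flat: in the four-cycle with its path metric
  every triple has excess zero, yet the four points do not embed in the line. Such a configuration
  can only disturb pairs almost as far apart as the diameter, and the mass bound makes these rare.
  Once most pairs are aligned, nothing may be lost from one scale to the next. Two mechanisms ensure
  this. The pointwise error \<open>size n / 64\<close> proved at one scale is the error
  \<open>size (Suc n) / 32\<close> assumed at the next. The averaged errors are telescoped instead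
  of being estimated anew: inserting a point costs only an excess, and a triple counts at a bounded
  number of scales. Curvature has to be small at every base point \<open>x\<close>, not just on
  average, because triples with one prescribed vertex occur; hence \<open>ekernel\<close> is
  normalised by the distances from its first argument. The powers of two are generous:
  \<open>2 ^ -2000\<close> has to survive repeated use of Markov's inequality to yield
  \<open>2 ^ -200\<close> for the height function, which is negligible against the threshold
  \<open>2 ^ -40\<close> for mean tilts.\<close>

definition excess :: "'a::metric_space \<Rightarrow> 'a \<Rightarrow> 'a \<Rightarrow> real" where
  "excess x y z = dist x y + dist y z + dist x z
     - 2 * max (dist x y) (max (dist y z) (dist x z))"

definition ekernel :: "'a::metric_space \<Rightarrow> 'a \<Rightarrow> 'a \<Rightarrow> real" where
  "ekernel x y z = excess x y z / max (dist x y) (dist x z) ^ 3"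

lemma excess_nonneg: "0 \<le> excess x y z"
  using dist_triangle[of x y z] dist_triangle[of x z y] dist_triangle[of y z x]
  by (auto simp: excess_def dist_commute max_def)

lemma excess_rotate: "excess x y z = excess y x z"
  by (simp add: excess_def dist_commute max.commute max.left_commute)

lemma ekernel_nonneg: "0 \<le> ekernel x y z"
  unfolding ekernel_def
  by (intro divide_nonneg_nonneg excess_nonneg zero_le_power) (simp add: le_max_iff_disj)

lemma excess_middle:
  assumes "dist x y \<le> dist x z" "dist y z \<le> dist x z"
  shows "excess x y z = dist x y + dist y z - dist x z"
  using assms by (simp add: excess_def max_def)

lemma excess_le_ekernel:
  assumes "dist x y \<le> r" "dist x z \<le> r"
  shows "excess x y z \<le> r ^ 3 * ekernel x y z"
proof -
  define \<rho> where "\<rho> = max (dist x y) (dist x z)"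
  have r: "0 \<le> \<rho>" "\<rho> \<le> r" using assms by (auto simp: \<rho>_def le_max_iff_disj)
  show ?thesis
  proof (cases "\<rho> = 0")
    case True
    then have "dist x y = 0" "dist x z = 0"
      by (auto simp: \<rho>_def max_def split: if_splits)
    then have "x = y" "x = z" by auto
    then have "excess x y z = 0" by (simp add: excess_def)
    then show ?thesis using ekernel_nonneg[of x y z] r by simp
  next
    case False
    then have "excess x y z = \<rho> ^ 3 * ekernel x y z"
      by (simp add: ekernel_def \<rho>_def[symmetric])
    also have "\<dots> \<le> r ^ 3 * ekernel x y z"
      using r by (intro mult_right_mono power_mono ekernel_nonneg) auto
    finally show ?thesis .
  qed
qed

section \<open>Averages over a finite measure with measurable distance\<close>

locale measured_metric = finite_measure M for M :: "'a::metric_space measure" +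
  assumes dist_meas: "(\<lambda>(x, y). dist x y) \<in> borel_measurable (M \<Otimes>\<^sub>M M)"
begin

lemma measurable_dist' [measurable]:
  assumes [measurable]: "f \<in> N \<rightarrow>\<^sub>M M" "g \<in> N \<rightarrow>\<^sub>M M"
  shows "(\<lambda>x. dist (f x) (g x)) \<in> borel_measurable N"
proof -
  have "(\<lambda>x. (f x, g x)) \<in> N \<rightarrow>\<^sub>M M \<Otimes>\<^sub>M M" by measurable
  from measurable_compose[OF this dist_meas] show ?thesis by simp
qed

lemma measurable_excess [measurable]:
  assumes [measurable]: "f \<in> N \<rightarrow>\<^sub>M M" "g \<in> N \<rightarrow>\<^sub>M M" "k \<in> N \<rightarrow>\<^sub>M M"
  shows "(\<lambda>x. excess (f x) (g x) (k x)) \<in> borel_measurable N"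
  unfolding excess_def by measurable

lemma measurable_ekernel [measurable]:
  assumes [measurable]: "f \<in> N \<rightarrow>\<^sub>M M" "g \<in> N \<rightarrow>\<^sub>M M" "k \<in> N \<rightarrow>\<^sub>M M"
  shows "(\<lambda>x. ekernel (f x) (g x) (k x)) \<in> borel_measurable N"
  unfolding ekernel_def by measurable

text \<open>For a measurable null set the value is 0, because the integral vanishes and
  \<open>0 / 0 = 0\<close> in \<open>ennreal\<close>. It is a true average only for positive
  measure, as \<open>mean_const\<close> records.\<close>

definition mean :: "'a set \<Rightarrow> ('a \<Rightarrow> ennreal) \<Rightarrow> ennreal" where
  "mean A f = (\<integral>\<^sup>+ x. f x * indicator A x \<partial>M) / ennreal (measure M A)"

lemma mean_mono: "(\<And>x. x \<in> A \<Longrightarrow> f x \<le> g x) \<Longrightarrow> mean A f \<le> mean A g"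
  unfolding mean_def by (intro divide_right_mono_ennreal nn_integral_mono) (simp add: indicator_def)

lemma mean_const:
  assumes "A \<in> sets M" "0 < measure M A"
  shows "mean A (\<lambda>_. c) = c"
  using assms unfolding mean_def
  by (simp add: nn_integral_cmult_indicator emeasure_eq_measure ennreal_mult_divide_eq)

lemma mean_add:
  assumes [measurable]: "A \<in> sets M" "f \<in> borel_measurable M" "g \<in> borel_measurable M"
  shows "mean A (\<lambda>x. f x + g x) = mean A f + mean A g"
  unfolding mean_def
  by (simp add: distrib_right nn_integral_add add_divide_distrib_ennreal)

lemma measurable_mean [measurable (raw)]:
  assumes [measurable]: "A \<in> sets M" "(\<lambda>(x, y). f x y) \<in> borel_measurable (N \<Otimes>\<^sub>M M)"
  shows "(\<lambda>x. mean A (f x)) \<in> borel_measurable N"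
  unfolding mean_def by measurable

end

subsection \<open>Height functions\<close>

locale height_space = measured_metric M for M :: "'a::metric_space measure" +
  fixes h :: "'a \<Rightarrow> real" and \<epsilon> :: real
  assumes h_meas [measurable]: "h \<in> borel_measurable M"
    and h_lip: "x \<in> space M \<Longrightarrow> y \<in> space M \<Longrightarrow> \<bar>h x - h y\<bar> \<le> dist x y"
    and eps_nonneg: "0 \<le> \<epsilon>"
    and mass_le_diam: "A \<in> sets M \<Longrightarrow> 0 \<le> D \<Longrightarrow> (\<And>x y. x \<in> A \<Longrightarrow> y \<in> A \<Longrightarrow> dist x y \<le> D) \<Longrightarrow>
      measure M A \<le> (1 + \<epsilon>) * D"
begin

definition tilt :: "'a \<Rightarrow> 'a \<Rightarrow> real" where
  "tilt x y = dist x y - \<bar>h x - h y\<bar>"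

definition slab :: "real \<Rightarrow> real \<Rightarrow> 'a set" where
  "slab a b = {x \<in> space M. a \<le> h x \<and> h x < b}"

lemma tilt_nonneg: "x \<in> space M \<Longrightarrow> y \<in> space M \<Longrightarrow> 0 \<le> tilt x y"
  using h_lip by (simp add: tilt_def)

text \<open>Along increasing heights the height differences add up exactly, so only the triangle
  inequality for the distance remains.\<close>

lemma tilt_triangle: "h x \<le> h y \<Longrightarrow> h y \<le> h z \<Longrightarrow> tilt x z \<le> tilt x y + tilt y z"
  using dist_triangle[of x z y] by (simp add: tilt_def)

lemma sets_slab [measurable]: "slab a b \<in> sets M"
  unfolding slab_def by measurable

lemma measurable_tilt [measurable]:
  assumes [measurable]: "f \<in> N \<rightarrow>\<^sub>M M" "g \<in> N \<rightarrow>\<^sub>M M"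
  shows "(\<lambda>x. tilt (f x) (g x)) \<in> borel_measurable N"
  unfolding tilt_def by measurable

lemma sets_tilt_gt:
  assumes "x \<in> space M" "A \<in> sets M"
  shows "{y \<in> A. d < tilt x y} \<in> sets M"
proof -
  have [measurable]: "A \<in> sets M" by fact
  have [simp]: "x \<in> space M" using assms by simp
  have "{y \<in> space M. y \<in> A \<and> d < tilt x y} \<in> sets M" by measurable
  moreover have "{y \<in> space M. y \<in> A \<and> d < tilt x y} = {y \<in> A. d < tilt x y}"
    using sets.sets_into_space[OF assms(2)] by auto
  ultimately show ?thesis by simp
qed

text \<open>Points in a thin slice carrying little mass are discarded; any two remaining points are
  joined through a generic third point of the slice of the first one.\<close>

lemma mass_le_length:
  assumes A: "A \<in> sets M" "A \<subseteq> slab a (a + l)" and l: "0 < l" "l \<le> s"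
    and N: "0 < (N::nat)" and d: "0 \<le> d" and m: "0 \<le> m"
    and gen: "\<And>x. x \<in> A \<Longrightarrow> measure M {y \<in> A. d < tilt x y} \<le> m"
  shows "measure M A \<le> (1 + \<epsilon>) * (l + 2 * s / N + 2 * d) + 2 * N * m"
proof -
  have [measurable]: "A \<in> sets M" by fact
  have AS: "A \<subseteq> space M" using sets.sets_into_space[OF A(1)] .
  define b where "b x = nat \<lfloor>(h x - a) * N / l\<rfloor>" for x
  have bm: "b \<in> M \<rightarrow>\<^sub>M count_space UNIV" unfolding b_def by measurable
  define S where "S t = {x \<in> A. b x = t}" for t
  have Sm: "S t \<in> sets M" for t
  proof -
    have "{x \<in> space M. x \<in> A \<and> b x = t} \<in> sets M" using bm by measurable
    moreover have "{x \<in> space M. x \<in> A \<and> b x = t} = S t" using AS by (auto simp: S_def)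
    ultimately show ?thesis by simp
  qed
  have bN: "b x < N" if "x \<in> A" for x
  proof -
    have x: "a \<le> h x" "h x < a + l" using A(2) that by (auto simp: slab_def)
    have "(h x - a) * N / l < N"
      using x l N by (simp add: pos_divide_less_eq mult.commute)
    moreover have "0 \<le> (h x - a) * N / l" using x l by simp
    ultimately show ?thesis unfolding b_def by (simp add: nat_less_iff floor_less_iff)
  qed
  have AU: "A = (\<Union>t<N. S t)" using bN by (auto simp: S_def)
  \<comment> \<open>The threshold is twice \<open>m\<close> because a generic point of a slice has
    to avoid two exceptional sets of mass \<open>m\<close>, one for each of the two points to be
    joined.\<close>
  define G where "G = {t. t < N \<and> 2 * m < measure M (S t)}"
  define W where "W = (\<Union>t\<in>G. S t)"
  have fG: "finite G" by (simp add: G_def)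
  have Wm: "W \<in> sets M" unfolding W_def using fG Sm by auto
  have close: "\<bar>h x - h u\<bar> \<le> s / N" if "x \<in> A" "u \<in> A" "b x = b u" for x u
  proof -
    have x: "a \<le> h x" "a \<le> h u" using A(2) that by (auto simp: slab_def)
    have "\<lfloor>(h x - a) * N / l\<rfloor> = \<lfloor>(h u - a) * N / l\<rfloor>"
      using that(3) x l unfolding b_def by (subst (asm) eq_nat_nat_iff) auto
    then have "\<bar>(h x - a) * N / l - (h u - a) * N / l\<bar> < 1" by linarith
    also have "(h x - a) * N / l - (h u - a) * N / l = (h x - h u) * N / l"
      by (simp add: algebra_simps diff_divide_distrib)
    finally have "\<bar>h x - h u\<bar> * N < l" using l N by (simp add: abs_mult)
    then have "\<bar>h x - h u\<bar> * N \<le> s" using l by simp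
    then show ?thesis using N by (simp add: pos_le_divide_eq)
  qed
  have Wd: "dist x y \<le> l + 2 * s / N + 2 * d" if xy: "x \<in> W" "y \<in> W" for x y
  proof -
    obtain t where t: "t \<in> G" "x \<in> S t" using xy by (auto simp: W_def)
    have xA: "x \<in> A" "y \<in> A" using xy by (auto simp: W_def S_def)
    define B1 where "B1 = {z \<in> A. d < tilt x z}"
    define B2 where "B2 = {z \<in> A. d < tilt y z}"
    have Bm: "B1 \<in> sets M" "B2 \<in> sets M"
      unfolding B1_def B2_def using xA AS A by (auto intro!: sets_tilt_gt)
    have "\<not> S t \<subseteq> B1 \<union> B2"
    proof
      assume "S t \<subseteq> B1 \<union> B2"
      then have "measure M (S t) \<le> measure M (B1 \<union> B2)"
        using Bm Sm by (intro finite_measure_mono) auto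
      also have "\<dots> \<le> measure M B1 + measure M B2"
        using Bm by (intro measure_Un_le) auto
      also have "\<dots> \<le> 2 * m" using gen[OF xA(1)] gen[OF xA(2)] by (simp add: B1_def B2_def)
      finally show False using t by (simp add: G_def)
    qed
    then obtain u where u: "u \<in> S t" "u \<notin> B1" "u \<notin> B2" by auto
    then have uA: "u \<in> A" "b u = b x" using t by (auto simp: S_def)
    have "tilt x u \<le> d" "tilt y u \<le> d" using u uA by (auto simp: B1_def B2_def)
    then have "dist x u \<le> d + \<bar>h x - h u\<bar>" "dist y u \<le> d + \<bar>h y - h u\<bar>"
      by (auto simp: tilt_def)
    moreover have "\<bar>h x - h u\<bar> \<le> s / N" using close[OF xA(1) uA(1)] uA by simp
    moreover have "\<bar>h x - h y\<bar> \<le> l"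
    proof -
      have "x \<in> slab a (a + l)" "y \<in> slab a (a + l)" using A(2) xA by auto
      then show ?thesis unfolding slab_def by simp linarith
    qed
    moreover have "dist x y \<le> dist x u + dist y u"
      using dist_triangle2[of x y u] .
    ultimately show ?thesis by simp
  qed
  have "measure M W \<le> (1 + \<epsilon>) * (l + 2 * s / N + 2 * d)"
    using l d N by (intro mass_le_diam Wm Wd) auto
  moreover have "measure M A \<le> measure M W + 2 * N * m"
  proof -
    have "A \<subseteq> W \<union> (\<Union>t\<in>{..<N} - G. S t)" unfolding AU W_def by auto
    then have "measure M A \<le> measure M (W \<union> (\<Union>t\<in>{..<N} - G. S t))"
      using Wm Sm by (intro finite_measure_mono) auto
    also have "\<dots> \<le> measure M W + measure M (\<Union>t\<in>{..<N} - G. S t)"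
      using Wm Sm by (intro measure_Un_le) auto
    also have "measure M (\<Union>t\<in>{..<N} - G. S t) \<le> (\<Sum>t\<in>{..<N} - G. measure M (S t))"
      using Sm by (intro finite_measure_subadditive_finite) auto
    also have "\<dots> \<le> (\<Sum>t\<in>{..<N} - G. 2 * m)"
      by (intro sum_mono) (auto simp: G_def)
    also have "\<dots> \<le> (\<Sum>t\<in>{..<N}. 2 * m)"
      using m by (intro sum_mono2) auto
    finally show ?thesis by simp
  qed
  ultimately show ?thesis by simp
qed

text \<open>Two exceptional sets of mass at most \<open>m\<close> cannot exhaust \<open>C\<close>,
  so some \<open>u\<close> in \<open>C\<close> is almost aligned with both points, and the detour
  through \<open>u\<close> costs at most \<open>2 * r\<close> in height. This turns information on
  most pairs into information on all pairs.\<close>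

lemma dist_le_via_proxy:
  assumes x: "x \<in> space M" "y \<in> space M" and C: "C \<in> sets M"
    and close: "\<And>u. u \<in> C \<Longrightarrow> \<bar>h x - h u\<bar> \<le> r"
    and bad: "measure M {u \<in> C. d < tilt x u} \<le> m" "measure M {u \<in> C. d < tilt y u} \<le> m"
    and big: "2 * m < measure M C"
  shows "dist x y \<le> \<bar>h x - h y\<bar> + 2 * r + 2 * d"
proof -
  have Bm: "{u \<in> C. d < tilt x u} \<in> sets M" "{u \<in> C. d < tilt y u} \<in> sets M"
    using x C by (auto intro!: sets_tilt_gt)
  have "\<not> C \<subseteq> {u \<in> C. d < tilt x u} \<union> {u \<in> C. d < tilt y u}"
  proof
    assume "C \<subseteq> {u \<in> C. d < tilt x u} \<union> {u \<in> C. d < tilt y u}"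
    then have "measure M C \<le> measure M ({u \<in> C. d < tilt x u} \<union> {u \<in> C. d < tilt y u})"
      using Bm by (intro finite_measure_mono) auto
    also have "\<dots> \<le> measure M {u \<in> C. d < tilt x u} + measure M {u \<in> C. d < tilt y u}"
      using Bm by (intro measure_Un_le) auto
    finally show False using bad big by simp
  qed
  then obtain u where u: "u \<in> C" "tilt x u \<le> d" "tilt y u \<le> d" by force
  then have "dist x u \<le> d + \<bar>h x - h u\<bar>" "dist y u \<le> d + \<bar>h y - h u\<bar>"
    by (auto simp: tilt_def)
  moreover have "dist x y \<le> dist x u + dist y u" using dist_triangle2[of x y u] .
  ultimately show ?thesis using close[OF u(1)] by linarith
qed

definition mean_tilt :: "'a set \<Rightarrow> 'a set \<Rightarrow> ennreal" where
  "mean_tilt A B = mean A (\<lambda>x. mean B (\<lambda>y. ennreal (tilt x y)))"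

text \<open>A variable on which a summand does not depend is averaged out, which is where positive
  mass enters.\<close>

lemma mean3:
  assumes [measurable]: "A \<in> sets M" "B \<in> sets M" "C \<in> sets M"
    and pos: "0 < measure M A" "0 < measure M B" "0 < measure M C"
  shows "mean A (\<lambda>x. mean B (\<lambda>y. mean C (\<lambda>z. ennreal (tilt x y) + ennreal (tilt y z)))) =
      mean_tilt A B + mean_tilt B C"
proof -
  have "mean A (\<lambda>x. mean B (\<lambda>y. mean C (\<lambda>z. ennreal (tilt x y) + ennreal (tilt y z)))) =
      mean A (\<lambda>x. mean B (\<lambda>y. ennreal (tilt x y) + mean C (\<lambda>z. ennreal (tilt y z))))"
  proof -
    have "mean C (\<lambda>z. ennreal (tilt x y) + ennreal (tilt y z)) =
        ennreal (tilt x y) + mean C (\<lambda>z. ennreal (tilt y z))" if "x \<in> A" "y \<in> B" for x y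
    proof -
      have [simp]: "y \<in> space M"
        using that sets.sets_into_space[OF assms(2)] by auto
      show ?thesis using pos by (simp add: mean_add mean_const)
    qed
    then show ?thesis by (intro antisym mean_mono) auto
  qed
  also have "\<dots> = mean A (\<lambda>x. mean B (\<lambda>y. ennreal (tilt x y)) + mean_tilt B C)"
  proof -
    have "mean B (\<lambda>y. ennreal (tilt x y) + mean C (\<lambda>z. ennreal (tilt y z))) =
        mean B (\<lambda>y. ennreal (tilt x y)) + mean_tilt B C" if "x \<in> A" for x
    proof -
      have [simp]: "x \<in> space M"
        using that sets.sets_into_space[OF assms(1)] by auto
      show ?thesis unfolding mean_tilt_def by (rule mean_add) measurable
    qed
    then show ?thesis by (intro antisym mean_mono) auto
  qed
  also have "\<dots> = mean_tilt A B + mean_tilt B C"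
  proof -
    have "mean A (\<lambda>x. mean B (\<lambda>y. ennreal (tilt x y)) + mean_tilt B C) =
      mean A (\<lambda>x. mean B (\<lambda>y. ennreal (tilt x y))) + mean A (\<lambda>x. mean_tilt B C)"
      by (rule mean_add) measurable
    then show ?thesis using pos by (simp add: mean_const mean_tilt_def)
  qed
  finally show ?thesis .
qed

lemma mean_tilt_triangle:
  assumes S: "A \<in> sets M" "B \<in> sets M" "C \<in> sets M"
    and pos: "0 < measure M A" "0 < measure M B" "0 < measure M C"
    and ord: "\<And>x y. x \<in> A \<Longrightarrow> y \<in> B \<Longrightarrow> h x \<le> h y" "\<And>y z. y \<in> B \<Longrightarrow> z \<in> C \<Longrightarrow> h y \<le> h z"
  shows "mean_tilt A C \<le> mean_tilt A B + mean_tilt B C"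
proof -
  have "mean_tilt A C = mean A (\<lambda>x. mean B (\<lambda>y. mean C (\<lambda>z. ennreal (tilt x z))))"
    using S pos by (simp add: mean_tilt_def mean_const)
  also have "\<dots> \<le> mean A (\<lambda>x. mean B (\<lambda>y. mean C (\<lambda>z. ennreal (tilt x y) + ennreal (tilt y z))))"
  proof (intro mean_mono)
    fix x y z assume xyz: "x \<in> A" "y \<in> B" "z \<in> C"
    then have "x \<in> space M" "y \<in> space M" "z \<in> space M"
      using S[THEN sets.sets_into_space] by auto
    moreover have "tilt x z \<le> tilt x y + tilt y z"
      using xyz ord by (intro tilt_triangle) auto
    ultimately show "ennreal (tilt x z) \<le> ennreal (tilt x y) + ennreal (tilt y z)"
      by (simp add: tilt_nonneg flip: ennreal_plus)
  qed
  also have "\<dots> = mean_tilt A B + mean_tilt B C" using S pos by (rule mean3)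
  finally show ?thesis .
qed

text \<open>When \<open>dist x z\<close> is the longest side, the defect in the triangle inequality
  is exactly the excess. So the triangle inequality for tilts can be reversed at the price of a mean
  excess; this is the step that telescopes over the scales.\<close>

lemma mean_tilt_split:
  assumes S: "A \<in> sets M" "B \<in> sets M" "C \<in> sets M"
    and pos: "0 < measure M A" "0 < measure M B" "0 < measure M C"
    and ord: "\<And>x y. x \<in> A \<Longrightarrow> y \<in> B \<Longrightarrow> h x \<le> h y" "\<And>y z. y \<in> B \<Longrightarrow> z \<in> C \<Longrightarrow> h y \<le> h z"
    and long: "\<And>x y z. x \<in> A \<Longrightarrow> y \<in> B \<Longrightarrow> z \<in> C \<Longrightarrow> dist x y \<le> dist x z \<and> dist y z \<le> dist x z"
  shows "mean_tilt A B + mean_tilt B C \<le>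
    mean_tilt A C + mean A (\<lambda>x. mean B (\<lambda>y. mean C (\<lambda>z. ennreal (excess x y z))))"
proof -
  have [measurable]: "A \<in> sets M" "B \<in> sets M" "C \<in> sets M" by fact+
  have "mean_tilt A B + mean_tilt B C =
      mean A (\<lambda>x. mean B (\<lambda>y. mean C (\<lambda>z. ennreal (tilt x y) + ennreal (tilt y z))))"
    using S pos by (rule mean3[symmetric])
  also have "\<dots> \<le> mean A (\<lambda>x. mean B (\<lambda>y. mean C (\<lambda>z. ennreal (tilt x z) + ennreal (excess x y z))))"
  proof (intro mean_mono)
    fix x y z assume xyz: "x \<in> A" "y \<in> B" "z \<in> C"
    then have sp: "x \<in> space M" "y \<in> space M" "z \<in> space M"
      using S[THEN sets.sets_into_space] by auto
    have "excess x y z = dist x y + dist y z - dist x z"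
      using long[OF xyz] by (intro excess_middle) auto
    then have "tilt x y + tilt y z = tilt x z + excess x y z"
      using ord(1)[OF xyz(1,2)] ord(2)[OF xyz(2,3)] by (simp add: tilt_def)
    then show "ennreal (tilt x y) + ennreal (tilt y z) \<le> ennreal (tilt x z) + ennreal (excess x y z)"
      using sp by (simp add: tilt_nonneg excess_nonneg flip: ennreal_plus)
  qed
  also have "\<dots> = mean A (\<lambda>x. mean B (\<lambda>y. mean C (\<lambda>z. ennreal (tilt x z)) +
      mean C (\<lambda>z. ennreal (excess x y z))))"
  proof -
    have "mean C (\<lambda>z. ennreal (tilt x z) + ennreal (excess x y z)) =
        mean C (\<lambda>z. ennreal (tilt x z)) + mean C (\<lambda>z. ennreal (excess x y z))"
      if "x \<in> A" "y \<in> B" for x y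
    proof -
      have [simp]: "y \<in> space M" "x \<in> space M"
        using that S[THEN sets.sets_into_space] by auto
      show ?thesis by (rule mean_add) measurable
    qed
    then show ?thesis by (intro antisym mean_mono) auto
  qed
  also have "\<dots> = mean A (\<lambda>x. mean C (\<lambda>z. ennreal (tilt x z)) +
      mean B (\<lambda>y. mean C (\<lambda>z. ennreal (excess x y z))))"
  proof -
    have "mean B (\<lambda>y. mean C (\<lambda>z. ennreal (tilt x z)) + mean C (\<lambda>z. ennreal (excess x y z))) =
        mean C (\<lambda>z. ennreal (tilt x z)) + mean B (\<lambda>y. mean C (\<lambda>z. ennreal (excess x y z)))"
      if "x \<in> A" for x
    proof -
      have [simp]: "x \<in> space M"
        using that S[THEN sets.sets_into_space] by auto
      have "mean B (\<lambda>y. mean C (\<lambda>z. ennreal (tilt x z)) + mean C (\<lambda>z. ennreal (excess x y z))) =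
        mean B (\<lambda>y. mean C (\<lambda>z. ennreal (tilt x z))) + mean B (\<lambda>y. mean C (\<lambda>z. ennreal (excess x y z)))"
        by (rule mean_add[of B "\<lambda>_. mean C (\<lambda>z. ennreal (tilt x z))"
          "\<lambda>y. mean C (\<lambda>z. ennreal (excess x y z))"]) measurable
      then show ?thesis using pos by (simp add: mean_const)
    qed
    then show ?thesis by (intro antisym mean_mono) auto
  qed
  also have "\<dots> = mean_tilt A C + mean A (\<lambda>x. mean B (\<lambda>y. mean C (\<lambda>z. ennreal (excess x y z))))"
    unfolding mean_tilt_def
    by (rule mean_add[of A "\<lambda>x. mean C (\<lambda>z. ennreal (tilt x z))"
      "\<lambda>x. mean B (\<lambda>y. mean C (\<lambda>z. ennreal (excess x y z)))"]) measurable
  finally show ?thesis .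
qed

end

subsection \<open>Dyadic cells of a nearly straight space\<close>

locale flat_space = height_space M h \<epsilon>
  for M :: "'a::metric_space measure" and h \<epsilon> +
  fixes L :: real
  assumes L_pos: "0 < L"
    and eps_small: "\<epsilon> \<le> 1 / 2 ^ 200"
    and h_range: "x \<in> space M \<Longrightarrow> 0 \<le> h x \<and> h x \<le> L"
    and full_mass: "(1 - \<epsilon>) * L \<le> measure M (space M)"
    and curvature: "x \<in> space M \<Longrightarrow>
      (\<integral>\<^sup>+ y. \<integral>\<^sup>+ z. ennreal (ekernel x y z) \<partial>M \<partial>M) \<le> ennreal \<epsilon>"
    and few_tilted: "x \<in> space M \<Longrightarrow> measure M {y \<in> space M. \<epsilon> * L < tilt x y} \<le> \<epsilon> * L"
begin

text \<open>The factor \<open>2 ^ 10\<close> gives 1024 cells at scale zero, so that giving up some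
  twenty cells at either end costs only a small part of \<open>L\<close>.\<close>

definition size :: "nat \<Rightarrow> real" where "size n = L / 2 ^ (n + 10)"

definition cell :: "nat \<Rightarrow> int \<Rightarrow> 'a set" where
  "cell n j = slab (of_int j * size n) ((of_int j + 1) * size n)"

definition bin :: "nat \<Rightarrow> int \<Rightarrow> nat \<Rightarrow> 'a set" where
  "bin n j t = slab ((of_int j + real t / 256) * size n) ((of_int j + (real t + 1) / 256) * size n)"

text \<open>The windows are placed such that, in the order of the heights, \<open>window (Suc n) (2 * j + 1)\<close> and
  \<open>window (Suc n) (2 * j + 2)\<close> lie strictly between \<open>window n j\<close> and \<open>window n (j + 1)\<close>.\<close>

definition window :: "nat \<Rightarrow> int \<Rightarrow> 'a set" where
  "window n j = slab ((of_int j + 1/4) * size n) ((of_int j + 3/8) * size n)"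

text \<open>Every bin has to carry half of its length in mass: the proxy for a point is taken from
  its own bin, and the windows of the next scale inherit their mass from a bin of the
  parent.\<close>

definition dense :: "nat \<Rightarrow> int \<Rightarrow> bool" where
  "dense n j \<longleftrightarrow> (\<forall>t<256. size n / 512 \<le> measure M (bin n j t))"

definition regular :: "nat \<Rightarrow> int \<Rightarrow> bool" where
  "regular n j \<longleftrightarrow> dense n j \<and>
     mean_tilt (window n j) (window n (j + 1)) \<le> ennreal (size n / 2 ^ 40)"

text \<open>Cells at most ten apart have parents at most six apart, the range of
  \<open>good_pairs_close\<close>; so the property can be passed on to the next scale.\<close>

definition near :: "nat \<Rightarrow> int \<Rightarrow> bool" where
  "near n j \<longleftrightarrow> (\<forall>i i'. \<bar>i - j\<bar> \<le> 10 \<and> \<bar>i' - j\<bar> \<le> 10 \<and> \<bar>i - i'\<bar> \<le> 10 \<longrightarrow>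
     (\<forall>x\<in>cell n i. \<forall>y\<in>cell n i'. dist x y \<le> \<bar>h x - h y\<bar> + size n / 32))"

definition good :: "nat \<Rightarrow> int \<Rightarrow> bool" where
  "good n j \<longleftrightarrow> near n j \<and> (\<forall>i. \<bar>i - j\<bar> \<le> 10 \<longrightarrow> regular n i)"

lemma size_pos: "0 < size n" using L_pos by (simp add: size_def)

lemma size_Suc: "size (Suc n) = size n / 2" by (simp add: size_def power_add)

lemma sets_cells [measurable]: "cell n j \<in> sets M" "bin n j t \<in> sets M" "window n j \<in> sets M"
  by (simp_all add: cell_def bin_def window_def)

lemma window_bin: "bin n j 64 \<subseteq> window n j"
proof -
  have "(of_int j + (real 64 + 1) / 256) * size n \<le> (of_int j + 3/8) * size n"
    using size_pos[of n] by (intro mult_right_mono) auto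
  then show ?thesis by (auto simp: bin_def window_def slab_def)
qed

lemma window_cell: "window n j \<subseteq> cell n j"
proof -
  have "(of_int j + 3/8) * size n \<le> (of_int j + 1) * size n" "of_int j * size n \<le> (of_int j + 1/4) * size n"
    using size_pos[of n] by (intro mult_right_mono; simp)+
  then show ?thesis by (auto simp: cell_def window_def slab_def)
qed

lemma bin_cell: "t < 256 \<Longrightarrow> bin n j t \<subseteq> cell n j"
proof -
  assume "t < 256"
  then have "(of_int j + (real t + 1) / 256) * size n \<le> (of_int j + 1) * size n"
      "of_int j * size n \<le> (of_int j + real t/256) * size n"
    using size_pos[of n] by (intro mult_right_mono; simp)+
  then show ?thesis by (auto simp: cell_def bin_def slab_def)
qed

lemma window_h:
  assumes "x \<in> window n j"
  shows "(of_int j + 1/4) * size n \<le> h x" "h x < (of_int j + 3/8) * size n" "x \<in> space M"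
  using assms by (auto simp: window_def slab_def)

lemma cell_h:
  assumes "x \<in> cell n j"
  shows "of_int j * size n \<le> h x" "h x < (of_int j + 1) * size n" "x \<in> space M"
  using assms by (auto simp: cell_def slab_def)

lemma window_mass: "dense n j \<Longrightarrow> size n / 512 \<le> measure M (window n j)"
proof -
  assume "dense n j"
  then have "size n / 512 \<le> measure M (bin n j 64)" by (simp add: dense_def)
  also have "\<dots> \<le> measure M (window n j)"
    by (intro finite_measure_mono window_bin) measurable
  finally show ?thesis .
qed

lemma window_mass_pos: "dense n j \<Longrightarrow> 0 < measure M (window n j)"
  using window_mass[of n j] size_pos[of n] by simp

lemma window_order:
  assumes "x \<in> window n i" "y \<in> window n j" "i < j" shows "h x \<le> h y"
proof -
  have "(of_int i + 3/8) * size n \<le> (of_int j + 1/4) * size n"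
    using size_pos[of n] assms(3) by (intro mult_right_mono) linarith+
  then show ?thesis using window_h[OF assms(1)] window_h[OF assms(2)] by linarith
qed

section \<open>Estimates in the neighbourhood of a good cell\<close>

lemma mean_tilt_windows:
  assumes "\<And>i. a \<le> i \<Longrightarrow> i \<le> a + 1 + int m \<Longrightarrow> regular n i"
  shows "mean_tilt (window n a) (window n (a + 1 + int m)) \<le> ennreal ((1 + real m) * size n / 2 ^ 40)"
  using assms
proof (induction m)
  case 0
  then show ?case by (simp add: regular_def)
next
  case (Suc m)
  have reg: "regular n a" "regular n (a + 1 + int m)" "regular n (a + 1 + int (Suc m))"
    using Suc.prems by auto
  have "mean_tilt (window n a) (window n (a + 1 + int (Suc m))) \<le>
    mean_tilt (window n a) (window n (a + 1 + int m)) +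
    mean_tilt (window n (a + 1 + int m)) (window n (a + 1 + int (Suc m)))"
    using reg by (intro mean_tilt_triangle window_mass_pos)
      (auto simp: regular_def intro: window_order)
  also have "\<dots> \<le> ennreal ((1 + real m) * size n / 2 ^ 40) + ennreal (size n / 2 ^ 40)"
    using reg(2) Suc.prems by (intro add_mono Suc.IH) (auto simp: regular_def add_ac)
  also have "\<dots> = ennreal ((1 + real (Suc m)) * size n / 2 ^ 40)"
    using size_pos[of n] by (simp add: field_simps flip: ennreal_plus)
  finally show ?case .
qed

text \<open>Within distance \<open>r\<close> of \<open>x\<close> the excess is at most
  \<open>r ^ 3\<close> times the kernel, and the kernel is controlled by the curvature bound at the
  vertex \<open>x\<close>.\<close>

lemma local_excess:
  assumes x: "x \<in> space M" and [measurable]: "A \<in> sets M" "B \<in> sets M"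
    and d: "\<And>y. y \<in> A \<Longrightarrow> dist x y \<le> r" "\<And>y. y \<in> B \<Longrightarrow> dist x y \<le> r"
    and "0 \<le> r"
  shows "(\<integral>\<^sup>+ y. (\<integral>\<^sup>+ z. ennreal (excess x y z) * indicator B z \<partial>M) * indicator A y \<partial>M) \<le> ennreal (r ^ 3 * \<epsilon>)"
proof -
  note x [simp]
  have "(\<integral>\<^sup>+ y. (\<integral>\<^sup>+ z. ennreal (excess x y z) * indicator B z \<partial>M) * indicator A y \<partial>M) \<le>
    (\<integral>\<^sup>+ y. \<integral>\<^sup>+ z. ennreal (r ^ 3) * ennreal (ekernel x y z) \<partial>M \<partial>M)"
  proof (intro nn_integral_mono)
    fix y assume "y \<in> space M"
    show "(\<integral>\<^sup>+ z. ennreal (excess x y z) * indicator B z \<partial>M) * indicator A y \<le>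
      (\<integral>\<^sup>+ z. ennreal (r ^ 3) * ennreal (ekernel x y z) \<partial>M)"
    proof (cases "y \<in> A")
      case True
      have "(\<integral>\<^sup>+ z. ennreal (excess x y z) * indicator B z \<partial>M) \<le>
        (\<integral>\<^sup>+ z. ennreal (r ^ 3) * ennreal (ekernel x y z) \<partial>M)"
        using d True \<open>0 \<le> r\<close>
        by (intro nn_integral_mono)
          (auto simp: indicator_def excess_le_ekernel ekernel_nonneg simp flip: ennreal_mult)
      then show ?thesis using True by simp
    qed simp
  qed
  also have "\<dots> = (\<integral>\<^sup>+ y. ennreal (r ^ 3) * (\<integral>\<^sup>+ z. ennreal (ekernel x y z) \<partial>M) \<partial>M)"
  proof (intro nn_integral_cong)
    fix y assume "y \<in> space M"
    then have [simp]: "y \<in> space M" by auto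
    show "(\<integral>\<^sup>+ z. ennreal (r ^ 3) * ennreal (ekernel x y z) \<partial>M) =
      ennreal (r ^ 3) * (\<integral>\<^sup>+ z. ennreal (ekernel x y z) \<partial>M)"
      by (rule nn_integral_cmult) measurable
  qed
  also have "\<dots> = ennreal (r ^ 3) * (\<integral>\<^sup>+ y. \<integral>\<^sup>+ z. ennreal (ekernel x y z) \<partial>M \<partial>M)"
    by (rule nn_integral_cmult) measurable
  also have "\<dots> \<le> ennreal (r ^ 3) * ennreal \<epsilon>"
    by (intro mult_left_mono curvature x) simp
  also have "\<dots> = ennreal (r ^ 3 * \<epsilon>)"
    using eps_nonneg \<open>0 \<le> r\<close> by (simp add: ennreal_mult)
  finally show ?thesis .
qed

lemma mean_le_bound:
  assumes "(\<integral>\<^sup>+ x. f x * indicator A x \<partial>M) \<le> ennreal c" "m \<le> measure M A" "0 < m" "0 \<le> c"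
  shows "mean A f \<le> ennreal (c / m)"
proof -
  have "mean A f \<le> ennreal c / ennreal (measure M A)"
    unfolding mean_def by (intro divide_right_mono_ennreal assms)
  also have "\<dots> = ennreal (c / measure M A)"
    using assms by (intro divide_ennreal) auto
  also have "\<dots> \<le> ennreal (c / m)"
    using assms by (intro ennreal_leI divide_left_mono mult_pos_pos) auto
  finally show ?thesis .
qed

lemma cell_h_diff:
  assumes "x \<in> cell n i" "y \<in> cell n j"
  shows "h y - h x \<le> (of_int (j - i) + 1) * size n" "(of_int (j - i) - 1) * size n \<le> h y - h x"
  using cell_h[OF assms(1)] cell_h[OF assms(2)] by (auto simp: algebra_simps)

lemma cell_h_diff_le:
  assumes "x \<in> cell n i" "y \<in> cell n j" "j - i \<le> c"
  shows "h y - h x \<le> (of_int c + 1) * size n"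
proof -
  have "(of_int (j - i) + 1) * size n \<le> (of_int c + 1) * size n"
    using assms(3) size_pos[of n] by (intro mult_right_mono) auto
  then show ?thesis using cell_h_diff(1)[OF assms(1,2)] by linarith
qed

lemma cell_h_diff_ge:
  assumes "x \<in> cell n i" "y \<in> cell n j" "c \<le> j - i"
  shows "(of_int c - 1) * size n \<le> h y - h x"
proof -
  have "(of_int c - 1) * size n \<le> (of_int (j - i) - 1) * size n"
    using assms(3) size_pos[of n] by (intro mult_right_mono) auto
  then show ?thesis using cell_h_diff(2)[OF assms(1,2)] by linarith
qed

lemma good_dist:
  assumes "good n j" "x \<in> cell n i" "y \<in> cell n i'" "\<bar>i - j\<bar> \<le> 10" "\<bar>i' - j\<bar> \<le> 10" "\<bar>i - i'\<bar> \<le> 10"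
  shows "dist x y \<le> \<bar>h x - h y\<bar> + size n / 32"
  using assms unfolding good_def near_def by blast

lemma good_dist12:
  assumes "good n j" "x \<in> cell n j" "y \<in> cell n i" "\<bar>i - j\<bar> \<le> 10"
  shows "dist x y \<le> 12 * size n"
proof -
  have "dist x y \<le> \<bar>h x - h y\<bar> + size n / 32"
    using assms(4) by (intro good_dist[OF assms(1,2,3)]) auto
  moreover have "h x - h y \<le> (of_int 10 + 1) * size n" "h y - h x \<le> (of_int 10 + 1) * size n"
    using assms(4) by (intro cell_h_diff_le[OF assms(3,2)] cell_h_diff_le[OF assms(2,3)]; simp)+
  ultimately show ?thesis using size_pos[of n] by simp
qed

lemma integral_mean_le:
  assumes [measurable]: "A \<in> sets M" "B \<in> sets M"
    and [measurable]: "(\<lambda>y. \<integral>\<^sup>+ z. g y z * indicator B z \<partial>M) \<in> borel_measurable M"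
    and le: "(\<integral>\<^sup>+ y. (\<integral>\<^sup>+ z. g y z * indicator B z \<partial>M) * indicator A y \<partial>M) \<le> ennreal c"
    and m: "m \<le> measure M B" "0 < m" and c: "0 \<le> c"
  shows "(\<integral>\<^sup>+ y. mean B (g y) * indicator A y \<partial>M) \<le> ennreal (c / m)"
proof -
  have "(\<integral>\<^sup>+ y. mean B (g y) * indicator A y \<partial>M) =
    (\<integral>\<^sup>+ y. ((\<integral>\<^sup>+ z. g y z * indicator B z \<partial>M) * indicator A y) / ennreal (measure M B) \<partial>M)"
    by (intro nn_integral_cong) (simp add: mean_def ennreal_times_divide mult.commute)
  also have "\<dots> = (\<integral>\<^sup>+ y. (\<integral>\<^sup>+ z. g y z * indicator B z \<partial>M) * indicator A y \<partial>M) / ennreal (measure M B)"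
    by (rule nn_integral_divide) measurable
  also have "\<dots> \<le> ennreal c / ennreal (measure M B)"
    by (intro divide_right_mono_ennreal le)
  also have "\<dots> = ennreal (c / measure M B)"
    using m c by (intro divide_ennreal) auto
  also have "\<dots> \<le> ennreal (c / m)"
    using m c by (intro ennreal_leI divide_left_mono mult_pos_pos) auto
  finally show ?thesis .
qed

lemma mean_mean_le:
  assumes [measurable]: "A \<in> sets M" "B \<in> sets M"
    and [measurable]: "(\<lambda>y. \<integral>\<^sup>+ z. g y z * indicator B z \<partial>M) \<in> borel_measurable M"
    and le: "(\<integral>\<^sup>+ y. (\<integral>\<^sup>+ z. g y z * indicator B z \<partial>M) * indicator A y \<partial>M) \<le> ennreal c"
    and m: "m \<le> measure M A" "m' \<le> measure M B" "0 < m" "0 < m'" and c: "0 \<le> c"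
  shows "mean A (\<lambda>y. mean B (g y)) \<le> ennreal (c / m' / m)"
  using m c by (intro mean_le_bound[OF integral_mean_le[OF assms(1-4)]]) auto

text \<open>The numerical factors in front of \<open>\<epsilon>\<close> in the local estimates all
  stay below \<open>2 ^ 100\<close>, so that each such term is negligible.\<close>

lemma eps_bound: "K \<le> 2 ^ 100 \<Longrightarrow> 0 \<le> K \<Longrightarrow> K * \<epsilon> \<le> 1 / 2 ^ 100"
  using mult_mono[of K "2^100" \<epsilon> "1/2^200"] eps_small eps_nonneg by simp

text \<open>A window on the right of \<open>x\<close> is the reference: if \<open>x\<close> lies between \<open>y\<close> and \<open>w\<close>, the tilts of
  \<open>(y, x)\<close> and \<open>(x, w)\<close> add up to the tilt of \<open>(y, w)\<close> plus an excess.\<close>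

lemma tilt_to_left:
  assumes g: "good n j" and l: "j - 10 \<le> l" "l \<le> j - 3" and x: "x \<in> cell n j"
  shows "mean (window n l) (\<lambda>y. ennreal (tilt y x)) \<le> ennreal (size n / 2 ^ 34)"
proof -
  define A where "A = window n l"
  define B where "B = window n (j + 10)"
  have [measurable]: "A \<in> sets M" "B \<in> sets M" by (simp_all add: A_def B_def)
  have AB: "A \<subseteq> space M" "B \<subseteq> space M" by (auto simp: A_def B_def window_def slab_def)
  have [simp]: "x \<in> space M" using cell_h[OF x] by simp
  have reg: "regular n i" if "l \<le> i" "i \<le> j + 10" for i
    using g that l unfolding good_def by auto
  have mass: "size n / 512 \<le> measure M A" "size n / 512 \<le> measure M B"
  proof -
    have "dense n l" "dense n (j + 10)" using reg[of l] reg[of "j + 10"] l by (auto simp: regular_def)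
    then show "size n / 512 \<le> measure M A" "size n / 512 \<le> measure M B"
      unfolding A_def B_def by (blast intro: window_mass)+
  qed
  then have pos: "0 < measure M A" "0 < measure M B" using size_pos[of n] by simp_all
  \<comment> \<open>From \<open>window n l\<close> to \<open>window n (j + 10)\<close> there are
    \<open>m + 1 \<le> 20\<close> consecutive gaps, each of mean tilt at most
    \<open>size n / 2 ^ 40\<close>.\<close>
  define m where "m = nat (j + 9 - l)"
  have m: "l + 1 + int m = j + 10" "real m \<le> 19" using l by (auto simp: m_def)
  have "mean_tilt A B \<le> ennreal ((1 + real m) * size n / 2 ^ 40)"
    using mean_tilt_windows[of l m n] reg m by (simp add: A_def B_def)
  also have "\<dots> \<le> ennreal (20 * size n / 2 ^ 40)"
    using m size_pos[of n] by (intro ennreal_leI divide_right_mono mult_right_mono) auto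
  finally have T: "mean_tilt A B \<le> ennreal (20 * size n / 2 ^ 40)" .
  have "mean A (\<lambda>y. mean B (\<lambda>w. ennreal (excess x y w))) \<le>
      ennreal ((12 * size n) ^ 3 * \<epsilon> / (size n / 512) / (size n / 512))"
  proof (rule mean_mean_le)
    show "(\<integral>\<^sup>+ y. (\<integral>\<^sup>+ z. ennreal (excess x y z) * indicator B z \<partial>M) * indicator A y \<partial>M)
      \<le> ennreal ((12 * size n) ^ 3 * \<epsilon>)"
    proof (rule local_excess)
      show "dist x y \<le> 12 * size n" if "y \<in> A" for y
        using that window_cell l by (intro good_dist12[OF g x]) (auto simp: A_def)
      show "dist x y \<le> 12 * size n" if "y \<in> B" for y
        using that window_cell l by (intro good_dist12[OF g x]) (auto simp: B_def)
    qed (use size_pos[of n] in simp_all)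
  qed (use mass size_pos[of n] eps_nonneg in simp_all)
  also have "(12 * size n) ^ 3 * \<epsilon> / (size n / 512) / (size n / 512) = (12 ^ 3 * 512\<^sup>2 * \<epsilon>) * size n"
    using size_pos[of n] by (simp add: field_simps power2_eq_square power3_eq_cube)
  also have "ennreal \<dots> \<le> ennreal (1 / 2 ^ 100 * size n)"
    using size_pos[of n] by (intro ennreal_leI mult_right_mono eps_bound) simp_all
  finally have E: "mean A (\<lambda>y. mean B (\<lambda>w. ennreal (excess x y w))) \<le> ennreal (1 / 2 ^ 100 * size n)" .
  have "mean A (\<lambda>y. ennreal (tilt y x)) = mean A (\<lambda>y. mean B (\<lambda>w. ennreal (tilt y x)))"
    using pos by (simp add: mean_const)
  also have "\<dots> \<le> mean A (\<lambda>y. mean B (\<lambda>w. ennreal (tilt y w) + ennreal (excess x y w)))"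
  proof (intro mean_mono)
    fix y w assume yw: "y \<in> A" "w \<in> B"
    then have yw': "y \<in> cell n l" "w \<in> cell n (j + 10)" using window_cell by (auto simp: A_def B_def)
    have sp: "y \<in> space M" "w \<in> space M" using yw AB by auto
    \<comment> \<open>\<open>x\<close> lies at least two sizes above \<open>y\<close> and nine below
      \<open>w\<close>, much more than the error \<open>size n / 32\<close>; so
      \<open>dist y w\<close> is the longest side and the excess is a defect in the triangle
      inequality.\<close>
    have h1: "(of_int 3 - 1) * size n \<le> h x - h y" using l by (intro cell_h_diff_ge[OF yw'(1) x]) simp
    have h2: "(of_int 10 - 1) * size n \<le> h w - h x" by (intro cell_h_diff_ge[OF x yw'(2)]) simp
    have yx: "dist x y \<le> h x - h y + size n / 32"
      using good_dist[OF g x yw'(1)] l h1 size_pos[of n] by simp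
    have xw: "dist x w \<le> h w - h x + size n / 32"
      using good_dist[OF g x yw'(2)] h2 size_pos[of n] by simp
    have yw_ge: "h w - h y \<le> dist y w" using h_lip[OF sp] by linarith
    have "excess y x w = dist y x + dist x w - dist y w"
      using yx xw yw_ge h1 h2 size_pos[of n] by (intro excess_middle) (simp_all add: dist_commute)
    then have "tilt y x + tilt x w = tilt y w + excess x y w"
      using h1 h2 size_pos[of n] by (simp add: tilt_def excess_rotate[of x y w])
    moreover have "0 \<le> tilt x w" using sp by (simp add: tilt_nonneg)
    ultimately have "tilt y x \<le> tilt y w + excess x y w" by linarith
    then show "ennreal (tilt y x) \<le> ennreal (tilt y w) + ennreal (excess x y w)"
      using sp by (simp add: tilt_nonneg excess_nonneg flip: ennreal_plus)
  qed
  also have "\<dots> = mean A (\<lambda>y. mean B (\<lambda>w. ennreal (tilt y w)) + mean B (\<lambda>w. ennreal (excess x y w)))"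
  proof -
    have "mean B (\<lambda>w. ennreal (tilt y w) + ennreal (excess x y w)) =
      mean B (\<lambda>w. ennreal (tilt y w)) + mean B (\<lambda>w. ennreal (excess x y w))" if "y \<in> A" for y
    proof -
      have [simp]: "y \<in> space M" using that AB by auto
      show ?thesis by (rule mean_add) measurable
    qed
    then show ?thesis by (intro antisym mean_mono) auto
  qed
  also have "\<dots> = mean_tilt A B + mean A (\<lambda>y. mean B (\<lambda>w. ennreal (excess x y w)))"
    unfolding mean_tilt_def by (rule mean_add) measurable
  also have "\<dots> \<le> ennreal (20 * size n / 2 ^ 40) + ennreal (1 / 2 ^ 100 * size n)"
    by (intro add_mono T E)
  also have "\<dots> = ennreal (20 * size n / 2 ^ 40 + 1 / 2 ^ 100 * size n)"
    using size_pos[of n] by (intro ennreal_plus[symmetric]) auto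
  also have "\<dots> \<le> ennreal (size n / 2 ^ 34)"
    using size_pos[of n] by (intro ennreal_leI) simp
  finally show ?thesis by (simp add: A_def)
qed

text \<open>A window to the left of both points serves as a common observer. Seen from its points
  \<open>u\<close>, both \<open>x\<close> and \<open>y\<close> are almost aligned on average, so
  \<open>dist x y\<close> exceeds the height difference by little more than the excess of
  \<open>x\<close>, \<open>y\<close>, \<open>u\<close>. Curvature at \<open>x\<close> bounds that
  excess on average, and Markov's inequality bounds the exceptional \<open>y\<close>.\<close>

lemma few_tilted_cell:
  assumes g: "good n j" "good n j'" and jj: "\<bar>j - j'\<bar> \<le> 6" and x: "x \<in> cell n j"
  shows "measure M {y \<in> cell n j'. size n / 2 ^ 32 < tilt x y} \<le> size n / 2 ^ 100"
proof -
  \<comment> \<open>Ten cells left of the farther cell is at least four cells left of the nearer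
    one. So \<open>tilt_to_left\<close> applies to both points, and the observer is farther from one
    of them than they are from each other.\<close>
  define l where "l = max j j' - 10"
  define W where "W = window n l"
  have l: "j - 10 \<le> l" "l \<le> j - 3" "j' - 10 \<le> l" "l \<le> j' - 3" using jj by (auto simp: l_def)
  have [measurable]: "W \<in> sets M" by (simp add: W_def)
  have Wsp: "W \<subseteq> space M" by (auto simp: W_def window_def slab_def)
  have [simp]: "x \<in> space M" using cell_h[OF x] by simp
  have "regular n l" using g(1) l unfolding good_def by auto
  then have mass: "size n / 512 \<le> measure M W" using window_mass[of n l] unfolding W_def regular_def by blast
  then have pos: "0 < measure M W" using size_pos[of n] by simp
  define G where "G y = mean W (\<lambda>u. ennreal (excess x y u))" for y
  have [measurable]: "G \<in> borel_measurable M" unfolding G_def by measurable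
  have "(\<integral>\<^sup>+ y. G y * indicator (cell n j') y \<partial>M) \<le> ennreal ((12 * size n) ^ 3 * \<epsilon> / (size n / 512))"
    unfolding G_def
  proof (rule integral_mean_le)
    show "(\<integral>\<^sup>+ y. (\<integral>\<^sup>+ z. ennreal (excess x y z) * indicator W z \<partial>M) * indicator (cell n j') y \<partial>M)
      \<le> ennreal ((12 * size n) ^ 3 * \<epsilon>)"
    proof (rule local_excess)
      show "dist x y \<le> 12 * size n" if "y \<in> cell n j'" for y
        using that jj by (intro good_dist12[OF g(1) x]) auto
      show "dist x y \<le> 12 * size n" if "y \<in> W" for y
        using that window_cell l by (intro good_dist12[OF g(1) x]) (auto simp: W_def)
    qed (use size_pos[of n] in simp_all)
  qed (use mass size_pos[of n] eps_nonneg in simp_all)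
  also have "(12 * size n) ^ 3 * \<epsilon> / (size n / 512) = (12 ^ 3 * 512 * \<epsilon>) * (size n)\<^sup>2"
    using size_pos[of n] by (simp add: field_simps power2_eq_square power3_eq_cube)
  finally have int_G: "(\<integral>\<^sup>+ y. G y * indicator (cell n j') y \<partial>M) \<le> ennreal ((12 ^ 3 * 512 * \<epsilon>) * (size n)\<^sup>2)" .
  have ptw: "ennreal (tilt x y) \<le> ennreal (size n / 2 ^ 33) + G y" if y: "y \<in> cell n j'" for y
  proof -
    have [simp]: "y \<in> space M" using cell_h[OF y] by simp
    have "ennreal (tilt x y) = mean W (\<lambda>u. ennreal (tilt x y))" using pos by (simp add: mean_const)
    also have "\<dots> \<le> mean W (\<lambda>u. ennreal (tilt u x) + ennreal (tilt u y) + ennreal (excess x y u))"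
    proof (intro mean_mono)
      fix u assume u: "u \<in> W"
      then have uc: "u \<in> cell n l" and usp: "u \<in> space M" using window_cell Wsp by (auto simp: W_def)
      have hu: "h u < (of_int l + 3/8) * size n" using u window_h by (auto simp: W_def)
      have hx: "of_int j * size n \<le> h x" "of_int j' * size n \<le> h y"
        using cell_h[OF x] cell_h[OF y] by auto
      have xy: "dist x y \<le> \<bar>h x - h y\<bar> + size n / 32"
        using jj by (intro good_dist[OF g(1) x y]) auto
      have h6: "h x - h y \<le> (of_int 6 + 1) * size n" "h y - h x \<le> (of_int 6 + 1) * size n"
        using jj by (intro cell_h_diff_le[OF y x] cell_h_diff_le[OF x y]; simp)+
      have h3: "(of_int 3 - 1) * size n \<le> h x - h u" "(of_int 3 - 1) * size n \<le> h y - h u"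
        using l by (intro cell_h_diff_ge[OF uc x] cell_h_diff_ge[OF uc y]; simp)+
      have h9: "9 * size n \<le> h x - h u \<or> 9 * size n \<le> h y - h u"
      proof (cases "j \<le> j'")
        case True
        then have "j' = l + 10" by (simp add: l_def)
        then have "of_int j' * size n = of_int l * size n + 10 * size n" by (simp add: algebra_simps)
        then show ?thesis using hu hx size_pos[of n] by (simp add: algebra_simps)
      next
        case False
        then have "j = l + 10" by (simp add: l_def)
        then have "of_int j * size n = of_int l * size n + 10 * size n" by (simp add: algebra_simps)
        then show ?thesis using hu hx size_pos[of n] by (simp add: algebra_simps)
      qed
      have ge: "h x - h u \<le> dist u x" "h y - h u \<le> dist u y"
        using h_lip[OF usp, of x] h_lip[OF usp, of y] by auto
      have "dist x y \<le> 8 * size n" using xy h6 size_pos[of n] by simp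
      then have "dist x y \<le> max (dist u x) (dist u y)"
        using h9 ge size_pos[of n] by (auto simp: le_max_iff_disj)
      \<comment> \<open>As \<open>dist x y\<close> does not exceed the longer of the other two
        sides, the excess is \<open>dist x y\<close> minus the difference of these sides.\<close>
      then have "dist x y \<le> \<bar>dist u x - dist u y\<bar> + excess x y u"
        unfolding excess_def by (auto simp: max_def dist_commute)
      moreover have "dist u x = h x - h u + tilt u x" "dist u y = h y - h u + tilt u y"
        using h3 size_pos[of n] by (auto simp: tilt_def)
      moreover have "0 \<le> tilt u x" "0 \<le> tilt u y" using usp by (auto simp: tilt_nonneg)
      ultimately have "tilt x y \<le> tilt u x + tilt u y + excess x y u"
        unfolding tilt_def[of x y] by linarith
      then show "ennreal (tilt x y) \<le> ennreal (tilt u x) + ennreal (tilt u y) + ennreal (excess x y u)"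
        using usp by (simp add: tilt_nonneg excess_nonneg flip: ennreal_plus)
    qed
    also have "\<dots> = mean W (\<lambda>u. ennreal (tilt u x)) + mean W (\<lambda>u. ennreal (tilt u y)) + G y"
      unfolding G_def by (subst mean_add[of W "\<lambda>u. ennreal (tilt u x) + ennreal (tilt u y)"
        "\<lambda>u. ennreal (excess x y u)"]; (subst mean_add)?; measurable?) 
    also have "\<dots> \<le> ennreal (size n / 2 ^ 34) + ennreal (size n / 2 ^ 34) + G y"
      unfolding W_def using l g x y by (intro add_mono tilt_to_left order_refl) auto
    also have "ennreal (size n / 2 ^ 34) + ennreal (size n / 2 ^ 34) = ennreal (size n / 2 ^ 33)"
      using size_pos[of n] by (simp flip: ennreal_plus)
    finally show ?thesis .
  qed
  define Bad where "Bad = {y \<in> cell n j'. size n / 2 ^ 32 < tilt x y}"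
  have [measurable]: "Bad \<in> sets M" unfolding Bad_def by (intro sets_tilt_gt) auto
  have "ennreal (size n / 2 ^ 33 * measure M Bad) = (\<integral>\<^sup>+ y. ennreal (size n / 2 ^ 33) * indicator Bad y \<partial>M)"
    using size_pos[of n] by (simp add: nn_integral_cmult_indicator emeasure_eq_measure flip: ennreal_mult)
  also have "\<dots> \<le> (\<integral>\<^sup>+ y. G y * indicator (cell n j') y \<partial>M)"
  proof (intro nn_integral_mono)
    fix y show "ennreal (size n / 2 ^ 33) * indicator Bad y \<le> G y * indicator (cell n j') y"
    proof (cases "y \<in> Bad")
      case True
      then have y: "y \<in> cell n j'" "size n / 2 ^ 32 < tilt x y" by (auto simp: Bad_def)
      \<comment> \<open>The two averaged tilts use up half of the threshold
        \<open>size n / 2 ^ 32\<close>, so on \<open>Bad\<close> the mean excess \<open>G\<close>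
        must supply the other half.\<close>
      have "ennreal (size n / 2 ^ 33) + ennreal (size n / 2 ^ 33) = ennreal (size n / 2 ^ 32)"
        using size_pos[of n] by (simp flip: ennreal_plus)
      also have "\<dots> \<le> ennreal (tilt x y)" using y(2) by (intro ennreal_leI) simp
      also have "\<dots> \<le> ennreal (size n / 2 ^ 33) + G y" by (rule ptw[OF y(1)])
      finally have "ennreal (size n / 2 ^ 33) \<le> G y" by (simp add: ennreal_add_left_cancel_le)
      then show ?thesis using True y by simp
    qed simp
  qed
  also note int_G
  finally have "size n / 2 ^ 33 * measure M Bad \<le> (12 ^ 3 * 512 * \<epsilon>) * (size n)\<^sup>2"
    using eps_nonneg by (subst (asm) ennreal_le_iff) auto
  then have "size n * measure M Bad \<le> size n * ((2 ^ 33 * (12 ^ 3 * 512) * \<epsilon>) * size n)"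
    by (simp add: field_simps power2_eq_square)
  then have "measure M Bad \<le> (2 ^ 33 * (12 ^ 3 * 512) * \<epsilon>) * size n"
    using size_pos[of n] by (simp only: mult_le_cancel_left_pos)
  also have "\<dots> \<le> 1 / 2 ^ 100 * size n"
    using size_pos[of n] by (intro mult_right_mono eps_bound) auto
  finally show ?thesis by (simp add: Bad_def)
qed

text \<open>This is \<open>mass_le_length\<close> at the scale of a good cell. With
  \<open>2 ^ 24\<close> slices, the slice width, the tolerated tilt, the mass lost in thin slices
  and the factor \<open>1 + \<epsilon>\<close> cost less than \<open>size n / 2 ^ 20\<close>
  together.\<close>

lemma mass_subslab:
  assumes g: "good n j" and ab: "of_int j * size n \<le> a" "a \<le> b" "b \<le> (of_int j + 1) * size n"
  shows "measure M (slab a b) \<le> b - a + size n / 2 ^ 20"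
proof (cases "a = b")
  case True
  then have "slab a b = {}" by (auto simp: slab_def)
  then show ?thesis using True size_pos[of n] by simp
next
  case False
  have sub: "slab a b \<subseteq> cell n j" using ab by (auto simp: cell_def slab_def)
  have l: "0 < b - a" "b - a \<le> size n" using ab False by (auto simp: algebra_simps)
  have "measure M (slab a b) \<le> (1 + \<epsilon>) * ((b - a) + 2 * size n / real (2 ^ 24) + 2 * (size n / 2 ^ 32))
      + 2 * real (2 ^ 24) * (size n / 2 ^ 100)"
  proof (rule mass_le_length[where a = a])
    fix x assume x: "x \<in> slab a b"
    then have xc: "x \<in> cell n j" using sub by auto
    then have [simp]: "x \<in> space M" using cell_h by auto
    have "measure M {y \<in> slab a b. size n / 2 ^ 32 < tilt x y} \<le> measure M {y \<in> cell n j. size n / 2 ^ 32 < tilt x y}"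
      using sub by (intro finite_measure_mono sets_tilt_gt) auto
    also have "\<dots> \<le> size n / 2 ^ 100" using xc g by (intro few_tilted_cell) auto
    finally show "measure M {y \<in> slab a b. size n / 2 ^ 32 < tilt x y} \<le> size n / 2 ^ 100" .
  qed (use l size_pos[of n] in auto)
  also have "\<dots> = ((b - a) + 2 * size n / real (2 ^ 24) + 2 * (size n / 2 ^ 32))
      + \<epsilon> * ((b - a) + 2 * size n / real (2 ^ 24) + 2 * (size n / 2 ^ 32)) + 2 * real (2 ^ 24) * (size n / 2 ^ 100)"
    by (simp only: distrib_right mult_1_left)
  also have "\<epsilon> * ((b - a) + 2 * size n / real (2 ^ 24) + 2 * (size n / 2 ^ 32)) \<le> 1 / 2 ^ 200 * (4 * size n)"
    using l size_pos[of n] eps_nonneg eps_small by (intro mult_mono) auto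
  finally show ?thesis using size_pos[of n] by simp
qed

lemma cell_bin:
  assumes "x \<in> cell n j"
  obtains t where "t < 256" "x \<in> bin n j t"
proof
  define X where "X = h x / size n - of_int j"
  define t where "t = nat \<lfloor>X * 256\<rfloor>"
  have r: "0 \<le> X" "X < 1"
    using cell_h[OF assms] size_pos[of n] by (auto simp: X_def field_simps)
  then have t: "real t = of_int \<lfloor>X * 256\<rfloor>" unfolding t_def by simp
  have rt: "real t \<le> X * 256" "X * 256 < real t + 1"
    unfolding t by linarith+
  then have q: "of_int j + real t / 256 \<le> of_int j + X" "of_int j + X < of_int j + (real t + 1) / 256"
    by simp_all
  have "h x = (of_int j + X) * size n" using size_pos[of n] by (simp add: X_def)
  then show "x \<in> bin n j t"
    using size_pos[of n] cell_h[OF assms] q unfolding bin_def slab_def by simp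
  have "real t < 256" using rt r by linarith
  then show "t < 256" by simp
qed

lemma bin_close:
  assumes "x \<in> bin n j t" "y \<in> bin n j t" shows "\<bar>h x - h y\<bar> \<le> size n / 256"
proof -
  have "(of_int j + (real t + 1) / 256) * size n = (of_int j + real t / 256) * size n + size n / 256"
    by (simp add: algebra_simps add_divide_distrib)
  moreover have "(of_int j + real t / 256) * size n \<le> h x" "(of_int j + real t / 256) * size n \<le> h y"
    "h x < (of_int j + (real t + 1) / 256) * size n" "h y < (of_int j + (real t + 1) / 256) * size n"
    using assms by (auto simp: bin_def slab_def)
  ultimately show ?thesis by linarith
qed

text \<open>The bin of \<open>x\<close> is the proxy set: most of it is aligned with both points,
  and its heights vary by \<open>size n / 256\<close> only. The point is the gain of a factor two
  over \<open>near\<close>: since \<open>size n / 64 = size (Suc n) / 32\<close>, this is what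
  \<open>near\<close> demands of the children.\<close>

lemma good_pairs_close:
  assumes g: "good n j" "good n j'" and jj: "\<bar>j - j'\<bar> \<le> 6" and x: "x \<in> cell n j" and y: "y \<in> cell n j'"
  shows "dist x y \<le> \<bar>h x - h y\<bar> + size n / 64"
proof -
  obtain t where t: "t < 256" "x \<in> bin n j t" using cell_bin[OF x] .
  have sp: "x \<in> space M" "y \<in> space M" using cell_h[OF x] cell_h[OF y] by auto
  have sub: "bin n j t \<subseteq> cell n j" using t by (intro bin_cell)
  have bad: "measure M {u \<in> bin n j t. size n / 2 ^ 32 < tilt z u} \<le> size n / 2 ^ 100"
    if "z \<in> cell n i" "good n i" "\<bar>i - j\<bar> \<le> 6" for z i
  proof -
    have "z \<in> space M" using cell_h[OF that(1)] by auto
    then have "measure M {u \<in> bin n j t. size n / 2 ^ 32 < tilt z u} \<le> measure M {u \<in> cell n j. size n / 2 ^ 32 < tilt z u}"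
      using sub by (intro finite_measure_mono sets_tilt_gt) auto
    also have "\<dots> \<le> size n / 2 ^ 100" using that g by (intro few_tilted_cell) auto
    finally show ?thesis .
  qed
  have "dist x y \<le> \<bar>h x - h y\<bar> + 2 * (size n / 256) + 2 * (size n / 2 ^ 32)"
  proof (rule dist_le_via_proxy[OF sp, where C = "bin n j t"])
    show "\<bar>h x - h u\<bar> \<le> size n / 256" if "u \<in> bin n j t" for u using t(2) that by (rule bin_close)
    show "measure M {u \<in> bin n j t. size n / 2 ^ 32 < tilt x u} \<le> size n / 2 ^ 100"
      using bad[OF x g(1)] by simp
    show "measure M {u \<in> bin n j t. size n / 2 ^ 32 < tilt y u} \<le> size n / 2 ^ 100"
      using bad[OF y g(2)] jj by simp
    have "regular n j" using g(1) unfolding good_def by auto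
    then have "size n / 512 \<le> measure M (bin n j t)" using t by (auto simp: regular_def dense_def)
    then show "2 * (size n / 2 ^ 100) < measure M (bin n j t)" using size_pos[of n] by simp
  qed simp
  then show ?thesis using size_pos[of n] by simp
qed

section \<open>The coarsest scale\<close>

lemma size_0: "size 0 = L / 1024" by (simp add: size_def)

text \<open>The numeral is \<open>2 ^ 100\<close>. Likewise \<open>1099511627776\<close>,
  \<open>1125899906842624\<close> and \<open>1152921504606846976\<close> below are
  \<open>2 ^ 40\<close>, \<open>2 ^ 50\<close> and \<open>2 ^ 60\<close>.\<close>

lemma eps_L: "\<epsilon> * L \<le> L / 1267650600228229401496703205376"
proof -
  have "\<epsilon> * L \<le> 1 / 2 ^ 200 * L" using eps_small L_pos by (intro mult_right_mono) auto
  also have "\<dots> \<le> L / 1267650600228229401496703205376" using L_pos by simp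
  finally show ?thesis .
qed

lemma few_tilted_subset:
  assumes "x \<in> space M" "A \<in> sets M"
  shows "measure M {y \<in> A. \<epsilon> * L < tilt x y} \<le> \<epsilon> * L"
proof -
  have "measure M {y \<in> A. \<epsilon> * L < tilt x y} \<le> measure M {y \<in> space M. \<epsilon> * L < tilt x y}"
    using assms sets.sets_into_space[OF assms(2)] by (intro finite_measure_mono sets_tilt_gt) auto
  also have "\<dots> \<le> \<epsilon> * L" using assms by (intro few_tilted)
  finally show ?thesis .
qed

text \<open>The slicing argument again, now fed with the global hypothesis \<open>few_tilted\<close>
  instead of the estimate in a good cell, hence valid for slabs in any position.\<close>

lemma mass_slab:
  assumes "a \<le> b" "b \<le> a + 2 * L"
  shows "measure M (slab a b) \<le> b - a + L / 1099511627776"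
proof (cases "a = b")
  case True
  then have "slab a b = {}" by (auto simp: slab_def)
  then show ?thesis using True L_pos by simp
next
  case False
  have l: "0 < b - a" "b - a \<le> 2 * L" using assms False by auto
  have eL: "0 \<le> \<epsilon> * L" "\<epsilon> * L \<le> 1 / 2 ^ 200 * L"
    using eps_nonneg eps_small L_pos by (auto intro: mult_right_mono)
  have "measure M (slab a b) \<le> (1 + \<epsilon>) * ((b - a) + 2 * (2 * L) / 1125899906842624 + 2 * (\<epsilon> * L))
      + 2 * 1125899906842624 * (\<epsilon> * L)"
  proof (rule mass_le_length[where a = a and N = 1125899906842624, simplified of_nat_numeral])
    fix x assume "x \<in> slab a b"
    then have "x \<in> space M" by (simp add: slab_def)
    then show "measure M {y \<in> slab a b. \<epsilon> * L < tilt x y} \<le> \<epsilon> * L"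
      by (rule few_tilted_subset) simp
  qed (use l eL in auto)
  also have "\<dots> = ((b - a) + 2 * (2 * L) / 1125899906842624 + 2 * (\<epsilon> * L))
      + \<epsilon> * ((b - a) + 2 * (2 * L) / 1125899906842624 + 2 * (\<epsilon> * L)) + 2 * 1125899906842624 * (\<epsilon> * L)"
    by (simp only: distrib_right mult_1_left)
  also have "\<epsilon> * ((b - a) + 2 * (2 * L) / 1125899906842624 + 2 * (\<epsilon> * L)) \<le> \<epsilon> * (4 * L)"
  proof (intro mult_left_mono)
    have "2 * (\<epsilon> * L) \<le> L" using eps_L L_pos by linarith
    moreover have "2 * (2 * L) / 1125899906842624 \<le> L" using L_pos by simp
    ultimately show "b - a + 2 * (2 * L) / 1125899906842624 + 2 * (\<epsilon> * L) \<le> 4 * L" using l L_pos by linarith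
  qed (rule eps_nonneg)
  finally show ?thesis using eps_L L_pos by linarith
qed

lemma mass_space: "measure M (space M) \<le> 3 * L"
proof -
  \<comment> \<open>Slabs are open on the right, so \<open>slab 0 L\<close> could miss points with
    \<open>h x = L\<close>.\<close>
  have "space M \<subseteq> slab 0 (2 * L)" using h_range L_pos by (force simp: slab_def)
  then have "measure M (space M) \<le> measure M (slab 0 (2 * L))" by (intro finite_measure_mono) auto
  also have "\<dots> \<le> 2 * L - 0 + L / 1099511627776" using L_pos by (intro mass_slab) auto
  finally show ?thesis using L_pos by simp
qed

text \<open>By subtraction: the slabs on both sides of the bin carry hardly more than their lengths
  while the whole space carries almost \<open>L\<close>, so the bin carries almost its length, twice
  what is asked.\<close>

lemma dense_0:
  assumes j: "0 \<le> j" "j \<le> 1023"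
  shows "dense 0 j"
  unfolding dense_def
proof (intro allI impI)
  fix t :: nat assume t: "t < 256"
  define a where "a = (of_int j + real t / 256) * size 0"
  define b where "b = (of_int j + (real t + 1) / 256) * size 0"
  have ba: "b = a + size 0 / 256" by (simp add: a_def b_def algebra_simps add_divide_distrib)
  have a0: "0 \<le> a" using j size_pos[of 0] by (simp add: a_def)
  have "real t + 1 \<le> 256" using t by simp
  moreover have "of_int j \<le> (1023 :: real)" using j by simp
  ultimately have "of_int j + (real t + 1) / 256 \<le> 1024" by (simp add: field_simps)
  then have "b \<le> 1024 * size 0" using size_pos[of 0] unfolding b_def by (intro mult_right_mono) auto
  then have bL: "b \<le> L" by (simp add: size_0)
  have eL: "\<epsilon> * L \<le> 1 / 2 ^ 200 * L" using eps_small L_pos by (auto intro: mult_right_mono)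
  have "space M \<subseteq> slab 0 a \<union> (bin 0 j t \<union> slab b (L + L / 1099511627776))"
    using h_range L_pos by (force simp: slab_def bin_def a_def b_def)
  then have "measure M (space M) \<le> measure M (slab 0 a \<union> (bin 0 j t \<union> slab b (L + L / 1099511627776)))"
    by (intro finite_measure_mono) auto
  also have "\<dots> \<le> measure M (slab 0 a) + measure M (bin 0 j t \<union> slab b (L + L / 1099511627776))"
    by (intro measure_Un_le) auto
  also have "\<dots> \<le> measure M (slab 0 a) + (measure M (bin 0 j t) + measure M (slab b (L + L / 1099511627776)))"
    by (intro add_left_mono measure_Un_le) auto
  also have "measure M (slab 0 a) \<le> a - 0 + L / 1099511627776"
    using a0 ba bL L_pos size_pos[of 0] by (intro mass_slab) auto
  also have "measure M (slab b (L + L / 1099511627776)) \<le> L + L / 1099511627776 - b + L / 1099511627776"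
  proof (intro mass_slab)
    show "b \<le> L + L / 1099511627776" using bL L_pos by (simp add: add_increasing2)
    show "L + L / 1099511627776 \<le> b + 2 * L" using ba a0 size_pos[of 0] L_pos by simp
  qed
  finally have "L - \<epsilon> * L \<le> a - 0 + L / 1099511627776 + (measure M (bin 0 j t) + (L + L / 1099511627776 - b + L / 1099511627776))"
    using full_mass by (simp add: left_diff_distrib)
  then have "L / 1024 / 512 \<le> measure M (bin 0 j t)"
    using eps_L ba L_pos unfolding size_0 by linarith
  then show "size 0 / 512 \<le> measure M (bin 0 j t)"
    by (simp add: size_0)
qed

lemma close_0:
  assumes j: "0 \<le> j" "j \<le> 1023" and x: "x \<in> cell 0 j" and y: "y \<in> space M"
  shows "dist x y \<le> \<bar>h x - h y\<bar> + size 0 / 64"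
proof -
  obtain t where t: "t < 256" "x \<in> bin 0 j t" using cell_bin[OF x] .
  have eL: "\<epsilon> * L \<le> 1 / 2 ^ 200 * L" using eps_small L_pos by (auto intro: mult_right_mono)
  have xs: "x \<in> space M" using cell_h[OF x] by simp
  have "dist x y \<le> \<bar>h x - h y\<bar> + 2 * (size 0 / 256) + 2 * (\<epsilon> * L)"
  proof (rule dist_le_via_proxy[OF xs y, where C = "bin 0 j t"])
    show "\<bar>h x - h u\<bar> \<le> size 0 / 256" if "u \<in> bin 0 j t" for u using t(2) that by (rule bin_close)
    have "size 0 / 512 \<le> measure M (bin 0 j t)" using dense_0[OF j] t by (auto simp: dense_def)
    moreover have "2 * (\<epsilon> * L) < L / 1024 / 512" using eps_L L_pos by linarith
    ultimately show "2 * (\<epsilon> * L) < measure M (bin 0 j t)" by (simp add: size_0)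
  qed (use xs y in \<open>auto intro: few_tilted_subset\<close>)
  then show ?thesis using eps_L L_pos unfolding size_0 by linarith
qed

text \<open>Outside a set of mass \<open>\<epsilon> * L\<close> the tilt is at most
  \<open>\<epsilon> * L\<close>, and on that set it is at most \<open>L\<close>. The bound lies far
  below the threshold of \<open>regular\<close> because the sum of these means is later divided by
  that threshold.\<close>

lemma mean_tilt_0:
  assumes j: "0 \<le> j" "j \<le> 1022"
  shows "mean_tilt (window 0 j) (window 0 (j + 1)) \<le> ennreal (size 0 / 2 ^ 60)"
proof -
  define B where "B = window 0 (j + 1)"
  have [measurable]: "B \<in> sets M" by (simp add: B_def)
  have Bs: "B \<subseteq> space M" by (auto simp: B_def window_def slab_def)
  have eL: "0 \<le> \<epsilon> * L" "\<epsilon> * L \<le> 1 / 2 ^ 200 * L"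
    using eps_nonneg eps_small L_pos by (auto intro: mult_right_mono)
  have "mean B (\<lambda>y. ennreal (tilt x y)) \<le> ennreal (size 0 / 2 ^ 60)" if x: "x \<in> window 0 j" for x
  proof -
    have xc: "x \<in> cell 0 j" "x \<in> space M" using x window_cell window_h by auto
    define Bad where "Bad = {y \<in> space M. \<epsilon> * L < tilt x y}"
    have [measurable]: "Bad \<in> sets M" unfolding Bad_def using xc by (intro sets_tilt_gt) auto
    have "(\<integral>\<^sup>+ y. ennreal (tilt x y) * indicator B y \<partial>M) \<le>
      (\<integral>\<^sup>+ y. ennreal (\<epsilon> * L) * indicator (space M) y + ennreal L * indicator Bad y \<partial>M)"
    proof (intro nn_integral_mono)
      fix y assume y: "y \<in> space M"
      have "tilt x y \<le> size 0 / 64" using close_0[OF _ _ xc(1) y] j by (simp add: tilt_def)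
      then have "tilt x y \<le> L" using L_pos by (simp add: size_0)
      then show "ennreal (tilt x y) * indicator B y \<le>
          ennreal (\<epsilon> * L) * indicator (space M) y + ennreal L * indicator Bad y"
        using y Bs eL by (auto simp: indicator_def Bad_def intro!: ennreal_leI add_increasing)
    qed
    also have "\<dots> = ennreal (\<epsilon> * L) * emeasure M (space M) + ennreal L * emeasure M Bad"
      by (simp add: nn_integral_add nn_integral_cmult_indicator)
    also have "\<dots> = ennreal (\<epsilon> * L * measure M (space M) + L * measure M Bad)"
      using eL L_pos by (simp add: emeasure_eq_measure ennreal_mult ennreal_plus)
    also have "\<dots> \<le> ennreal (\<epsilon> * L * (3 * L) + L * (\<epsilon> * L))"
      using eL L_pos mass_space few_tilted[OF xc(2)] unfolding Bad_def
      by (intro ennreal_leI add_mono mult_left_mono) auto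
    finally have "(\<integral>\<^sup>+ y. ennreal (tilt x y) * indicator B y \<partial>M) \<le> ennreal (4 * (\<epsilon> * L) * L)"
      by (simp add: algebra_simps)
    moreover have "dense 0 (j + 1)" using j by (intro dense_0) auto
    then have "size 0 / 512 \<le> measure M B" unfolding B_def by (rule window_mass)
    ultimately have "mean B (\<lambda>y. ennreal (tilt x y)) \<le> ennreal (4 * (\<epsilon> * L) * L / (size 0 / 512))"
      using size_pos[of 0] eL L_pos by (intro mean_le_bound) auto
    also have "4 * (\<epsilon> * L) * L / (size 0 / 512) = 2 ^ 21 * (\<epsilon> * L)"
      using L_pos by (simp add: size_0)
    also have "ennreal \<dots> \<le> ennreal (size 0 / 2 ^ 60)"
      using eL L_pos by (intro ennreal_leI) (simp add: size_0)
    finally show ?thesis .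
  qed
  then have "mean_tilt (window 0 j) B \<le> mean (window 0 j) (\<lambda>_. ennreal (size 0 / 2 ^ 60))"
    unfolding mean_tilt_def by (intro mean_mono)
  moreover have "dense 0 j" using j by (intro dense_0) auto
  then have "0 < measure M (window 0 j)" by (rule window_mass_pos)
  ultimately show ?thesis by (simp add: mean_const B_def)
qed

lemma good_0:
  assumes "10 \<le> j" "j \<le> 1012"
  shows "good 0 j"
  unfolding good_def near_def regular_def
proof (intro conjI allI impI ballI)
  fix i i' x y assume i: "\<bar>i - j\<bar> \<le> 10 \<and> \<bar>i' - j\<bar> \<le> 10 \<and> \<bar>i - i'\<bar> \<le> 10"
    and xy: "x \<in> cell 0 i" "y \<in> cell 0 i'"
  have "dist x y \<le> \<bar>h x - h y\<bar> + size 0 / 64"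
    using i assms xy cell_h[OF xy(2)] by (intro close_0[OF _ _ xy(1)]) auto
  then show "dist x y \<le> \<bar>h x - h y\<bar> + size 0 / 32" using size_pos[of 0] by simp
next
  fix i assume i: "\<bar>i - j\<bar> \<le> 10"
  show "dense 0 i" using i assms by (intro dense_0) auto
  show "mean_tilt (window 0 i) (window 0 (i + 1)) \<le> ennreal (size 0 / 2 ^ 40)"
  proof (rule order_trans[OF mean_tilt_0])
    show "ennreal (size 0 / 2 ^ 60) \<le> ennreal (size 0 / 2 ^ 40)"
      using size_pos[of 0] by (intro ennreal_leI) simp
  qed (use i assms in auto)
qed

subsection \<open>The stopping construction\<close>

text \<open>The initial cells 10 to 1012 are those for which all cells within ten, and the right
  neighbours of these, have indices from 0 to 1023. Later the whole neighbourhood must survive, not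
  just the ancestors, since the estimates in a good cell use windows up to ten cells away.\<close>

fun alive :: "nat \<Rightarrow> int \<Rightarrow> bool" where
  "alive 0 j \<longleftrightarrow> 10 \<le> j \<and> j \<le> 1012"
| "alive (Suc n) i \<longleftrightarrow> (\<forall>i'. \<bar>i' - i\<bar> \<le> 10 \<longrightarrow> alive n (i' div 2) \<and> regular (Suc n) i')"

lemma alive_parent: "alive (Suc n) i \<Longrightarrow> alive n (i div 2)"
  by auto

lemma cell_parent: "cell (Suc n) i \<subseteq> cell n (i div 2)"
proof
  fix x assume "x \<in> cell (Suc n) i"
  then have x: "x \<in> space M" "of_int i * size n \<le> 2 * h x" "2 * h x < (of_int i + 1) * size n"
    by (auto simp: cell_def slab_def size_Suc)
  have "of_int (2 * (i div 2)) \<le> (of_int i :: real)" by (subst of_int_le_iff) simp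
  then have "(2 * of_int (i div 2)) * size n \<le> of_int i * size n"
    using size_pos[of n] by (intro mult_right_mono) auto
  moreover have "(of_int (i + 1) :: real) \<le> of_int (2 * (i div 2 + 1))" by (subst of_int_le_iff) simp
  then have "(of_int i + 1) * size n \<le> (2 * (of_int (i div 2) + 1)) * size n"
    using size_pos[of n] by (intro mult_right_mono) auto
  moreover have "(2 * (of_int (i div 2) + 1)) * size n = 2 * ((of_int (i div 2) + 1) * size n)"
    "(2 * of_int (i div 2)) * size n = 2 * (of_int (i div 2) * size n)" by simp_all
  ultimately have "of_int (i div 2) * size n \<le> h x" "h x < (of_int (i div 2) + 1) * size n"
    using x by linarith+
  then show "x \<in> cell n (i div 2)" using x unfolding cell_def slab_def by blast
qed

lemma alive_good: "alive n j \<Longrightarrow> good n j"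
proof (induction n arbitrary: j)
  case 0
  then show ?case by (simp add: good_0)
next
  case (Suc n)
  show ?case unfolding good_def near_def
  proof (intro conjI allI impI ballI)
    fix i i' x y assume i: "\<bar>i - j\<bar> \<le> 10 \<and> \<bar>i' - j\<bar> \<le> 10 \<and> \<bar>i - i'\<bar> \<le> 10"
      and xy: "x \<in> cell (Suc n) i" "y \<in> cell (Suc n) i'"
    have "good n (i div 2)" "good n (i' div 2)" using Suc i by auto
    moreover have "\<bar>i div 2 - i' div 2\<bar> \<le> 6" using i by linarith
    ultimately have "dist x y \<le> \<bar>h x - h y\<bar> + size n / 64"
      using xy cell_parent by (intro good_pairs_close[of n "i div 2" "i' div 2"]) auto
    then show "dist x y \<le> \<bar>h x - h y\<bar> + size (Suc n) / 32" by (simp add: size_Suc)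
  qed (use Suc in auto)
qed

lemma alive_range: "alive n j \<Longrightarrow> 0 \<le> j \<and> j < 1024 * 2 ^ n"
proof (induction n arbitrary: j)
  case (Suc n)
  then have "0 \<le> j div 2 \<and> j div 2 < 1024 * 2 ^ n" by (intro Suc.IH alive_parent)
  then show ?case by auto
qed simp

definition index :: "nat \<Rightarrow> 'a \<Rightarrow> int" where "index n x = \<lfloor>h x / size n\<rfloor>"

lemma cell_index: "x \<in> space M \<Longrightarrow> x \<in> cell n j \<longleftrightarrow> index n x = j"
  using size_pos[of n] unfolding cell_def slab_def index_def floor_eq_iff
  by (auto simp: pos_le_divide_eq pos_divide_less_eq)

definition core :: "'a set" where "core = {x \<in> space M. \<forall>n. alive n (index n x)}"

lemma sets_core [measurable]: "core \<in> sets M"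
proof -
  have [measurable]: "index n \<in> M \<rightarrow>\<^sub>M count_space UNIV" for n
    unfolding index_def by measurable
  show ?thesis unfolding core_def by measurable
qed

text \<open>The decisive scale is the first one at which the cells of \<open>x\<close> and
  \<open>y\<close> are more than six apart. There the heights differ by at least six sizes, whereas
  the preceding scale, or \<open>close_0\<close> at scale zero, limits the error to a small fraction
  of one size. If there is no such scale, the error tends to zero.\<close>

lemma core_expanding:
  assumes "x \<in> core" "y \<in> core"
  shows "dist x y \<le> 2 * \<bar>h x - h y\<bar>"
proof -
  have xs: "x \<in> space M" "y \<in> space M" using assms by (auto simp: core_def)
  have al: "alive n (index n x)" "alive n (index n y)" for n using assms by (auto simp: core_def)
  have c: "x \<in> cell n (index n x)" "y \<in> cell n (index n y)" for n
    using xs cell_index by auto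
  have far: "6 * size n \<le> \<bar>h x - h y\<bar>" if "6 < \<bar>index n x - index n y\<bar>" for n
  proof (cases "index n x < index n y")
    case True
    have "(of_int 7 - 1) * size n \<le> h y - h x" using that True by (intro cell_h_diff_ge[OF c]) auto
    then show ?thesis by simp
  next
    case False
    have "(of_int 7 - 1) * size n \<le> h x - h y" using that False by (intro cell_h_diff_ge[OF c(2) c(1)]) auto
    then show ?thesis by simp
  qed
  have close: "dist x y \<le> \<bar>h x - h y\<bar> + size n / 64" if "\<bar>index n x - index n y\<bar> \<le> 6" for n
    using that al c by (intro good_pairs_close[of n "index n x" "index n y"] alive_good) auto
  show ?thesis
  proof (cases "\<exists>n. 6 < \<bar>index n x - index n y\<bar>")
    case True
    define n where "n = (LEAST n. 6 < \<bar>index n x - index n y\<bar>)"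
    have n: "6 < \<bar>index n x - index n y\<bar>" using LeastI_ex[OF True] by (simp add: n_def)
    show ?thesis
    proof (cases n)
      case 0
      have "dist x y \<le> \<bar>h x - h y\<bar> + size 0 / 64"
        using al(1)[of 0] by (intro close_0[OF _ _ c(1) xs(2)]) auto
      then show ?thesis using far[OF n] 0 size_pos[of 0] by simp
    next
      case (Suc m)
      then have "\<not> 6 < \<bar>index m x - index m y\<bar>" using not_less_Least[of m "\<lambda>n. 6 < \<bar>index n x - index n y\<bar>"]
        by (simp add: n_def)
      then have "dist x y \<le> \<bar>h x - h y\<bar> + size m / 64" by (intro close) simp
      then show ?thesis using far[OF n] Suc size_pos[of m] by (simp add: size_Suc)
    qed
  next
    case False
    then have "dist x y \<le> \<bar>h x - h y\<bar> + size n / 64" for n by (intro close) (simp add: not_less)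
    moreover have "(\<lambda>n. \<bar>h x - h y\<bar> + size n / 64) \<longlonglongrightarrow> \<bar>h x - h y\<bar> + 0 / 64"
    proof (intro tendsto_intros)
      have "(\<lambda>n. (L / 2 ^ 10) * (1 / 2) ^ n) \<longlonglongrightarrow> (L / 2 ^ 10) * 0"
        by (intro tendsto_intros LIMSEQ_realpow_zero) auto
      then show "size \<longlonglongrightarrow> 0" by (simp add: size_def[abs_def] power_add power_one_over field_simps)
    qed auto
    ultimately have "dist x y \<le> \<bar>h x - h y\<bar> + 0 / 64" by (intro LIMSEQ_le_const) auto
    moreover have "a \<le> b + 0 / 64 \<Longrightarrow> 0 \<le> b \<Longrightarrow> a \<le> 2 * b" for a b :: real by simp
    ultimately show ?thesis using abs_ge_zero by blast
  qed
qed

subsection \<open>Total length of the sparse cells\<close>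

definition living :: "nat \<Rightarrow> int set" where "living n = {j. alive n j}"

text \<open>The two parent conditions, shared with \<open>tilted\<close>, single out the finer gaps
  from window \<open>i\<close> to \<open>i + 1\<close> that can be controlled from the coarser
  scale: for \<open>i = 2 * j + 1\<close> they only ask that \<open>j\<close> be alive, for
  \<open>i = 2 * j + 2\<close> they ask it of both \<open>j\<close> and
  \<open>j + 1\<close>.\<close>

definition sparse :: "nat \<Rightarrow> int set" where
  "sparse n = {i. alive n (i div 2) \<and> alive n ((i - 1) div 2) \<and> \<not> dense (Suc n) i}"

definition tilted :: "nat \<Rightarrow> int set" where
  "tilted n = {i. alive n (i div 2) \<and> alive n ((i - 1) div 2) \<and> dense (Suc n) i \<and> \<not> regular (Suc n) i}"

lemma living_subset: "living n \<subseteq> {0..<1024 * 2 ^ n}"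
  using alive_range by (auto simp: living_def)

lemma finite_living: "finite (living n)"
  using living_subset finite_atLeastLessThan_int by (rule finite_subset)

definition children :: "nat \<Rightarrow> int set" where "children n = {i. alive n (i div 2)}"

lemma children_eq: "children n = (\<lambda>j. 2 * j) ` living n \<union> (\<lambda>j. 2 * j + 1) ` living n"
proof -
  have "i \<in> (\<lambda>j. 2 * j) ` living n \<union> (\<lambda>j. 2 * j + 1) ` living n" if "alive n (i div 2)" for i
  proof (cases "even i")
    case True
    then have "i = 2 * (i div 2)" by simp
    then show ?thesis using that unfolding living_def by blast
  next
    case False
    then have "i = 2 * (i div 2) + 1" by simp
    then show ?thesis using that unfolding living_def by blast
  qed
  then show ?thesis by (auto simp: children_def living_def)
qed

lemma finite_children: "finite (children n)"
  unfolding children_eq using finite_living by auto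

lemma sum_children:
  fixes f :: "int \<Rightarrow> 'b::comm_monoid_add"
  shows "sum f (children n) = (\<Sum>j\<in>living n. f (2 * j) + f (2 * j + 1))"
proof -
  have "(\<lambda>j. 2 * j) ` living n \<inter> (\<lambda>j. 2 * j + 1) ` living n = {}" by (auto simp: image_iff) presburger
  then have "sum f (children n) = sum f ((\<lambda>j. 2 * j) ` living n) + sum f ((\<lambda>j. 2 * j + 1) ` living n)"
    unfolding children_eq using finite_living by (intro sum.union_disjoint) auto
  also have "\<dots> = (\<Sum>j\<in>living n. f (2 * j)) + (\<Sum>j\<in>living n. f (2 * j + 1))"
    by (subst (1 2) sum.reindex) (auto simp: inj_on_def)
  finally show ?thesis by (simp add: sum.distrib)
qed

lemma living_Suc_subset: "living (Suc n) \<subseteq> {i. alive n (i div 2) \<and> alive n ((i - 1) div 2)}"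
  by (auto simp: living_def)

lemma cell_halves: "cell n j \<subseteq> cell (Suc n) (2 * j) \<union> cell (Suc n) (2 * j + 1)"
proof
  fix x assume x: "x \<in> cell n j"
  have eq: "real_of_int (2 * j) * size (Suc n) = of_int j * size n"
    "(real_of_int (2 * j + 1) + 1) * size (Suc n) = (of_int j + 1) * size n"
    by (simp_all add: size_Suc algebra_simps)
  show "x \<in> cell (Suc n) (2 * j) \<union> cell (Suc n) (2 * j + 1)"
  proof (cases "h x < (real_of_int (2 * j) + 1) * size (Suc n)")
    case True
    moreover have "real_of_int (2 * j) * size (Suc n) \<le> h x" unfolding eq using cell_h[OF x] by simp
    ultimately show ?thesis using cell_h[OF x] unfolding cell_def slab_def by blast
  next
    case False
    moreover have "(real_of_int (2 * j) + 1) * size (Suc n) = real_of_int (2 * j + 1) * size (Suc n)" by simp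
    moreover have "h x < (real_of_int (2 * j + 1) + 1) * size (Suc n)" unfolding eq using cell_h[OF x] by simp
    ultimately have "x \<in> cell (Suc n) (2 * j + 1)" using cell_h[OF x] unfolding cell_def slab_def
      by (simp del: of_int_mult of_int_add)
    then show ?thesis by blast
  qed
qed

lemma subcell_bounds:
  "of_int (i div 2) * size n \<le> of_int i * size (Suc n)"
  "(of_int i + 1) * size (Suc n) \<le> (of_int (i div 2) + 1) * size n"
proof -
  have "of_int (2 * (i div 2)) \<le> (of_int i :: real)" by (subst of_int_le_iff) simp
  then have "(2 * of_int (i div 2)) * size (Suc n) \<le> of_int i * size (Suc n)"
    using size_pos[of "Suc n"] by (intro mult_right_mono) auto
  then show "of_int (i div 2) * size n \<le> of_int i * size (Suc n)" by (simp add: size_Suc)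
  have "(of_int (i + 1) :: real) \<le> of_int (2 * (i div 2 + 1))" by (subst of_int_le_iff) simp
  then have "(of_int i + 1) * size (Suc n) \<le> (2 * (of_int (i div 2) + 1)) * size (Suc n)"
    using size_pos[of "Suc n"] by (intro mult_right_mono) auto
  then show "(of_int i + 1) * size (Suc n) \<le> (of_int (i div 2) + 1) * size n" by (simp add: size_Suc algebra_simps)
qed

text \<open>A sparse cell has a bin that falls short of its length by
  \<open>size (Suc n) / 512\<close>; half of this deficit survives the errors in the mass bounds for
  the slabs on both sides of the bin. The numeral \<open>524288\<close> is
  \<open>2 ^ 19\<close>.\<close>

lemma mass_child:
  assumes "i \<in> children n"
  shows "measure M (cell (Suc n) i) \<le> (1 + 1 / 524288) * size (Suc n) - (if i \<in> sparse n then size (Suc n) / 1024 else 0)"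
proof -
  have g: "good n (i div 2)" using assms by (simp add: children_def alive_good)
  note b = subcell_bounds[of i n]
  show ?thesis
  proof (cases "i \<in> sparse n")
    case False
    have "measure M (cell (Suc n) i) \<le> (of_int i + 1) * size (Suc n) - of_int i * size (Suc n) + size n / 2 ^ 20"
      unfolding cell_def using b size_pos[of "Suc n"] by (intro mass_subslab[OF g]) (auto simp: algebra_simps)
    moreover have "(of_int i + 1) * size (Suc n) - of_int i * size (Suc n) = size (Suc n)"
      by (simp add: algebra_simps)
    ultimately show ?thesis using False by (simp add: size_Suc)
  next
    case True
    then obtain t where t: "t < 256" "measure M (bin (Suc n) i t) < size (Suc n) / 512"
      unfolding sparse_def dense_def by (auto simp: not_le)
    define a where "a = (of_int i + real t / 256) * size (Suc n)"
    define c where "c = (of_int i + (real t + 1) / 256) * size (Suc n)"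
    have ca: "c = a + size (Suc n) / 256" by (simp add: a_def c_def algebra_simps add_divide_distrib)
    have a1: "of_int i * size (Suc n) \<le> a" unfolding a_def using size_pos[of "Suc n"] by (intro mult_right_mono) auto
    have c1: "c \<le> (of_int i + 1) * size (Suc n)" unfolding c_def using size_pos[of "Suc n"] t by (intro mult_right_mono) auto
    have "cell (Suc n) i \<subseteq> slab (of_int i * size (Suc n)) a \<union> (bin (Suc n) i t \<union> slab c ((of_int i + 1) * size (Suc n)))"
      by (auto simp: cell_def bin_def slab_def a_def c_def)
    then have "measure M (cell (Suc n) i) \<le> measure M (slab (of_int i * size (Suc n)) a \<union> (bin (Suc n) i t \<union> slab c ((of_int i + 1) * size (Suc n))))"
      by (intro finite_measure_mono) auto
    also have "\<dots> \<le> measure M (slab (of_int i * size (Suc n)) a) + measure M (bin (Suc n) i t \<union> slab c ((of_int i + 1) * size (Suc n)))"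
      by (intro measure_Un_le) auto
    also have "\<dots> \<le> measure M (slab (of_int i * size (Suc n)) a) + (measure M (bin (Suc n) i t) + measure M (slab c ((of_int i + 1) * size (Suc n))))"
      by (intro add_left_mono measure_Un_le) auto
    also have "measure M (slab (of_int i * size (Suc n)) a) \<le> a - of_int i * size (Suc n) + size n / 2 ^ 20"
      using b a1 c1 ca size_pos[of "Suc n"] by (intro mass_subslab[OF g]) auto
    also have "measure M (slab c ((of_int i + 1) * size (Suc n))) \<le> (of_int i + 1) * size (Suc n) - c + size n / 2 ^ 20"
      using b a1 c1 ca size_pos[of "Suc n"] by (intro mass_subslab[OF g]) auto
    finally have "measure M (cell (Suc n) i) \<le> size (Suc n) - size (Suc n) / 256 + measure M (bin (Suc n) i t) + size n / 2 ^ 19"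
      using ca by (simp add: algebra_simps)
    moreover have "size n = 2 * size (Suc n)" by (simp add: size_Suc)
    ultimately show ?thesis using True t size_pos[of "Suc n"] by (simp add: algebra_simps)
  qed
qed

lemma sparse_subset: "sparse n \<subseteq> children n - living (Suc n)"
  by (auto simp: sparse_def children_def living_def regular_def)

definition living_mass :: "nat \<Rightarrow> real" where "living_mass n = (\<Sum>j\<in>living n. measure M (cell n j))"

definition living_length :: "nat \<Rightarrow> real" where "living_length n = real (card (living n)) * size n"

lemma card_children: "real (card (children n)) = 2 * real (card (living n))"
  using sum_children[of "\<lambda>_. 1::real" n] by simp

text \<open>Discarded cells carry at most slightly more mass than their length, and sparse cells carry
  definitely less; since the initial mass is almost the length, there are few sparse cells.\<close>

lemma living_mass_step:
  "living_mass n \<le> living_mass (Suc n) + (1 + 1 / 524288) * (living_length n - living_length (Suc n))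
     - real (card (sparse n)) * size (Suc n) / 1024"
proof -
  have sub: "living (Suc n) \<subseteq> children n" by (auto simp: living_def children_def)
  have "living_mass n \<le> (\<Sum>j\<in>living n. measure M (cell (Suc n) (2 * j)) + measure M (cell (Suc n) (2 * j + 1)))"
    unfolding living_mass_def
  proof (intro sum_mono)
    fix j
    have "measure M (cell n j) \<le> measure M (cell (Suc n) (2 * j) \<union> cell (Suc n) (2 * j + 1))"
      by (intro finite_measure_mono cell_halves) auto
    also have "\<dots> \<le> measure M (cell (Suc n) (2 * j)) + measure M (cell (Suc n) (2 * j + 1))"
      by (intro measure_Un_le) auto
    finally show "measure M (cell n j) \<le> \<dots>" .
  qed
  also have "\<dots> = (\<Sum>i\<in>children n. measure M (cell (Suc n) i))" by (rule sum_children[symmetric])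
  also have "\<dots> = living_mass (Suc n) + (\<Sum>i\<in>children n - living (Suc n). measure M (cell (Suc n) i))"
    unfolding living_mass_def using finite_children sub by (subst sum.subset_diff[OF sub]) auto
  also have "(\<Sum>i\<in>children n - living (Suc n). measure M (cell (Suc n) i)) \<le>
    (\<Sum>i\<in>children n - living (Suc n). (1 + 1 / 524288) * size (Suc n) - (if i \<in> sparse n then size (Suc n) / 1024 else 0))"
    by (intro sum_mono mass_child) auto
  also have "\<dots> = real (card (children n - living (Suc n))) * ((1 + 1 / 524288) * size (Suc n)) -
      (\<Sum>i\<in>children n - living (Suc n). if i \<in> sparse n then size (Suc n) / 1024 else 0)"
    by (simp add: sum_subtractf)
  also have "(\<Sum>i\<in>children n - living (Suc n). if i \<in> sparse n then size (Suc n) / 1024 else 0) =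
      real (card (sparse n)) * size (Suc n) / 1024"
  proof -
    have "(children n - living (Suc n)) \<inter> {i. i \<in> sparse n} = sparse n" using sparse_subset by auto
    then show ?thesis using finite_children[of n] by (simp add: sum.If_cases)
  qed
  also have "real (card (children n - living (Suc n))) = 2 * real (card (living n)) - real (card (living (Suc n)))"
    using finite_children[of n] finite_living[of "Suc n"] sub card_children[of n]
    by (simp add: card_Diff_subset of_nat_diff card_mono)
  finally show ?thesis
    by (simp add: living_length_def size_Suc algebra_simps add_divide_distrib diff_divide_distrib)
qed

lemma living_mass_le: "living_mass n \<le> (1 + 1 / 524288) * living_length n"
proof -
  have "living_mass n \<le> (\<Sum>j\<in>living n. (1 + 1 / 524288) * size n)"
    unfolding living_mass_def
  proof (intro sum_mono)
    fix j assume "j \<in> living n"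
    then have "good n j" by (simp add: living_def alive_good)
    then have "measure M (cell n j) \<le> (of_int j + 1) * size n - of_int j * size n + size n / 2 ^ 20"
      unfolding cell_def using size_pos[of n] by (intro mass_subslab) (auto simp: algebra_simps)
    then show "measure M (cell n j) \<le> (1 + 1 / 524288) * size n"
      using size_pos[of n] by (simp add: algebra_simps)
  qed
  then show ?thesis by (simp add: living_length_def algebra_simps)
qed

lemma living_0: "living 0 = {10..1012}" by (auto simp: living_def)

text \<open>By subtraction, as in \<open>dense_0\<close>: the two discarded end slabs carry hardly
  more than their lengths, and the total is almost \<open>L\<close>.\<close>

lemma living_mass_0: "living_length 0 - L / 2 ^ 30 \<le> living_mass 0"
proof -
  have L: "L = 1024 * size 0" by (simp add: size_0)
  have "space M \<subseteq> slab 0 (10 * size 0) \<union> ((\<Union>j\<in>living 0. cell 0 j) \<union> slab (1013 * size 0) (L + L / 1099511627776))"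
  proof
    fix x assume x: "x \<in> space M"
    have xc: "x \<in> cell 0 (index 0 x)" using x cell_index by auto
    consider "index 0 x < 10" | "10 \<le> index 0 x" "index 0 x \<le> 1012" | "1013 \<le> index 0 x" by linarith
    then show "x \<in> slab 0 (10 * size 0) \<union> ((\<Union>j\<in>living 0. cell 0 j) \<union> slab (1013 * size 0) (L + L / 1099511627776))"
    proof cases
      case 1
      then have "(of_int (index 0 x) + 1) * size 0 \<le> 10 * size 0"
        using size_pos[of 0] by (intro mult_right_mono) auto
      then show ?thesis using cell_h[OF xc] h_range[OF x] by (auto simp: slab_def)
    next
      case 2
      then show ?thesis using xc by (auto simp: living_0)
    next
      case 3
      then have "1013 * size 0 \<le> of_int (index 0 x) * size 0"
        using size_pos[of 0] by (intro mult_right_mono) auto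
      then show ?thesis using cell_h[OF xc] h_range[OF x] L_pos by (auto simp: slab_def)
    qed
  qed
  then have "measure M (space M) \<le> measure M (slab 0 (10 * size 0) \<union> ((\<Union>j\<in>living 0. cell 0 j) \<union> slab (1013 * size 0) (L + L / 1099511627776)))"
    using finite_living by (intro finite_measure_mono) auto
  also have "\<dots> \<le> measure M (slab 0 (10 * size 0)) + measure M ((\<Union>j\<in>living 0. cell 0 j) \<union> slab (1013 * size 0) (L + L / 1099511627776))"
    using finite_living by (intro measure_Un_le) auto
  also have "\<dots> \<le> measure M (slab 0 (10 * size 0)) + (measure M (\<Union>j\<in>living 0. cell 0 j) + measure M (slab (1013 * size 0) (L + L / 1099511627776)))"
    using finite_living by (intro add_left_mono measure_Un_le) auto
  also have "measure M (slab 0 (10 * size 0)) \<le> 10 * size 0 - 0 + L / 1099511627776"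
    using L_pos by (intro mass_slab) (auto simp: size_0)
  also have "measure M (\<Union>j\<in>living 0. cell 0 j) \<le> living_mass 0"
    unfolding living_mass_def using finite_living by (intro finite_measure_subadditive_finite) auto
  also have "measure M (slab (1013 * size 0) (L + L / 1099511627776)) \<le>
      L + L / 1099511627776 - 1013 * size 0 + L / 1099511627776"
    using L_pos by (intro mass_slab) (auto simp: size_0 field_simps)
  finally have "(1 - \<epsilon>) * L \<le> 10 * size 0 - 0 + L / 1099511627776 +
     (living_mass 0 + (L + L / 1099511627776 - 1013 * size 0 + L / 1099511627776))"
    using full_mass by simp
  moreover have "(1 - \<epsilon>) * L = L - \<epsilon> * L" by (simp add: algebra_simps)
  moreover have "living_length 0 = 1003 * size 0" by (simp add: living_length_def living_0)
  moreover have "L / 2 ^ 30 = L / 1073741824" by simp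
  ultimately show ?thesis using eps_L L L_pos by linarith
qed

text \<open>Summing \<open>living_mass_step\<close> leaves the initial gap between length and mass
  and a relative error \<open>2 ^ -19\<close> of the length. Multiplied by 1024, this is slightly
  less than \<open>L / 500\<close>.\<close>

lemma sparse_total: "(\<Sum>n<N. real (card (sparse n)) * size (Suc n)) \<le> L / 500"
proof -
  have "living_mass 0 \<le> living_mass N + (1 + 1 / 524288) * (living_length 0 - living_length N)
     - (\<Sum>n<N. real (card (sparse n)) * size (Suc n)) / 1024"
  proof (induction N)
    case (Suc N)
    then show ?case using living_mass_step[of N]
      by (simp add: algebra_simps add_divide_distrib diff_divide_distrib)
  qed simp
  then have "(\<Sum>n<N. real (card (sparse n)) * size (Suc n)) / 1024 \<le>
      (1 + 1 / 524288) * living_length 0 - living_mass 0"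
    using living_mass_le[of N] by (simp add: algebra_simps add_divide_distrib diff_divide_distrib)
  also have "\<dots> \<le> living_length 0 / 524288 + L / 2 ^ 30"
    using living_mass_0 by (simp add: algebra_simps)
  also have "living_length 0 = 1003 * (L / 1024)" by (simp add: living_length_def living_0 size_0)
  finally show ?thesis using L_pos by simp
qed

subsection \<open>Total length of the tilted cells\<close>

definition spread :: "'a \<Rightarrow> 'a \<Rightarrow> 'a \<Rightarrow> real" where
  "spread x y z = max (dist x y) (dist x z)"

text \<open>The kernel restricted to triples whose larger distance from \<open>x\<close> is
  comparable to \<open>size n\<close>. The two bounds differ by a factor four, so a given triple
  counts at no more than three scales.\<close>

definition kern :: "nat \<Rightarrow> 'a \<Rightarrow> 'a \<Rightarrow> 'a \<Rightarrow> ennreal" where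
  "kern n x y z = (if size n / 2 \<le> spread x y z \<and> spread x y z \<le> 2 * size n then ennreal (ekernel x y z) else 0)"

lemma measurable_kern [measurable]:
  assumes [measurable]: "f \<in> N \<rightarrow>\<^sub>M M" "g \<in> N \<rightarrow>\<^sub>M M" "k \<in> N \<rightarrow>\<^sub>M M"
  shows "(\<lambda>x. kern n (f x) (g x) (k x)) \<in> borel_measurable N"
  unfolding kern_def spread_def by measurable

definition local_curv :: "nat \<Rightarrow> 'a \<Rightarrow> ennreal" where
  "local_curv n x = (\<integral>\<^sup>+ y. \<integral>\<^sup>+ z. kern n x y z \<partial>M \<partial>M)"

lemma measurable_local_curv [measurable]: "local_curv n \<in> borel_measurable M"
  unfolding local_curv_def by measurable

lemma sum_kern_le: "(\<Sum>n<N. kern n x y z) \<le> 3 * ennreal (ekernel x y z)"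
proof -
  define S where "S = {n. n < N \<and> size n / 2 \<le> spread x y z \<and> spread x y z \<le> 2 * size n}"
  have fS: "finite S" by (simp add: S_def)
  have "card S \<le> 3"
  proof (cases "S = {}")
    case False
    define m where "m = Min S"
    have mS: "m \<in> S" using fS False by (simp add: m_def)
    have "S \<subseteq> {m..m + 2}"
    proof
      fix n assume n: "n \<in> S"
      have mn: "m \<le> n" using n fS by (simp add: m_def)
      have "size m \<le> 4 * size n" using mS n by (auto simp: S_def)
      moreover have "size m = 2 ^ (n - m) * size n"
        using mn by (simp add: size_def power_add[symmetric] field_simps)
      ultimately have "(2::real) ^ (n - m) \<le> 2 ^ 2" using size_pos[of n] by simp
      then have "n - m \<le> 2" by (subst (asm) power_increasing_iff) auto
      then show "n \<in> {m..m + 2}" using mn by auto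
    qed
    then have "card S \<le> card {m..m + 2}" by (intro card_mono) auto
    then show ?thesis by simp
  qed simp
  have "(\<Sum>n<N. kern n x y z) = (\<Sum>n\<in>S. ennreal (ekernel x y z))"
    unfolding kern_def S_def by (simp add: sum.If_cases Int_def lessThan_def)
  also have "\<dots> = of_nat (card S) * ennreal (ekernel x y z)" by simp
  also have "\<dots> \<le> of_nat 3 * ennreal (ekernel x y z)"
    using \<open>card S \<le> 3\<close> by (intro mult_right_mono of_nat_mono) auto
  finally show ?thesis by simp
qed

lemma sum_local_curv:
  assumes [simp]: "x \<in> space M"
  shows "(\<Sum>n<N. local_curv n x) \<le> ennreal (3 * \<epsilon>)"
proof -
  have "(\<Sum>n<N. local_curv n x) = (\<integral>\<^sup>+ y. (\<Sum>n<N. \<integral>\<^sup>+ z. kern n x y z \<partial>M) \<partial>M)"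
    unfolding local_curv_def by (rule nn_integral_sum[symmetric]) measurable
  also have "\<dots> = (\<integral>\<^sup>+ y. \<integral>\<^sup>+ z. (\<Sum>n<N. kern n x y z) \<partial>M \<partial>M)"
  proof (intro nn_integral_cong)
    fix y assume [simp]: "y \<in> space M"
    show "(\<Sum>n<N. \<integral>\<^sup>+ z. kern n x y z \<partial>M) = (\<integral>\<^sup>+ z. (\<Sum>n<N. kern n x y z) \<partial>M)"
      by (rule nn_integral_sum[symmetric]) measurable
  qed
  also have "\<dots> \<le> (\<integral>\<^sup>+ y. \<integral>\<^sup>+ z. 3 * ennreal (ekernel x y z) \<partial>M \<partial>M)"
    by (intro nn_integral_mono sum_kern_le)
  also have "\<dots> = (\<integral>\<^sup>+ y. 3 * (\<integral>\<^sup>+ z. ennreal (ekernel x y z) \<partial>M) \<partial>M)"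
  proof (intro nn_integral_cong)
    fix y assume [simp]: "y \<in> space M"
    show "(\<integral>\<^sup>+ z. 3 * ennreal (ekernel x y z) \<partial>M) = 3 * (\<integral>\<^sup>+ z. ennreal (ekernel x y z) \<partial>M)"
      by (rule nn_integral_cmult) measurable
  qed
  also have "\<dots> = 3 * (\<integral>\<^sup>+ y. \<integral>\<^sup>+ z. ennreal (ekernel x y z) \<partial>M \<partial>M)"
    by (rule nn_integral_cmult) measurable
  also have "\<dots> \<le> 3 * ennreal \<epsilon>" by (intro mult_left_mono curvature) auto
  also have "\<dots> = ennreal (3 * \<epsilon>)" using eps_nonneg by (simp add: ennreal_mult)
  finally show ?thesis .
qed

lemma int_sum_local_curv: "(\<Sum>n<N. \<integral>\<^sup>+ x. local_curv n x \<partial>M) \<le> ennreal (9 * \<epsilon> * L)"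
proof -
  have "(\<Sum>n<N. \<integral>\<^sup>+ x. local_curv n x \<partial>M) = (\<integral>\<^sup>+ x. (\<Sum>n<N. local_curv n x) \<partial>M)"
    by (rule nn_integral_sum[symmetric]) measurable
  also have "\<dots> \<le> (\<integral>\<^sup>+ x. ennreal (3 * \<epsilon>) \<partial>M)" by (intro nn_integral_mono sum_local_curv)
  also have "\<dots> = ennreal (3 * \<epsilon> * measure M (space M))"
    using eps_nonneg by (simp add: emeasure_eq_measure ennreal_mult)
  also have "\<dots> \<le> ennreal (3 * \<epsilon> * (3 * L))"
    using eps_nonneg mass_space by (intro ennreal_leI mult_left_mono) auto
  finally show ?thesis by (simp add: ac_simps)
qed

definition triple_mean :: "'a set \<Rightarrow> 'a set \<Rightarrow> 'a set \<Rightarrow> ennreal" where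
  "triple_mean A B C = mean A (\<lambda>x. mean B (\<lambda>y. mean C (\<lambda>z. ennreal (excess x y z))))"

text \<open>Each of the three averages costs a factor \<open>512 / size n\<close>, and the excess is
  at most \<open>(2 * size n) ^ 3\<close> times the kernel. All powers of \<open>size n\<close>
  cancel; this scale invariance lets one curvature integral pay for all scales.\<close>

lemma triple_mean_le:
  assumes [measurable]: "A \<in> sets M" "B \<in> sets M" "C \<in> sets M"
    and mass: "size n / 512 \<le> measure M A" "size n / 512 \<le> measure M B" "size n / 512 \<le> measure M C"
    and sc: "\<And>x y z. x \<in> A \<Longrightarrow> y \<in> B \<Longrightarrow> z \<in> C \<Longrightarrow> size n / 2 \<le> spread x y z \<and> spread x y z \<le> 2 * size n"
  shows "triple_mean A B C \<le> 2 ^ 30 * (\<integral>\<^sup>+ x. local_curv n x * indicator A x \<partial>M)"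
proof -
  have AS: "A \<subseteq> space M" "B \<subseteq> space M" "C \<subseteq> space M"
    using assms(1-3)[THEN sets.sets_into_space] by auto
  have s: "0 < size n" by (rule size_pos)
  have div: "f / ennreal (measure M D) \<le> ennreal (512 / size n) * f" if "size n / 512 \<le> measure M D" for f D
  proof -
    have "0 < measure M D" using that s by simp
    then have "f / ennreal (measure M D) = ennreal (1 / measure M D) * f"
      by (simp add: divide_ennreal_def inverse_ennreal inverse_eq_divide mult.commute)
    moreover have "1 / measure M D \<le> 1 / (size n / 512)" using that s by (intro divide_left_mono) auto
    then have "ennreal (1 / measure M D) * f \<le> ennreal (1 / (size n / 512)) * f"
      by (intro mult_right_mono ennreal_leI) auto
    ultimately show ?thesis by simp
  qed
  have 1: "mean C (\<lambda>z. ennreal (excess x y z)) \<le> ennreal (512 / size n * (2 * size n) ^ 3) * (\<integral>\<^sup>+ z. kern n x y z \<partial>M)"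
    if xy: "x \<in> A" "y \<in> B" for x y
  proof -
    have [simp]: "x \<in> space M" "y \<in> space M" using xy AS by auto
    have "mean C (\<lambda>z. ennreal (excess x y z)) \<le>
      ennreal (512 / size n) * (\<integral>\<^sup>+ z. ennreal (excess x y z) * indicator C z \<partial>M)"
      unfolding mean_def by (rule div[OF mass(3)])
    also have "(\<integral>\<^sup>+ z. ennreal (excess x y z) * indicator C z \<partial>M) \<le>
      (\<integral>\<^sup>+ z. ennreal ((2 * size n) ^ 3) * kern n x y z \<partial>M)"
    proof (intro nn_integral_mono)
      fix z
      show "ennreal (excess x y z) * indicator C z \<le> ennreal ((2 * size n) ^ 3) * kern n x y z"
      proof (cases "z \<in> C")
        case True
        from sc[OF xy True] have "excess x y z \<le> (2 * size n) ^ 3 * ekernel x y z"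
          by (intro excess_le_ekernel) (auto simp: spread_def)
        then show ?thesis using sc[OF xy True] True s
          by (simp add: kern_def ekernel_nonneg ennreal_leI flip: ennreal_mult)
      qed simp
    qed
    also have "\<dots> = ennreal ((2 * size n) ^ 3) * (\<integral>\<^sup>+ z. kern n x y z \<partial>M)"
      by (rule nn_integral_cmult) measurable
    finally have "mean C (\<lambda>z. ennreal (excess x y z)) \<le>
      ennreal (512 / size n) * (ennreal ((2 * size n) ^ 3) * (\<integral>\<^sup>+ z. kern n x y z \<partial>M))"
      by (simp add: mult_left_mono)
    moreover have "ennreal (512 / size n * (2 * size n) ^ 3) = ennreal (512 / size n) * ennreal ((2 * size n) ^ 3)"
      using s by (intro ennreal_mult) auto
    ultimately show ?thesis by (simp only: mult.assoc)
  qed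
  define c where "c = 512 / size n * (2 * size n) ^ 3"
  have c: "0 \<le> c" using s by (simp add: c_def)
  have 2: "mean B (\<lambda>y. mean C (\<lambda>z. ennreal (excess x y z))) \<le> ennreal (512 / size n * c) * local_curv n x"
    if x: "x \<in> A" for x
  proof -
    have [simp]: "x \<in> space M" using x AS by auto
    have "mean B (\<lambda>y. mean C (\<lambda>z. ennreal (excess x y z))) \<le>
      mean B (\<lambda>y. ennreal c * (\<integral>\<^sup>+ z. kern n x y z \<partial>M))"
      unfolding c_def using 1 x by (intro mean_mono) auto
    also have "\<dots> \<le> ennreal (512 / size n) * (\<integral>\<^sup>+ y. (ennreal c * (\<integral>\<^sup>+ z. kern n x y z \<partial>M)) * indicator B y \<partial>M)"
      unfolding mean_def by (rule div[OF mass(2)])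
    also have "(\<integral>\<^sup>+ y. (ennreal c * (\<integral>\<^sup>+ z. kern n x y z \<partial>M)) * indicator B y \<partial>M) \<le>
       (\<integral>\<^sup>+ y. ennreal c * (\<integral>\<^sup>+ z. kern n x y z \<partial>M) \<partial>M)"
      by (intro nn_integral_mono) (simp add: indicator_def)
    also have "\<dots> = ennreal c * local_curv n x"
      unfolding local_curv_def by (rule nn_integral_cmult) measurable
    finally have "mean B (\<lambda>y. mean C (\<lambda>z. ennreal (excess x y z))) \<le>
      ennreal (512 / size n) * (ennreal c * local_curv n x)"
      by (simp add: mult_left_mono)
    moreover have "ennreal (512 / size n * c) = ennreal (512 / size n) * ennreal c"
      using s c by (intro ennreal_mult) auto
    ultimately show ?thesis by (simp only: mult.assoc)
  qed
  have "triple_mean A B C \<le> mean A (\<lambda>x. ennreal (512 / size n * c) * local_curv n x)"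
    unfolding triple_mean_def using 2 by (intro mean_mono) auto
  also have "\<dots> \<le> ennreal (512 / size n) * (\<integral>\<^sup>+ x. (ennreal (512 / size n * c) * local_curv n x) * indicator A x \<partial>M)"
    unfolding mean_def by (rule div[OF mass(1)])
  also have "(\<integral>\<^sup>+ x. (ennreal (512 / size n * c) * local_curv n x) * indicator A x \<partial>M) =
      ennreal (512 / size n * c) * (\<integral>\<^sup>+ x. local_curv n x * indicator A x \<partial>M)"
    by (subst nn_integral_cmult[symmetric]) (simp_all add: mult.assoc)
  also have "ennreal (512 / size n) * (ennreal (512 / size n * c) * (\<integral>\<^sup>+ x. local_curv n x * indicator A x \<partial>M)) =
      ennreal (2 ^ 30) * (\<integral>\<^sup>+ x. local_curv n x * indicator A x \<partial>M)"
  proof -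
    have "ennreal (512 / size n) * ennreal (512 / size n * c) = ennreal (512 / size n * (512 / size n * c))"
      using s c by (intro ennreal_mult[symmetric]) auto
    also have "512 / size n * (512 / size n * c) = 2 ^ 30"
      using s by (simp add: c_def power3_eq_cube)
    finally show ?thesis by (simp only: mult.assoc[symmetric])
  qed
  finally show ?thesis by (simp add: mult_left_mono flip: ennreal_power)
qed

lemma window_Suc_h:
  assumes "x \<in> window (Suc n) i"
  shows "(of_int i / 2 + 1/8) * size n \<le> h x" "h x < (of_int i / 2 + 3/16) * size n"
proof -
  have "(of_int i + 1/4) * size (Suc n) = (of_int i / 2 + 1/8) * size n"
    "(of_int i + 3/8) * size (Suc n) = (of_int i / 2 + 3/16) * size n"
    by (simp_all add: size_Suc algebra_simps)
  then show "(of_int i / 2 + 1/8) * size n \<le> h x" "h x < (of_int i / 2 + 3/16) * size n"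
    using window_h[OF assms] by auto
qed

text \<open>A finer window begins at the fraction \<open>1/8\<close> or \<open>5/8\<close> of the
  parent, which is the left end of bin 32 or 160, and it contains that bin. So it has mass as soon
  as the parent is dense, even if the child is sparse.\<close>

lemma window_Suc_mass:
  assumes "dense n (i div 2)"
  shows "size n / 512 \<le> measure M (window (Suc n) i)"
proof -
  define t :: nat where "t = (if even i then 32 else 160)"
  have t: "real_of_int i / 2 + 1/8 = of_int (i div 2) + real t / 256"
  proof (cases "even i")
    case True
    then have "real_of_int i = 2 * of_int (i div 2)" by (metis dvd_mult_div_cancel of_int_mult of_int_numeral)
    then show ?thesis using True by (simp add: t_def)
  next
    case False
    then have "i = 2 * (i div 2) + 1" by simp
    then have "real_of_int i = 2 * of_int (i div 2) + 1" by (metis of_int_1 of_int_add of_int_mult of_int_numeral)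
    then show ?thesis using False by (simp add: t_def add_divide_distrib)
  qed
  have eq: "(of_int i + 1/4) * size (Suc n) = (of_int i / 2 + 1/8) * size n"
    "(of_int i + 3/8) * size (Suc n) = (of_int i / 2 + 3/16) * size n"
    by (simp_all add: size_Suc algebra_simps)
  have "(of_int (i div 2) + (real t + 1) / 256) \<le> of_int i / 2 + (3/16 :: real)" using t by (simp add: field_simps)
  then have "(of_int (i div 2) + (real t + 1) / 256) * size n \<le> (of_int i / 2 + 3/16) * size n"
    using size_pos[of n] by (intro mult_right_mono) auto
  then have "bin n (i div 2) t \<subseteq> window (Suc n) i"
    unfolding bin_def window_def slab_def eq using t by auto
  then have "measure M (bin n (i div 2) t) \<le> measure M (window (Suc n) i)"
    by (intro finite_measure_mono) auto
  moreover have "size n / 512 \<le> measure M (bin n (i div 2) t)"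
    using assms by (auto simp: dense_def t_def)
  ultimately show ?thesis by linarith
qed

definition defect :: "nat \<Rightarrow> int \<Rightarrow> ennreal" where
  "defect n j = triple_mean (window n j) (window (Suc n) (2 * j + 1)) (window n (j + 1)) +
     triple_mean (window (Suc n) (2 * j + 1)) (window (Suc n) (2 * j + 2)) (window n (j + 1))"

text \<open>\<open>mean_tilt_split\<close> is used twice: at the first inserted window for the whole
  gap, then at the second one for the rest of the gap. Both excess terms have their base points in
  \<open>cell n j\<close> and are charged to the curvature there.\<close>

lemma refine:
  assumes al: "alive n j"
  shows "mean_tilt (window n j) (window (Suc n) (2 * j + 1)) +
    mean_tilt (window (Suc n) (2 * j + 1)) (window (Suc n) (2 * j + 2)) +
    mean_tilt (window (Suc n) (2 * j + 2)) (window n (j + 1)) \<le>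
    mean_tilt (window n j) (window n (j + 1)) + defect n j" (is ?A)
  and "defect n j \<le> 2 ^ 31 * (\<integral>\<^sup>+ x. local_curv n x * indicator (cell n j) x \<partial>M)" (is ?B)
proof -
  define V where "V = window n j"
  define A where "A = window (Suc n) (2 * j + 1)"
  define B where "B = window (Suc n) (2 * j + 2)"
  define W where "W = window n (j + 1)"
  have S: "V \<in> sets M" "A \<in> sets M" "B \<in> sets M" "W \<in> sets M" by (auto simp: V_def A_def B_def W_def)
  have s: "0 < size n" by (rule size_pos)
  have g: "good n j" using al by (rule alive_good)
  have d: "dense n j" "dense n (j + 1)" using g by (auto simp: good_def regular_def)
  have mass: "size n / 512 \<le> measure M V" "size n / 512 \<le> measure M A"
    "size n / 512 \<le> measure M B" "size n / 512 \<le> measure M W"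
    using d window_mass[of n j] window_mass[of n "j + 1"] window_Suc_mass[of n "2 * j + 1"] window_Suc_mass[of n "2 * j + 2"]
    by (auto simp: V_def A_def B_def W_def)
  then have pos: "0 < measure M V" "0 < measure M A" "0 < measure M B" "0 < measure M W" using s by auto
  \<comment> \<open>With origin \<open>c\<close> and unit \<open>size n\<close> the four windows
    start at 1/4, 5/8, 9/8 and 5/4. The smallest gap between consecutive ones is 1/16, which exceeds
    the error 1/32; so the outer points of each triple are farthest apart.\<close>
  define c where "c = of_int j * size n"
  have V: "c + size n / 4 \<le> h x" "h x < c + 3/8 * size n" "x \<in> cell n j" if "x \<in> V" for x
    using window_h[of x n j] window_cell[of n j] that by (auto simp: V_def c_def algebra_simps)
  have A: "c + 5/8 * size n \<le> h x" "h x < c + 11/16 * size n" "x \<in> cell n j" if "x \<in> A" for x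
    using window_Suc_h[of x n "2 * j + 1"] window_cell[of "Suc n" "2 * j + 1"] cell_parent[of n "2 * j + 1"] that
    by (auto simp: A_def c_def algebra_simps add_divide_distrib)
  have B: "c + 9/8 * size n \<le> h x" "h x < c + 19/16 * size n" "x \<in> cell n (j + 1)" if "x \<in> B" for x
    using window_Suc_h[of x n "2 * j + 2"] window_cell[of "Suc n" "2 * j + 2"] cell_parent[of n "2 * j + 2"] that
    by (auto simp: B_def c_def algebra_simps add_divide_distrib)
  have W: "c + 5/4 * size n \<le> h x" "h x < c + 11/8 * size n" "x \<in> cell n (j + 1)" if "x \<in> W" for x
    using window_h[of x n "j + 1"] window_cell[of n "j + 1"] that by (auto simp: W_def c_def algebra_simps)
  have near: "dist x y \<le> h y - h x + size n / 32" "h y - h x \<le> dist x y"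
    if "x \<in> cell n i" "y \<in> cell n i'" "h x \<le> h y" "i = j \<or> i = j + 1" "i' = j \<or> i' = j + 1" for x y i i'
  proof -
    have "dist x y \<le> \<bar>h x - h y\<bar> + size n / 32" using that by (intro good_dist[OF g]) auto
    then show "dist x y \<le> h y - h x + size n / 32" using that by simp
    show "h y - h x \<le> dist x y" using h_lip[of x y] cell_h(3)[OF that(1)] cell_h(3)[OF that(2)] by simp
  qed
  have VAW: "dist x y \<le> dist x z \<and> dist y z \<le> dist x z \<and> size n / 2 \<le> spread x y z \<and> spread x y z \<le> 2 * size n"
    if "x \<in> V" "y \<in> A" "z \<in> W" for x y z
  proof -
    note hx = V(1,2)[OF that(1)] and hy = A(1,2)[OF that(2)] and hz = W(1,2)[OF that(3)]
    have le: "h x \<le> h y" "h y \<le> h z" "h x \<le> h z" using hx hy hz s by linarith+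
    have xy: "dist x y \<le> h y - h x + size n / 32" "h y - h x \<le> dist x y"
      using near[OF V(3)[OF that(1)] A(3)[OF that(2)] le(1)] by auto
    have yz: "dist y z \<le> h z - h y + size n / 32" "h z - h y \<le> dist y z"
      using near[OF A(3)[OF that(2)] W(3)[OF that(3)] le(2)] by auto
    have xz: "dist x z \<le> h z - h x + size n / 32" "h z - h x \<le> dist x z"
      using near[OF V(3)[OF that(1)] W(3)[OF that(3)] le(3)] by auto
    have "dist x y \<le> dist x z" "dist y z \<le> dist x z" "size n / 2 \<le> dist x z" "dist x z \<le> 2 * size n"
      using xy yz xz hx hy hz s by linarith+
    then show ?thesis by (simp add: spread_def le_max_iff_disj)
  qed
  have ABW: "dist x y \<le> dist x z \<and> dist y z \<le> dist x z \<and> size n / 2 \<le> spread x y z \<and> spread x y z \<le> 2 * size n"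
    if "x \<in> A" "y \<in> B" "z \<in> W" for x y z
  proof -
    note hx = A(1,2)[OF that(1)] and hy = B(1,2)[OF that(2)] and hz = W(1,2)[OF that(3)]
    have le: "h x \<le> h y" "h y \<le> h z" "h x \<le> h z" using hx hy hz s by linarith+
    have xy: "dist x y \<le> h y - h x + size n / 32" "h y - h x \<le> dist x y"
      using near[OF A(3)[OF that(1)] B(3)[OF that(2)] le(1)] by auto
    have yz: "dist y z \<le> h z - h y + size n / 32" "h z - h y \<le> dist y z"
      using near[OF B(3)[OF that(2)] W(3)[OF that(3)] le(2)] by auto
    have xz: "dist x z \<le> h z - h x + size n / 32" "h z - h x \<le> dist x z"
      using near[OF A(3)[OF that(1)] W(3)[OF that(3)] le(3)] by auto
    have "dist x y \<le> dist x z" "dist y z \<le> dist x z" "size n / 2 \<le> dist x z" "dist x z \<le> 2 * size n"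
      using xy yz xz hx hy hz s by linarith+
    then show ?thesis by (simp add: spread_def le_max_iff_disj)
  qed
  have oVA: "h x \<le> h y" if "x \<in> V" "y \<in> A" for x y
    using V(2)[OF that(1)] A(1)[OF that(2)] s by linarith
  have oAB: "h x \<le> h y" if "x \<in> A" "y \<in> B" for x y
    using A(2)[OF that(1)] B(1)[OF that(2)] s by linarith
  have oAW: "h x \<le> h y" if "x \<in> A" "y \<in> W" for x y
    using A(2)[OF that(1)] W(1)[OF that(2)] s by linarith
  have oBW: "h x \<le> h y" if "x \<in> B" "y \<in> W" for x y
    using B(2)[OF that(1)] W(1)[OF that(2)] s by linarith
  have 1: "mean_tilt V A + mean_tilt A W \<le> mean_tilt V W + triple_mean V A W"
    unfolding triple_mean_def using S pos VAW oVA oAW by (intro mean_tilt_split) auto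
  have 2: "mean_tilt A B + mean_tilt B W \<le> mean_tilt A W + triple_mean A B W"
    unfolding triple_mean_def using S pos ABW oAB oBW by (intro mean_tilt_split) auto
  have "mean_tilt V A + mean_tilt A B + mean_tilt B W \<le> mean_tilt V A + (mean_tilt A W + triple_mean A B W)"
    using 2 by (simp add: add.assoc add_left_mono)
  also have "\<dots> \<le> mean_tilt V W + triple_mean V A W + triple_mean A B W"
    using 1 by (simp add: add.assoc[symmetric] add_right_mono)
  finally show ?A by (simp add: V_def A_def B_def W_def defect_def add.assoc)
  have VA: "V \<subseteq> cell n j" "A \<subseteq> cell n j" using V(3) A(3) by auto
  have "triple_mean V A W \<le> 2 ^ 30 * (\<integral>\<^sup>+ x. local_curv n x * indicator V x \<partial>M)"
    using S mass VAW by (intro triple_mean_le) auto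
  also have "\<dots> \<le> 2 ^ 30 * (\<integral>\<^sup>+ x. local_curv n x * indicator (cell n j) x \<partial>M)"
    using VA by (intro mult_left_mono nn_integral_mono) (auto simp: indicator_def)
  finally have 3: "triple_mean V A W \<le> 2 ^ 30 * (\<integral>\<^sup>+ x. local_curv n x * indicator (cell n j) x \<partial>M)" .
  have "triple_mean A B W \<le> 2 ^ 30 * (\<integral>\<^sup>+ x. local_curv n x * indicator A x \<partial>M)"
    using S mass ABW by (intro triple_mean_le) auto
  also have "\<dots> \<le> 2 ^ 30 * (\<integral>\<^sup>+ x. local_curv n x * indicator (cell n j) x \<partial>M)"
    using VA by (intro mult_left_mono nn_integral_mono) (auto simp: indicator_def)
  finally have 4: "triple_mean A B W \<le> 2 ^ 30 * (\<integral>\<^sup>+ x. local_curv n x * indicator (cell n j) x \<partial>M)" .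
  have "defect n j \<le> 2 ^ 30 * (\<integral>\<^sup>+ x. local_curv n x * indicator (cell n j) x \<partial>M) + 
      2 ^ 30 * (\<integral>\<^sup>+ x. local_curv n x * indicator (cell n j) x \<partial>M)"
    using add_mono[OF 3 4] by (simp add: defect_def V_def A_def B_def W_def)
  also have "\<dots> = (2 ^ 30 + 2 ^ 30) * (\<integral>\<^sup>+ x. local_curv n x * indicator (cell n j) x \<partial>M)"
    by (simp only: distrib_right)
  also have "(2 ^ 30 + 2 ^ 30 :: ennreal) = 2 ^ 31" by simp
  finally show ?B .
qed

definition total_tilt :: "nat \<Rightarrow> ennreal" where
  "total_tilt n = (\<Sum>j\<in>living n. mean_tilt (window n j) (window n (j + 1)))"

lemma finite_exceptional: "finite (sparse n)" "finite (tilted n)"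
  by (rule finite_subset[OF _ finite_children[of n]]; auto simp: sparse_def tilted_def children_def)+

text \<open>The finer gap from \<open>2 * j + 1\<close> to \<open>2 * j + 2\<close> is the middle
  part of gap \<open>j\<close>. The one from \<open>2 * j + 2\<close> to \<open>2 * j + 3\<close> is
  bridged through \<open>window n (j + 1)\<close> and uses the last part of gap \<open>j\<close> and
  the first part of gap \<open>j + 1\<close>. No part is used twice, so the total grows by the
  defects only. The tilted cells take part in the sum, each with more than its threshold, which
  bounds their number.\<close>

lemma total_tilt_step:
  "total_tilt (Suc n) + of_nat (card (tilted n)) * ennreal (size (Suc n) / 2 ^ 40) \<le>
     total_tilt n + (\<Sum>j\<in>living n. defect n j)"
proof -
  define Q where "Q = {i. alive n (i div 2) \<and> alive n ((i - 1) div 2)}"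
  define J where "J = {j \<in> living n. j + 1 \<in> living n}"
  define mt where "mt i = mean_tilt (window (Suc n) i) (window (Suc n) (i + 1))" for i
  define T1 where "T1 j = mean_tilt (window n j) (window (Suc n) (2 * j + 1))" for j
  define T3 where "T3 j = mean_tilt (window (Suc n) (2 * j + 2)) (window n (j + 1))" for j
  have fin: "finite Q" "finite J"
    by (rule finite_subset[OF _ finite_children[of n]]; auto simp: Q_def children_def)
       (auto simp: J_def finite_living)
  have disj: "living (Suc n) \<inter> tilted n = {}" by (auto simp: living_def tilted_def)
  have "of_nat (card (tilted n)) * ennreal (size (Suc n) / 2 ^ 40) = (\<Sum>i\<in>tilted n. ennreal (size (Suc n) / 2 ^ 40))"
    by simp
  also have "\<dots> \<le> (\<Sum>i\<in>tilted n. mt i)"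
    by (intro sum_mono) (auto simp: tilted_def regular_def mt_def not_le)
  finally have "total_tilt (Suc n) + of_nat (card (tilted n)) * ennreal (size (Suc n) / 2 ^ 40) \<le>
      (\<Sum>i\<in>living (Suc n). mt i) + (\<Sum>i\<in>tilted n. mt i)"
    by (simp add: total_tilt_def mt_def add_left_mono)
  also have "\<dots> = (\<Sum>i\<in>living (Suc n) \<union> tilted n. mt i)"
    using disj finite_living finite_exceptional by (intro sum.union_disjoint[symmetric]) auto
  also have "\<dots> \<le> (\<Sum>i\<in>Q. mt i)"
    using fin living_Suc_subset by (intro sum_mono2) (auto simp: Q_def tilted_def)
  also have "Q = (\<lambda>j. 2 * j + 1) ` living n \<union> (\<lambda>j. 2 * j + 2) ` J"
  proof -
    have "i \<in> (\<lambda>j. 2 * j + 1) ` living n \<union> (\<lambda>j. 2 * j + 2) ` J" if i: "i \<in> Q" for i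
    proof (cases "even i")
      case True
      then have "i = 2 * ((i - 1) div 2) + 2" "(i - 1) div 2 + 1 = i div 2" by presburger+
      moreover have "(i - 1) div 2 \<in> J" using i calculation by (auto simp: J_def Q_def living_def)
      ultimately show ?thesis by blast
    next
      case False
      then have "i = 2 * (i div 2) + 1" by simp
      moreover have "i div 2 \<in> living n" using i by (auto simp: Q_def living_def)
      ultimately show ?thesis by blast
    qed
    then show ?thesis by (auto simp: Q_def J_def living_def)
  qed
  also have "(\<Sum>i\<in>(\<lambda>j. 2 * j + 1) ` living n \<union> (\<lambda>j. 2 * j + 2) ` J. mt i) =
      (\<Sum>i\<in>(\<lambda>j. 2 * j + 1) ` living n. mt i) + (\<Sum>i\<in>(\<lambda>j. 2 * j + 2) ` J. mt i)"
    using finite_living fin by (intro sum.union_disjoint) (auto simp: image_iff, presburger)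
  also have "\<dots> = (\<Sum>j\<in>living n. mt (2 * j + 1)) + (\<Sum>j\<in>J. mt (2 * j + 2))"
    by (subst (1 2) sum.reindex) (auto simp: inj_on_def)
  also have "(\<Sum>j\<in>J. mt (2 * j + 2)) \<le> (\<Sum>j\<in>J. T3 j + T1 (j + 1))"
  proof (intro sum_mono)
    fix j assume "j \<in> J"
    then have g: "good n j" "good n (j + 1)" by (auto simp: J_def living_def alive_good)
    then have d: "dense n (j + 1)" by (auto simp: good_def regular_def)
    have mass: "size n / 512 \<le> measure M (window (Suc n) (2 * j + 2))"
        "size n / 512 \<le> measure M (window n (j + 1))"
        "size n / 512 \<le> measure M (window (Suc n) (2 * j + 3))"
      using d window_mass[of n "j + 1"] window_Suc_mass[of n "2 * j + 3"] window_Suc_mass[of n "2 * j + 2"]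
      by auto
    have "mean_tilt (window (Suc n) (2 * j + 2)) (window (Suc n) (2 * j + 3)) \<le>
      mean_tilt (window (Suc n) (2 * j + 2)) (window n (j + 1)) +
      mean_tilt (window n (j + 1)) (window (Suc n) (2 * j + 3))"
    proof (intro mean_tilt_triangle)
      fix x y assume "x \<in> window (Suc n) (2 * j + 2)" "y \<in> window n (j + 1)"
      then have "h x < (of_int (2 * j + 2) / 2 + 3/16) * size n" "(of_int (j + 1) + 1/4) * size n \<le> h y"
        using window_Suc_h window_h by blast+
      moreover have "(of_int (2 * j + 2) / 2 + 3/16) * size n \<le> (of_int (j + 1) + 1/4) * size n"
        using size_pos[of n] by (intro mult_right_mono) (auto simp: add_divide_distrib)
      ultimately show "h x \<le> h y" by linarith
    next
      fix x y assume "x \<in> window n (j + 1)" "y \<in> window (Suc n) (2 * j + 3)"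
      then have "h x < (of_int (j + 1) + 3/8) * size n" "(of_int (2 * j + 3) / 2 + 1/8) * size n \<le> h y"
        using window_Suc_h window_h by blast+
      moreover have "(of_int (j + 1) + 3/8) * size n \<le> (of_int (2 * j + 3) / 2 + 1/8) * size n"
        using size_pos[of n] by (intro mult_right_mono) (auto simp: add_divide_distrib)
      ultimately show "h x \<le> h y" by linarith
    qed (use mass size_pos[of n] in auto)
    moreover have "2 * j + 2 + 1 = 2 * j + 3" "2 * (j + 1) + 1 = 2 * j + 3" by simp_all
    ultimately show "mt (2 * j + 2) \<le> T3 j + T1 (j + 1)"
      unfolding mt_def T1_def T3_def by (simp only:)
  qed
  also have "(\<Sum>j\<in>J. T3 j + T1 (j + 1)) = (\<Sum>j\<in>J. T3 j) + (\<Sum>i\<in>(\<lambda>j. j + 1) ` J. T1 i)"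
    by (subst sum.reindex) (auto simp: inj_on_def sum.distrib)
  also have "\<dots> \<le> (\<Sum>j\<in>living n. T3 j) + (\<Sum>j\<in>living n. T1 j)"
    using finite_living by (intro add_mono sum_mono2) (auto simp: J_def)
  also have "(\<Sum>j\<in>living n. mt (2 * j + 1)) + ((\<Sum>j\<in>living n. T3 j) + (\<Sum>j\<in>living n. T1 j)) =
      (\<Sum>j\<in>living n. T1 j + mt (2 * j + 1) + T3 j)"
    by (simp add: sum.distrib ac_simps)
  also have "\<dots> \<le> (\<Sum>j\<in>living n. mean_tilt (window n j) (window n (j + 1)) + defect n j)"
  proof (intro sum_mono)
    fix j assume "j \<in> living n"
    then have "alive n j" by (simp add: living_def)
    moreover have "2 * j + 1 + 1 = 2 * j + 2" by simp
    ultimately show "T1 j + mt (2 * j + 1) + T3 j \<le> mean_tilt (window n j) (window n (j + 1)) + defect n j"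
      unfolding T1_def T3_def mt_def using refine(1)[of n j] by (simp only:)
  qed
  finally show ?thesis by (simp add: total_tilt_def sum.distrib add_mono add_left_mono)
qed

lemma sum_defect: "(\<Sum>j\<in>living n. defect n j) \<le> 2 ^ 31 * (\<integral>\<^sup>+ x. local_curv n x \<partial>M)"
proof -
  have "(\<Sum>j\<in>living n. defect n j) \<le> (\<Sum>j\<in>living n. 2 ^ 31 * (\<integral>\<^sup>+ x. local_curv n x * indicator (cell n j) x \<partial>M))"
    by (intro sum_mono refine(2)) (simp add: living_def)
  also have "\<dots> = 2 ^ 31 * (\<Sum>j\<in>living n. \<integral>\<^sup>+ x. local_curv n x * indicator (cell n j) x \<partial>M)"
    by (rule sum_distrib_left[symmetric])
  also have "(\<Sum>j\<in>living n. \<integral>\<^sup>+ x. local_curv n x * indicator (cell n j) x \<partial>M) =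
     (\<integral>\<^sup>+ x. (\<Sum>j\<in>living n. local_curv n x * indicator (cell n j) x) \<partial>M)"
    by (rule nn_integral_sum[symmetric]) measurable
  also have "\<dots> \<le> (\<integral>\<^sup>+ x. local_curv n x \<partial>M)"
  proof (intro nn_integral_mono)
    fix x assume x: "x \<in> space M"
    have "(\<Sum>j\<in>living n. local_curv n x * indicator (cell n j) x) =
      (\<Sum>j\<in>living n. if j = index n x then local_curv n x else 0)"
      using cell_index[OF x] by (intro sum.cong) (auto simp: indicator_def)
    also have "\<dots> \<le> local_curv n x" using finite_living by (simp add: sum.delta)
    finally show "(\<Sum>j\<in>living n. local_curv n x * indicator (cell n j) x) \<le> local_curv n x" .
  qed
  finally show ?thesis by (simp add: mult_left_mono)
qed

text \<open>The initial tilt and the curvature of all scales form a budget of at most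
  \<open>L / 2 ^ 59\<close>, of which each tilted cell uses
  \<open>size (Suc n) / 2 ^ 40\<close>.\<close>

lemma tilted_total: "(\<Sum>n<N. real (card (tilted n)) * size (Suc n)) \<le> L / 1000"
proof -
  have "total_tilt N + (\<Sum>n<N. of_nat (card (tilted n)) * ennreal (size (Suc n) / 2 ^ 40)) \<le>
      total_tilt 0 + (\<Sum>n<N. \<Sum>j\<in>living n. defect n j)"
  proof (induction N)
    case (Suc N)
    have "total_tilt (Suc N) + (\<Sum>n<Suc N. of_nat (card (tilted n)) * ennreal (size (Suc n) / 2 ^ 40)) =
      (total_tilt (Suc N) + of_nat (card (tilted N)) * ennreal (size (Suc N) / 2 ^ 40)) +
      (\<Sum>n<N. of_nat (card (tilted n)) * ennreal (size (Suc n) / 2 ^ 40))" by (simp add: ac_simps)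
    also have "\<dots> \<le> (total_tilt N + (\<Sum>j\<in>living N. defect N j)) +
      (\<Sum>n<N. of_nat (card (tilted n)) * ennreal (size (Suc n) / 2 ^ 40))"
      by (intro add_right_mono total_tilt_step)
    also have "\<dots> = (total_tilt N + (\<Sum>n<N. of_nat (card (tilted n)) * ennreal (size (Suc n) / 2 ^ 40))) +
        (\<Sum>j\<in>living N. defect N j)" by (simp add: ac_simps)
    also have "\<dots> \<le> total_tilt 0 + (\<Sum>n<N. \<Sum>j\<in>living n. defect n j) + (\<Sum>j\<in>living N. defect N j)"
      by (intro add_right_mono Suc.IH)
    finally show ?case by (simp add: ac_simps)
  qed simp
  then have "(\<Sum>n<N. of_nat (card (tilted n)) * ennreal (size (Suc n) / 2 ^ 40)) \<le>
      total_tilt 0 + (\<Sum>n<N. \<Sum>j\<in>living n. defect n j)"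
    by (rule order_trans[rotated]) (simp add: add_increasing)
  also have "total_tilt 0 \<le> (\<Sum>j\<in>living 0. ennreal (size 0 / 2 ^ 60))"
    unfolding total_tilt_def by (intro sum_mono mean_tilt_0) (auto simp: living_0)
  also have "\<dots> = ennreal (1003 * (size 0 / 2 ^ 60))"
    by (subst ennreal_mult) (auto simp: living_0 size_0 L_pos less_imp_le)
  also have "\<dots> \<le> ennreal (L / 2 ^ 60)"
    using L_pos by (intro ennreal_leI) (simp add: size_0)
  also have "(\<Sum>n<N. \<Sum>j\<in>living n. defect n j) \<le> (\<Sum>n<N. 2 ^ 31 * (\<integral>\<^sup>+ x. local_curv n x \<partial>M))"
    by (intro sum_mono sum_defect)
  also have "\<dots> = 2 ^ 31 * (\<Sum>n<N. \<integral>\<^sup>+ x. local_curv n x \<partial>M)"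
    by (rule sum_distrib_left[symmetric])
  also have "\<dots> \<le> 2 ^ 31 * ennreal (9 * \<epsilon> * L)"
    by (intro mult_left_mono int_sum_local_curv) auto
  also have "\<dots> = ennreal (2 ^ 31 * (9 * \<epsilon> * L))"
    using eps_nonneg L_pos by (subst ennreal_mult[of "2 ^ 31"]) (simp_all flip: ennreal_power)
  also have "\<dots> \<le> ennreal (L / 2 ^ 60)"
  proof (intro ennreal_leI)
    have "2 ^ 31 * (9 * \<epsilon> * L) = 19327352832 * (\<epsilon> * L)" by simp
    also have "\<dots> \<le> L / 1152921504606846976" using eps_L L_pos by linarith
    finally show "2 ^ 31 * (9 * \<epsilon> * L) \<le> L / 2 ^ 60" by simp
  qed
  also have "ennreal (L / 2 ^ 60) + ennreal (L / 2 ^ 60) = ennreal (L / 2 ^ 59)"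
    using L_pos by (simp flip: ennreal_plus)
  also have "(\<Sum>n<N. of_nat (card (tilted n)) * ennreal (size (Suc n) / 2 ^ 40)) =
      ennreal (\<Sum>n<N. real (card (tilted n)) * (size (Suc n) / 2 ^ 40))"
  proof -
    have "of_nat (card (tilted n)) * ennreal (size (Suc n) / 2 ^ 40) =
        ennreal (real (card (tilted n)) * (size (Suc n) / 2 ^ 40))" for n
      using size_pos[of "Suc n"] by (subst ennreal_mult) (simp_all add: ennreal_of_nat_eq_real_of_nat)
    then show ?thesis using size_pos by (subst sum_ennreal[symmetric]) (simp_all add: less_imp_le)
  qed
  finally have "ennreal (\<Sum>n<N. real (card (tilted n)) * (size (Suc n) / 2 ^ 40)) \<le> ennreal (L / 2 ^ 59)"
    by (simp only: add_left_mono add_right_mono)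
  then have "(\<Sum>n<N. real (card (tilted n)) * (size (Suc n) / 2 ^ 40)) \<le> L / 2 ^ 59"
    using L_pos by (subst (asm) ennreal_le_iff) auto
  moreover have "(\<Sum>n<N. real (card (tilted n)) * (size (Suc n) / 2 ^ 40)) =
      (\<Sum>n<N. real (card (tilted n)) * size (Suc n)) / 2 ^ 40"
    by (simp add: sum_divide_distrib)
  ultimately show ?thesis using L_pos by simp
qed

subsection \<open>The surviving set\<close>

text \<open>A cell dies within ten cells of an exceptional cell or of a dead parent, so tracing the death back through
  the scales adds up a geometric series; the bound \<open>22 * size (Suc m) - 12 * size n\<close> is what
  makes the induction close.\<close>

lemma dead_origin:
  assumes "\<not> alive n i"
  shows "(\<exists>m p. m < n \<and> p \<in> sparse m \<union> tilted m \<and>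
      \<bar>of_int i * size n - of_int p * size (Suc m)\<bar> \<le> 22 * size (Suc m) - 12 * size n) \<or>
    of_int i * size n \<le> 22 * size 0 - 12 * size n \<or> L - 23 * size 0 + 12 * size n \<le> of_int i * size n"
  using assms
proof (induction n arbitrary: i)
  case 0
  then consider "i < 10" | "1013 \<le> i" by force
  then show ?case
  proof cases
    case 1
    then have "of_int i * size 0 \<le> 10 * size 0" using size_pos[of 0] by (intro mult_right_mono) auto
    then show ?thesis by simp
  next
    case 2
    then have "1013 * size 0 \<le> of_int i * size 0" using size_pos[of 0] by (intro mult_right_mono) auto
    then show ?thesis by (simp add: size_0)
  qed
next
  case (Suc n)
  have s: "size n = 2 * size (Suc n)" "0 < size (Suc n)" using size_pos by (simp_all add: size_Suc)
  show ?case
  \<comment> \<open>Eleven instead of ten: an irregular cell \<open>i'\<close> within ten counts as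
    sparse or tilted only if \<open>(i' - 1) div 2\<close> is alive as well.\<close>
  proof (cases "\<exists>i'. \<bar>i' - i\<bar> \<le> 11 \<and> \<not> alive n (i' div 2)")
    case True
    then obtain i' where i': "\<bar>i' - i\<bar> \<le> 11" "\<not> alive n (i' div 2)" by blast
    define q where "q = i' div 2"
    have "\<bar>i - 2 * q\<bar> \<le> 12" using i' by (auto simp: q_def)
    then have "\<bar>of_int (i - 2 * q)\<bar> * size (Suc n) \<le> 12 * size (Suc n)"
      using s by (intro mult_right_mono) linarith+
    then have "\<bar>of_int (i - 2 * q) * size (Suc n)\<bar> \<le> 12 * size (Suc n)" using s by (simp add: abs_mult)
    moreover have "of_int (i - 2 * q) * size (Suc n) = of_int i * size (Suc n) - of_int q * size n"
      by (simp add: s algebra_simps)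
    ultimately have d: "\<bar>of_int i * size (Suc n) - of_int q * size n\<bar> \<le> 12 * size (Suc n)" by simp
    from Suc.IH[OF i'(2)[folded q_def]] consider
      (a) m p where "m < n" "p \<in> sparse m \<union> tilted m"
        "\<bar>of_int q * size n - of_int p * size (Suc m)\<bar> \<le> 22 * size (Suc m) - 12 * size n"
      | (b) "of_int q * size n \<le> 22 * size 0 - 12 * size n"
      | (c) "L - 23 * size 0 + 12 * size n \<le> of_int q * size n" by blast
    then show ?thesis
    proof cases
      case a
      have "\<bar>of_int i * size (Suc n) - of_int p * size (Suc m)\<bar> \<le> 22 * size (Suc m) - 12 * size (Suc n)"
        using a(3) d s by linarith
      then show ?thesis using a by (intro disjI1 exI[of _ m] exI[of _ p]) auto
    next
      case b
      then have "of_int i * size (Suc n) \<le> 22 * size 0 - 12 * size (Suc n)" using d s by linarith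
      then show ?thesis by blast
    next
      case c
      then have "L - 23 * size 0 + 12 * size (Suc n) \<le> of_int i * size (Suc n)" using d s by linarith
      then show ?thesis by blast
    qed
  next
    case False
    then have al: "alive n (i' div 2)" if "\<bar>i' - i\<bar> \<le> 11" for i' using that by blast
    from Suc.prems obtain i' where i': "\<bar>i' - i\<bar> \<le> 10" "\<not> regular (Suc n) i'" using al by auto
    have "i' \<in> sparse n \<union> tilted n"
      using i' al[of i'] al[of "i' - 1"] by (auto simp: sparse_def tilted_def)
    moreover have "\<bar>of_int i * size (Suc n) - of_int i' * size (Suc n)\<bar> \<le> 22 * size (Suc n) - 12 * size (Suc n)"
    proof -
      have "\<bar>of_int (i - i')\<bar> * size (Suc n) \<le> 10 * size (Suc n)"
        using s i' by (intro mult_right_mono) linarith+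
      then have "\<bar>of_int (i - i') * size (Suc n)\<bar> \<le> 10 * size (Suc n)" using s by (simp add: abs_mult)
      then show ?thesis by (simp add: algebra_simps)
    qed
    ultimately show ?thesis by (intro disjI1 exI[of _ n] exI[of _ i']) auto
  qed
qed

lemma card_int_ball:
  fixes c r s :: real
  assumes "0 < s" "0 \<le> r"
  shows "finite {i::int. \<bar>of_int i * s - c\<bar> \<le> r}" "real (card {i::int. \<bar>of_int i * s - c\<bar> \<le> r}) * s \<le> 2 * r + s"
proof -
  have eq: "{i::int. \<bar>of_int i * s - c\<bar> \<le> r} = {\<lceil>(c - r) / s\<rceil>..\<lfloor>(c + r) / s\<rfloor>}"
    using assms by (auto simp: ceiling_le_iff le_floor_iff field_simps abs_le_iff)
  show "finite {i::int. \<bar>of_int i * s - c\<bar> \<le> r}" by (simp add: eq)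
  have nat_real: "real (nat k) = max 0 (of_int k)" for k by (cases "0 \<le> k") auto
  have "real (card {i::int. \<bar>of_int i * s - c\<bar> \<le> r}) = max 0 (of_int (\<lfloor>(c + r) / s\<rfloor> + 1 - \<lceil>(c - r) / s\<rceil>))"
    unfolding eq card_atLeastAtMost_int by (simp add: nat_real)
  also have "\<dots> \<le> max 0 ((c + r) / s + 1 - (c - r) / s)"
    by (intro max.mono) (auto, linarith)
  also have "(c + r) / s + 1 - (c - r) / s = (2 * r + s) / s" using assms by (simp add: field_simps)
  also have "max 0 ((2 * r + s) / s) = (2 * r + s) / s" using assms by (simp add: max_def)
  finally show "real (card {i::int. \<bar>of_int i * s - c\<bar> \<le> r}) * s \<le> 2 * r + s"
    using assms by (simp add: pos_le_divide_eq)
qed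

text \<open>By \<open>dead_origin\<close> an exceptional cell of size \<open>size (Suc m)\<close>
  kills at most 45 times its own length, and the two ends cost at most \<open>47 * size 0\<close>.
  With \<open>sparse_total\<close> and \<open>tilted_total\<close> the whole loss stays below
  \<open>L / 2\<close>.\<close>

lemma living_length_ge: "L / 2 \<le> living_length N"
proof -
  define s where "s = size N"
  have s: "0 < s" "s \<le> size 0"
    using L_pos unfolding s_def size_def
    by (auto intro!: divide_left_mono power_increasing simp del: power_numeral)
  define D where "D = {0..<1024 * 2 ^ N} - living N"
  define E where "E m p = {i::int. \<bar>of_int i * s - of_int p * size (Suc m)\<bar> \<le> 22 * size (Suc m)}" for m and p :: int
  define B1 where "B1 = {i::int. \<bar>of_int i * s - 11 * size 0\<bar> \<le> 11 * size 0}"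
  define B2 where "B2 = {i::int. \<bar>of_int i * s - (L - 23 / 2 * size 0)\<bar> \<le> 23 / 2 * size 0}"
  have Ls: "of_int (1024 * 2 ^ N) * s = L" by (simp add: s_def size_def power_add)
  have E: "finite (E m p)" "real (card (E m p)) * s \<le> 2 * (22 * size (Suc m)) + s" for m p
    unfolding E_def using s size_pos[of "Suc m"] by (intro card_int_ball; simp)+
  have B: "finite B1" "real (card B1) * s \<le> 2 * (11 * size 0) + s"
    "finite B2" "real (card B2) * s \<le> 2 * (23 / 2 * size 0) + s"
    unfolding B1_def B2_def using s size_pos[of 0] by (intro card_int_ball; simp)+
  have sub: "D \<subseteq> (\<Union>m<N. \<Union>p\<in>sparse m \<union> tilted m. E m p) \<union> (B1 \<union> B2)"
  proof
    fix i assume i: "i \<in> D"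
    have i0: "0 \<le> of_int i * s" using i s by (auto simp: D_def)
    have "of_int i * s \<le> of_int (1024 * 2 ^ N) * s"
      using i s by (intro mult_right_mono) (auto simp: D_def simp del: of_int_mult of_int_power)
    then have iL: "of_int i * s \<le> L" using Ls by simp
    have "\<not> alive N i" using i by (auto simp: D_def living_def)
    from dead_origin[OF this, folded s_def] consider
      (a) m p where "m < N" "p \<in> sparse m \<union> tilted m"
        "\<bar>of_int i * s - of_int p * size (Suc m)\<bar> \<le> 22 * size (Suc m) - 12 * s"
      | (b) "of_int i * s \<le> 22 * size 0 - 12 * s"
      | (c) "L - 23 * size 0 + 12 * s \<le> of_int i * s" by blast
    then show "i \<in> (\<Union>m<N. \<Union>p\<in>sparse m \<union> tilted m. E m p) \<union> (B1 \<union> B2)"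
    proof cases
      case a
      then have "i \<in> E m p" using s by (simp add: E_def)
      then show ?thesis using a by blast
    next
      case b
      then have "i \<in> B1" using i0 s unfolding B1_def by (simp add: abs_le_iff)
      then show ?thesis by blast
    next
      case c
      then have "\<bar>of_int i * s - (L - 23 / 2 * size 0)\<bar> \<le> 23 / 2 * size 0"
        using iL s by linarith
      then have "i \<in> B2" unfolding B2_def by simp
      then show ?thesis by blast
    qed
  qed
  have "card D \<le> card ((\<Union>m<N. \<Union>p\<in>sparse m \<union> tilted m. E m p) \<union> (B1 \<union> B2))"
    using sub E B finite_exceptional by (intro card_mono) auto
  also have "\<dots> \<le> card (\<Union>m<N. \<Union>p\<in>sparse m \<union> tilted m. E m p) + card (B1 \<union> B2)"
    by (rule card_Un_le)
  also have "\<dots> \<le> (\<Sum>m<N. \<Sum>p\<in>sparse m \<union> tilted m. card (E m p)) + (card B1 + card B2)"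
  proof (intro add_mono card_Un_le)
    have "card (\<Union>m<N. \<Union>p\<in>sparse m \<union> tilted m. E m p) \<le> (\<Sum>m<N. card (\<Union>p\<in>sparse m \<union> tilted m. E m p))"
      by (intro card_UN_le) auto
    also have "\<dots> \<le> (\<Sum>m<N. \<Sum>p\<in>sparse m \<union> tilted m. card (E m p))"
      using finite_exceptional by (intro sum_mono card_UN_le) auto
    finally show "card (\<Union>m<N. \<Union>p\<in>sparse m \<union> tilted m. E m p) \<le> \<dots>" .
  qed
  finally have "real (card D) \<le> real ((\<Sum>m<N. \<Sum>p\<in>sparse m \<union> tilted m. card (E m p)) + (card B1 + card B2))"
    by (rule of_nat_mono)
  then have "real (card D) * s \<le> real ((\<Sum>m<N. \<Sum>p\<in>sparse m \<union> tilted m. card (E m p)) + (card B1 + card B2)) * s"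
    using s by (intro mult_right_mono) auto
  also have "\<dots> = (\<Sum>m<N. \<Sum>p\<in>sparse m \<union> tilted m. real (card (E m p)) * s) + (real (card B1) * s + real (card B2) * s)"
    by (simp add: algebra_simps sum_distrib_left)
  also have "\<dots> \<le> (\<Sum>m<N. \<Sum>p\<in>sparse m \<union> tilted m. 45 * size (Suc m)) + (23 * size 0 + 24 * size 0)"
  proof (intro add_mono sum_mono)
    fix m p assume "m \<in> {..<N}"
    then have "s \<le> size (Suc m)" using L_pos unfolding s_def size_def
      by (intro divide_left_mono power_increasing) auto
    then show "real (card (E m p)) * s \<le> 45 * size (Suc m)" using E(2)[of m p] by linarith
  qed (use B s in linarith)+
  also have "(\<Sum>m<N. \<Sum>p\<in>sparse m \<union> tilted m. 45 * size (Suc m)) \<le>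
    (\<Sum>m<N. 45 * (real (card (sparse m)) * size (Suc m) + real (card (tilted m)) * size (Suc m)))"
  proof (intro sum_mono)
    fix m
    have "real (card (sparse m \<union> tilted m)) \<le> real (card (sparse m)) + real (card (tilted m))"
      using card_Un_le[of "sparse m" "tilted m"] by linarith
    then have "real (card (sparse m \<union> tilted m)) * size (Suc m) \<le> (real (card (sparse m)) + real (card (tilted m))) * size (Suc m)"
      using size_pos[of "Suc m"] by (intro mult_right_mono) auto
    then show "(\<Sum>p\<in>sparse m \<union> tilted m. 45 * size (Suc m)) \<le>
      45 * (real (card (sparse m)) * size (Suc m) + real (card (tilted m)) * size (Suc m))"
      by (simp add: algebra_simps)
  qed
  also have "\<dots> = 45 * ((\<Sum>m<N. real (card (sparse m)) * size (Suc m)) + (\<Sum>m<N. real (card (tilted m)) * size (Suc m)))"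
    by (simp only: sum_distrib_left[symmetric] sum.distrib)
  also have "\<dots> \<le> 45 * (L / 500 + L / 1000)"
    using sparse_total[of N] tilted_total[of N] by (intro mult_left_mono add_mono) auto
  finally have "real (card D) * s \<le> L / 2" using L_pos by (simp add: size_0)
  moreover have "real (card D) = 1024 * 2 ^ N - real (card (living N))"
  proof -
    have "card (living N) \<le> card {0..<1024 * 2 ^ N :: int}" using living_subset by (intro card_mono) auto
    moreover have "card {0..<1024 * 2 ^ N :: int} = 1024 * 2 ^ N" by (simp add: nat_mult_distrib nat_power_eq)
    moreover have "card D = card {0..<1024 * 2 ^ N :: int} - card (living N)"
      unfolding D_def using living_subset finite_living by (intro card_Diff_subset) auto
    ultimately show ?thesis by (simp add: of_nat_diff)
  qed
  ultimately show ?thesis using Ls unfolding living_length_def s_def[symmetric]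
    by (simp add: left_diff_distrib)
qed

text \<open>A living cell contains a window of mass at least \<open>size n / 512\<close>, so the
  points alive down to scale \<open>n\<close> have mass at least \<open>L / 1024\<close>, whatever
  \<open>n\<close> is. These sets decrease to \<open>core\<close>.\<close>

lemma core_mass: "0 < measure M core"
proof -
  define C where "C n = {x \<in> space M. \<forall>m\<le>n. alive m (index m x)}" for n
  have [measurable]: "index n \<in> M \<rightarrow>\<^sub>M count_space UNIV" for n
    unfolding index_def by measurable
  have Cm: "C n \<in> sets M" for n unfolding C_def by measurable
  have idx: "index n x = index (Suc n) x div 2" if "x \<in> space M" for n x
  proof -
    have "x \<in> cell (Suc n) (index (Suc n) x)" using that cell_index by blast
    then have "x \<in> cell n (index (Suc n) x div 2)" using cell_parent by blast
    then show ?thesis using that cell_index by blast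
  qed
  have anc: "alive n (index n x) \<Longrightarrow> \<forall>m\<le>n. alive m (index m x)" if "x \<in> space M" for n x
  proof (induction n)
    case (Suc n)
    then have "alive n (index n x)" using alive_parent idx[OF that, of n] by metis
    then show ?case using Suc by (auto simp: le_Suc_eq)
  qed simp
  have ge: "L / 1024 \<le> measure M (C n)" for n
  proof -
    have "L / 1024 \<le> living_length n / 512" using living_length_ge[of n] by simp
    also have "\<dots> = (\<Sum>j\<in>living n. size n / 512)" by (simp add: living_length_def)
    also have "\<dots> \<le> (\<Sum>j\<in>living n. measure M (cell n j))"
    proof (intro sum_mono)
      fix j assume "j \<in> living n"
      then have "good n j" by (simp add: living_def alive_good)
      then have "size n / 512 \<le> measure M (window n j)" by (intro window_mass) (auto simp: good_def regular_def)
      also have "\<dots> \<le> measure M (cell n j)" by (intro finite_measure_mono window_cell) auto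
      finally show "size n / 512 \<le> measure M (cell n j)" .
    qed
    also have "\<dots> = measure M (\<Union>j\<in>living n. cell n j)"
    proof (rule finite_measure_finite_Union[symmetric])
      show "disjoint_family_on (cell n) (living n)"
        unfolding disjoint_family_on_def
      proof (intro ballI impI)
        fix a b :: int assume "a \<noteq> b"
        moreover have "a = b" if "x \<in> cell n a" "x \<in> cell n b" for x
          using cell_index[OF cell_h(3)[OF that(1)], of n a] cell_index[OF cell_h(3)[OF that(1)], of n b] that
          by simp
        ultimately show "cell n a \<inter> cell n b = {}" by blast
      qed
    qed (auto simp: finite_living)
    also have "(\<Union>j\<in>living n. cell n j) = C n"
    proof (intro equalityI subsetI)
      fix x assume "x \<in> (\<Union>j\<in>living n. cell n j)"
      then obtain j where j: "alive n j" "x \<in> cell n j" by (auto simp: living_def)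
      then have x: "x \<in> space M" using cell_h(3) by blast
      then have "index n x = j" using j cell_index by blast
      then show "x \<in> C n" using anc[OF x, of n] j x by (simp add: C_def)
    next
      fix x assume "x \<in> C n"
      then have x: "x \<in> space M" "alive n (index n x)" by (auto simp: C_def)
      then have "x \<in> cell n (index n x)" using cell_index by blast
      then show "x \<in> (\<Union>j\<in>living n. cell n j)" using x by (auto simp: living_def)
    qed
    finally show ?thesis .
  qed
  have "(\<lambda>n. measure M (C n)) \<longlonglongrightarrow> measure M (\<Inter>n. C n)"
  proof (rule finite_Lim_measure_decseq)
    show "range C \<subseteq> sets M" using Cm by auto
    show "decseq C" by (auto simp: decseq_def C_def)
  qed
  then have "L / 1024 \<le> measure M (\<Inter>n. C n)"
    by (rule LIMSEQ_le_const) (use ge in auto)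
  moreover have "(\<Inter>n. C n) = core" by (auto simp: C_def core_def)
  ultimately show ?thesis using L_pos by simp
qed

end

subsection \<open>From curvature to straightness\<close>

text \<open>Here \<open>p\<close> and \<open>q\<close> are almost diametral. If \<open>u\<close> and
  \<open>w\<close> are not aligned as seen from \<open>p\<close>, then \<open>p\<close> lies almost
  between them. If the same holds for \<open>q\<close>, adding both relations shows that
  \<open>dist u w\<close> is almost \<open>dist p q\<close>: this is the four-cycle. If it fails for
  \<open>q\<close>, one of \<open>u\<close>, \<open>w\<close> is close to \<open>p\<close> and the
  tilt is small after all.\<close>

lemma collinear_or_antipodal:
  fixes p q u w :: "'a::metric_space"
  assumes e: "excess p u w \<le> \<eta>" "excess q u w \<le> \<eta>"
    and D: "L - \<delta> \<le> dist p q" and L: "dist p u \<le> L" "dist p w \<le> L" "dist q u \<le> L" "dist q w \<le> L"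
    and nn: "0 \<le> \<delta>" "0 \<le> \<eta>"
  shows "dist u w - \<bar>dist p u - dist p w\<bar> \<le> 2 * \<delta> + 4 * \<eta> \<or> L - \<delta> - \<eta> \<le> dist u w"
proof -
  have t: "dist p q \<le> dist p u + dist q u" "dist p q \<le> dist p w + dist q w"
    using dist_triangle2[of p q u] dist_triangle2[of p q w] by auto
  show ?thesis
  proof (cases "dist u w \<le> max (dist p u) (dist p w)")
    case True
    then have "dist u w - \<bar>dist p u - dist p w\<bar> \<le> \<eta>"
      using e(1) unfolding excess_def by (auto simp: max_def split: if_splits)
    then show ?thesis using nn by linarith
  next
    case False
    then have p: "dist p u + dist p w \<le> dist u w + \<eta>"
      using e(1) unfolding excess_def by (auto simp: max_def split: if_splits)
    show ?thesis
    proof (cases "dist u w \<le> max (dist q u) (dist q w)")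
      case True
      then have "dist u w \<le> \<bar>dist q u - dist q w\<bar> + \<eta>"
        using e(2) unfolding excess_def by (auto simp: max_def split: if_splits)
      then consider "dist u w \<le> dist q u - dist q w + \<eta>" | "dist u w \<le> dist q w - dist q u + \<eta>"
        by linarith
      then show ?thesis
      proof cases
        case 1
        then have "dist p u \<le> \<delta> + 2 * \<eta>" using p t D L by linarith
        moreover have "dist u w \<le> dist p u + dist p w" using dist_triangle3[of u w p] by simp
        ultimately show ?thesis by linarith
      next
        case 2
        then have "dist p w \<le> \<delta> + 2 * \<eta>" using p t D L by linarith
        moreover have "dist u w \<le> dist p u + dist p w" using dist_triangle3[of u w p] by simp
        ultimately show ?thesis by linarith
      qed
    next
      case False
      then have "dist q u + dist q w \<le> dist u w + \<eta>"
        using e(2) unfolding excess_def by (auto simp: max_def split: if_splits)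
      then show ?thesis using p t D by linarith
    qed
  qed
qed

section \<open>Spaces of almost maximal length and tiny curvature\<close>

lemma (in measured_metric) Markov_measure:
  assumes [measurable]: "f \<in> borel_measurable M" and int: "(\<integral>\<^sup>+ x. f x \<partial>M) \<le> ennreal (c * t)"
    and t: "0 < t" "0 \<le> c"
  shows "measure M {x \<in> space M. ennreal t < f x} \<le> c"
proof -
  define A where "A = {x \<in> space M. ennreal t < f x}"
  have [measurable]: "A \<in> sets M" unfolding A_def by measurable
  have "ennreal (t * measure M A) = (\<integral>\<^sup>+ x. ennreal t * indicator A x \<partial>M)"
    using t by (simp add: nn_integral_cmult_indicator emeasure_eq_measure ennreal_mult)
  also have "\<dots> \<le> (\<integral>\<^sup>+ x. f x \<partial>M)"
    by (intro nn_integral_mono) (auto simp: A_def indicator_def)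
  also note int
  finally have "t * measure M A \<le> c * t" using t by (subst (asm) ennreal_le_iff) auto
  then show ?thesis using t by (simp add: A_def mult.commute)
qed

locale curved_space = measured_metric M for M :: "'a::metric_space measure" +
  fixes L e :: real
  assumes L_pos: "0 < L"
    and e_bounds: "0 < e" "e \<le> 1 / 2 ^ 2000"
    and diam: "x \<in> space M \<Longrightarrow> y \<in> space M \<Longrightarrow> dist x y \<le> L"
    and full_mass: "(1 - e) * L \<le> measure M (space M)"
    and mass_le_diam: "A \<in> sets M \<Longrightarrow> 0 \<le> D \<Longrightarrow> (\<And>x y. x \<in> A \<Longrightarrow> y \<in> A \<Longrightarrow> dist x y \<le> D) \<Longrightarrow>
      measure M A \<le> (1 + e) * D"
    and curvature: "x \<in> space M \<Longrightarrow> (\<integral>\<^sup>+ y. \<integral>\<^sup>+ z. ennreal (ekernel x y z) \<partial>M \<partial>M) \<le> ennreal e"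
begin

lemma excess_integral:
  assumes [simp]: "x \<in> space M"
  shows "(\<integral>\<^sup>+ y. \<integral>\<^sup>+ z. ennreal (excess x y z) \<partial>M \<partial>M) \<le> ennreal (e * L ^ 3)"
proof -
  have "(\<integral>\<^sup>+ y. \<integral>\<^sup>+ z. ennreal (excess x y z) \<partial>M \<partial>M) \<le>
    (\<integral>\<^sup>+ y. \<integral>\<^sup>+ z. ennreal (L ^ 3) * ennreal (ekernel x y z) \<partial>M \<partial>M)"
    using L_pos by (intro nn_integral_mono)
      (auto simp: ekernel_nonneg excess_le_ekernel diam ennreal_leI simp flip: ennreal_mult)
  also have "\<dots> = (\<integral>\<^sup>+ y. ennreal (L ^ 3) * (\<integral>\<^sup>+ z. ennreal (ekernel x y z) \<partial>M) \<partial>M)"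
  proof (intro nn_integral_cong)
    fix y assume [simp]: "y \<in> space M"
    show "(\<integral>\<^sup>+ z. ennreal (L ^ 3) * ennreal (ekernel x y z) \<partial>M) =
      ennreal (L ^ 3) * (\<integral>\<^sup>+ z. ennreal (ekernel x y z) \<partial>M)"
      by (rule nn_integral_cmult) measurable
  qed
  also have "\<dots> = ennreal (L ^ 3) * (\<integral>\<^sup>+ y. \<integral>\<^sup>+ z. ennreal (ekernel x y z) \<partial>M \<partial>M)"
    by (rule nn_integral_cmult) measurable
  also have "\<dots> \<le> ennreal (L ^ 3) * ennreal e"
    by (intro mult_left_mono curvature) auto
  finally show ?thesis using L_pos e_bounds by (simp add: ennreal_mult mult.commute)
qed

text \<open>Two points almost antipodal to \<open>u\<close> have an excess with \<open>u\<close> comparable to their distance. A large set of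
  such points would therefore have too much mass in a small ball.\<close>

lemma antipodal_small:
  assumes u [simp]: "u \<in> space M" and \<delta>: "0 \<le> \<delta>" "\<delta> \<le> 1 / 2 ^ 209"
  shows "measure M {w \<in> space M. (1 - \<delta>) * L \<le> dist u w} \<le> L / 2 ^ 201"
proof (rule ccontr)
  define B where "B = {w \<in> space M. (1 - \<delta>) * L \<le> dist u w}"
  define m where "m = measure M B"
  assume "\<not> ?thesis"
  then have m: "L / 2 ^ 201 < m" by (simp add: B_def m_def)
  then have m0: "0 < m" using L_pos by (meson divide_pos_pos less_trans zero_less_numeral zero_less_power)
  have [measurable]: "B \<in> sets M" unfolding B_def by measurable
  have Bs: "B \<subseteq> space M" by (auto simp: B_def)
  \<comment> \<open>If \<open>dist w w'\<close> is not the longest side, the excess is at least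
    \<open>dist w w' - \<delta> * L\<close>. If it is, the excess is at least
    \<open>(1 - 2 * \<delta>) * L\<close>, and \<open>dist w w' \<le> L\<close> suffices.\<close>
  have d1: "dist w w' \<le> 2 * excess u w w' + 2 * \<delta> * L" if w: "w \<in> B" "w' \<in> B" for w w'
  proof -
    have a: "(1 - \<delta>) * L \<le> dist u w" "(1 - \<delta>) * L \<le> dist u w'" "dist u w \<le> L" "dist u w' \<le> L" "dist w w' \<le> L"
      using w Bs by (auto simp: B_def diam)
    have eq: "(1 - \<delta>) * L = L - \<delta> * L" by (simp add: algebra_simps)
    have "(1::real) / 2 ^ 209 \<le> 1 / 2" by simp
    then have "\<delta> * L \<le> 1 / 2 * L" using \<delta> L_pos by (intro mult_right_mono) linarith+
    moreover have "0 \<le> \<delta> * L" using \<delta> L_pos by simp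
    ultimately show ?thesis using a unfolding eq excess_def max_def by (auto split: if_splits)
  qed
  have int: "(\<integral>\<^sup>+ w. (\<integral>\<^sup>+ w'. ennreal (dist w w') * indicator B w' \<partial>M) * indicator B w \<partial>M) \<le>
      ennreal (2 * e * L ^ 3 + 2 * \<delta> * L * m * m)"
  proof -
    have "(\<integral>\<^sup>+ w. (\<integral>\<^sup>+ w'. ennreal (dist w w') * indicator B w' \<partial>M) * indicator B w \<partial>M) \<le>
      (\<integral>\<^sup>+ w. (\<integral>\<^sup>+ w'. 2 * ennreal (excess u w w') + ennreal (2 * \<delta> * L) * indicator B w' \<partial>M) * indicator B w \<partial>M)"
    proof (intro nn_integral_mono)
      fix w assume "w \<in> space M"
      show "(\<integral>\<^sup>+ w'. ennreal (dist w w') * indicator B w' \<partial>M) * indicator B w \<le>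
        (\<integral>\<^sup>+ w'. 2 * ennreal (excess u w w') + ennreal (2 * \<delta> * L) * indicator B w' \<partial>M) * indicator B w"
      proof (cases "w \<in> B")
        case True
        have "ennreal (dist w w') \<le> 2 * ennreal (excess u w w') + ennreal (2 * \<delta> * L)" if "w' \<in> B" for w'
        proof -
          have "ennreal (dist w w') \<le> ennreal (2 * excess u w w' + 2 * \<delta> * L)"
            using d1[OF True that] by (rule ennreal_leI)
          also have "\<dots> = 2 * ennreal (excess u w w') + ennreal (2 * \<delta> * L)"
            using \<delta> L_pos excess_nonneg[of u w w'] by (simp add: ennreal_mult)
          finally show ?thesis .
        qed
        then have "(\<integral>\<^sup>+ w'. ennreal (dist w w') * indicator B w' \<partial>M) \<le>
          (\<integral>\<^sup>+ w'. 2 * ennreal (excess u w w') + ennreal (2 * \<delta> * L) * indicator B w' \<partial>M)"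
          by (intro nn_integral_mono) (auto simp: indicator_def)
        then show ?thesis using True by simp
      qed simp
    qed
    also have "\<dots> = (\<integral>\<^sup>+ w. (2 * (\<integral>\<^sup>+ w'. ennreal (excess u w w') \<partial>M) + ennreal (2 * \<delta> * L * m)) * indicator B w \<partial>M)"
    proof (intro nn_integral_cong)
      fix w assume [simp]: "w \<in> space M"
      show "(\<integral>\<^sup>+ w'. 2 * ennreal (excess u w w') + ennreal (2 * \<delta> * L) * indicator B w' \<partial>M) * indicator B w =
        (2 * (\<integral>\<^sup>+ w'. ennreal (excess u w w') \<partial>M) + ennreal (2 * \<delta> * L * m)) * indicator B w"
      proof -
        have "(\<integral>\<^sup>+ w'. 2 * ennreal (excess u w w') + ennreal (2 * \<delta> * L) * indicator B w' \<partial>M) =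
          (\<integral>\<^sup>+ w'. 2 * ennreal (excess u w w') \<partial>M) + (\<integral>\<^sup>+ w'. ennreal (2 * \<delta> * L) * indicator B w' \<partial>M)"
          by (rule nn_integral_add) measurable
        also have "(\<integral>\<^sup>+ w'. 2 * ennreal (excess u w w') \<partial>M) = 2 * (\<integral>\<^sup>+ w'. ennreal (excess u w w') \<partial>M)"
          by (rule nn_integral_cmult) measurable
        also have "(\<integral>\<^sup>+ w'. ennreal (2 * \<delta> * L) * indicator B w' \<partial>M) = ennreal (2 * \<delta> * L * m)"
          using \<delta> L_pos m0 by (simp add: nn_integral_cmult_indicator emeasure_eq_measure m_def ennreal_mult)
        finally show ?thesis by simp
      qed
    qed
    also have "\<dots> \<le> (\<integral>\<^sup>+ w. 2 * (\<integral>\<^sup>+ w'. ennreal (excess u w w') \<partial>M) + ennreal (2 * \<delta> * L * m) * indicator B w \<partial>M)"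
      by (intro nn_integral_mono) (auto simp: indicator_def)
    also have "\<dots> = (\<integral>\<^sup>+ w. 2 * (\<integral>\<^sup>+ w'. ennreal (excess u w w') \<partial>M) \<partial>M) + (\<integral>\<^sup>+ w. ennreal (2 * \<delta> * L * m) * indicator B w \<partial>M)"
      by (rule nn_integral_add) measurable
    also have "(\<integral>\<^sup>+ w. 2 * (\<integral>\<^sup>+ w'. ennreal (excess u w w') \<partial>M) \<partial>M) = 2 * (\<integral>\<^sup>+ w. (\<integral>\<^sup>+ w'. ennreal (excess u w w') \<partial>M) \<partial>M)"
      by (rule nn_integral_cmult) measurable
    also have "\<dots> \<le> 2 * ennreal (e * L ^ 3)" by (intro mult_left_mono excess_integral) auto
    also have "(\<integral>\<^sup>+ w. ennreal (2 * \<delta> * L * m) * indicator B w \<partial>M) = ennreal (2 * \<delta> * L * m * m)"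
      using \<delta> L_pos m0 by (simp add: nn_integral_cmult_indicator emeasure_eq_measure m_def[symmetric] ennreal_mult)
    also have "2 * ennreal (e * L ^ 3) + ennreal (2 * \<delta> * L * m * m) = ennreal (2 * e * L ^ 3 + 2 * \<delta> * L * m * m)"
      using \<delta> L_pos m0 e_bounds by (simp add: ennreal_mult mult.assoc)
    finally show ?thesis by (simp add: add_right_mono)
  qed
  \<comment> \<open>The mean distance of pairs in \<open>B\<close> is at most
    \<open>(2 ^ -208 + 2 ^ -900) * L\<close>, hence below \<open>\<kappa> * L\<close>, while
    \<open>16 * \<kappa> = 2 ^ -203\<close> still contradicts the assumed mass.\<close>
  define \<kappa> :: real where "\<kappa> = 1 / 2 ^ 207"
  have "\<exists>w0\<in>B. (\<integral>\<^sup>+ w'. ennreal (dist w0 w') * indicator B w' \<partial>M) \<le> ennreal (\<kappa> * L * m)"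
  proof (rule ccontr)
    assume "\<not> ?thesis"
    then have "ennreal (\<kappa> * L * m) * indicator B w \<le> (\<integral>\<^sup>+ w'. ennreal (dist w w') * indicator B w' \<partial>M) * indicator B w" for w
      by (cases "w \<in> B") (auto simp: not_le less_imp_le)
    then have "(\<integral>\<^sup>+ w. ennreal (\<kappa> * L * m) * indicator B w \<partial>M) \<le>
      (\<integral>\<^sup>+ w. (\<integral>\<^sup>+ w'. ennreal (dist w w') * indicator B w' \<partial>M) * indicator B w \<partial>M)"
      by (intro nn_integral_mono)
    also note int
    also have "(\<integral>\<^sup>+ w. ennreal (\<kappa> * L * m) * indicator B w \<partial>M) = ennreal (\<kappa> * L * m * m)"
      using L_pos m0
      by (simp add: \<kappa>_def nn_integral_cmult_indicator emeasure_eq_measure m_def[symmetric] flip: ennreal_mult)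
    finally have "\<kappa> * L * m * m \<le> 2 * e * L ^ 3 + 2 * \<delta> * L * m * m"
      using L_pos m0 e_bounds \<delta> by (subst (asm) ennreal_le_iff) auto
    moreover have "2 * \<delta> * L * m * m \<le> 2 * (1 / 2 ^ 209) * L * m * m"
      using L_pos m0 \<delta> by (intro mult_right_mono) auto
    moreover have "2 * e * L ^ 3 \<le> (1 / 2 ^ 900) * L * m * m"
    proof -
      have "(L / 2 ^ 201) * (L / 2 ^ 201) \<le> m * m" using m m0 L_pos by (intro mult_mono) auto
      then have "(1 / 2 ^ 900) * L * ((L / 2 ^ 201) * (L / 2 ^ 201)) \<le> (1 / 2 ^ 900) * L * (m * m)"
        using L_pos by (intro mult_left_mono) auto
      moreover have "2 * e * L ^ 3 \<le> 2 * (1 / 2 ^ 2000) * L ^ 3"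
        using e_bounds L_pos by (intro mult_right_mono mult_left_mono) auto
      moreover have "2 * (1 / 2 ^ 2000) * L ^ 3 \<le> (1 / 2 ^ 900) * L * ((L / 2 ^ 201) * (L / 2 ^ 201))"
      proof -
        have "(1 / 2 ^ 900) * L * ((L / 2 ^ 201) * (L / 2 ^ 201)) = (1 / 2 ^ 900 / 2 ^ 201 / 2 ^ 201) * L ^ 3"
          by (simp add: power3_eq_cube)
        moreover have "2 * (1 / 2 ^ 2000) \<le> (1 / 2 ^ 900 / 2 ^ 201 / 2 ^ 201 :: real)" by simp
        ultimately show ?thesis using L_pos by (simp only: mult_right_mono zero_le_power less_imp_le)
      qed
      ultimately show ?thesis by (simp add: mult.assoc)
    qed
    ultimately have "\<kappa> * (L * m * m) \<le> (1 / 2 ^ 900 + 2 * (1 / 2 ^ 209)) * (L * m * m)"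
      by (simp add: algebra_simps)
    then have "\<kappa> \<le> 1 / 2 ^ 900 + 2 * (1 / 2 ^ 209)" using L_pos m0 by (simp only: mult_le_cancel_right_pos mult_pos_pos)
    then show False by (simp add: \<kappa>_def)
  qed
  then obtain w0 where w0: "w0 \<in> B" "(\<integral>\<^sup>+ w'. ennreal (dist w0 w') * indicator B w' \<partial>M) \<le> ennreal (\<kappa> * L * m)" by blast
  have [simp]: "w0 \<in> space M" using w0 Bs by auto
  define A where "A = {w' \<in> space M. ennreal (2 * \<kappa> * L) < ennreal (dist w0 w') * indicator B w'}"
  have Am [measurable]: "A \<in> sets M" unfolding A_def by measurable
  \<comment> \<open>So at least half of \<open>B\<close> lies within \<open>2 * \<kappa> * L\<close>
    of \<open>w0\<close>, in a set of diameter at most \<open>4 * \<kappa> * L\<close>.\<close>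
  have "measure M A \<le> m / 2" unfolding A_def
  proof (rule Markov_measure)
    show "(\<integral>\<^sup>+ w'. ennreal (dist w0 w') * indicator B w' \<partial>M) \<le> ennreal (m / 2 * (2 * \<kappa> * L))"
      using w0(2) by (simp add: ac_simps)
  qed (use L_pos m0 in \<open>auto simp: \<kappa>_def\<close>)
  moreover have "measure M (B - A) \<le> (1 + e) * (4 * \<kappa> * L)"
  proof (rule mass_le_diam)
    fix x y assume xy: "x \<in> B - A" "y \<in> B - A"
    have "dist w0 z \<le> 2 * \<kappa> * L" if "z \<in> B - A" for z
      using that Bs L_pos by (auto simp: A_def not_less \<kappa>_def ennreal_le_iff)
    from this[OF xy(1)] this[OF xy(2)] show "dist x y \<le> 4 * \<kappa> * L"
      using dist_triangle3[of x y w0] by linarith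
  qed (use L_pos in \<open>auto simp: \<kappa>_def\<close>)
  moreover have "m \<le> measure M (B - A) + measure M A"
  proof -
    have "m \<le> measure M ((B - A) \<union> A)" unfolding m_def by (intro finite_measure_mono) auto
    also have "\<dots> \<le> measure M (B - A) + measure M A" by (intro measure_Un_le) auto
    finally show ?thesis .
  qed
  moreover have "(1 + e) * (4 * \<kappa> * L) \<le> 2 * (4 * \<kappa> * L)"
  proof (rule mult_right_mono)
    have "(1::real) / 2 ^ 2000 \<le> 1" by simp
    then show "1 + e \<le> 2" using e_bounds by linarith
  qed (use L_pos in \<open>auto simp: \<kappa>_def\<close>)
  ultimately have "m \<le> 16 * \<kappa> * L" by linarith
  also have "\<dots> = L / 2 ^ 203" by (simp add: \<kappa>_def)
  also have "\<dots> < m" using m L_pos by simp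
  finally show False by simp
qed

lemma e_small: "e \<le> 1 / 2 ^ 1000" "3 * e \<le> 1 / 2 ^ 210"
proof -
  have "(1::real) / 2 ^ 2000 \<le> 1 / 2 ^ 1000" "3 * ((1::real) / 2 ^ 2000) \<le> 1 / 2 ^ 210" by simp_all
  then show "e \<le> 1 / 2 ^ 1000" "3 * e \<le> 1 / 2 ^ 210" using e_bounds by linarith+
qed

text \<open>Otherwise the diameter bound would limit the mass to
  \<open>(1 + e) * (1 - 3 * e) * L\<close>, which is less than \<open>(1 - e) * L\<close>.\<close>

lemma far_points: "\<exists>p\<in>space M. \<exists>q\<in>space M. (1 - 3 * e) * L \<le> dist p q"
proof (rule ccontr)
  assume "\<not> ?thesis"
  then have *: "dist p q \<le> (1 - 3 * e) * L" if "p \<in> space M" "q \<in> space M" for p q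
    using that by (auto simp: not_le less_imp_le)
  have e1: "3 * e \<le> 1"
  proof -
    have "(1::real) / 2 ^ 210 \<le> 1" by simp
    then show ?thesis using e_small by linarith
  qed
  define D where "D = (1 - 3 * e) * L"
  have "measure M (space M) \<le> (1 + e) * D"
    using * e1 L_pos by (intro mass_le_diam) (auto simp: D_def)
  moreover have "(1 + e) * (1 - 3 * e) < 1 - e"
  proof -
    have "(1 + e) * (1 - 3 * e) = 1 - e - (e + 3 * (e * e))" by (simp add: algebra_simps)
    moreover have "0 < e * e" using e_bounds(1) by simp
    ultimately show ?thesis using e_bounds(1) by linarith
  qed
  then have "(1 + e) * D < (1 - e) * L" using L_pos by (simp add: D_def mult.assoc[symmetric])
  ultimately show False using full_mass by linarith
qed

text \<open>Markov's inequality twice: \<open>2 ^ -2000\<close> is split evenly for the outer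
  integral, and the remaining \<open>2 ^ -1000\<close> is at most \<open>2 ^ -700 * 2 ^ -210\<close>
  for the inner one.\<close>

lemma few_large_excess:
  assumes [simp]: "p \<in> space M"
  obtains S where "S \<in> sets M" "measure M (space M - S) \<le> L / 2 ^ 1000"
    "\<And>u. u \<in> S \<Longrightarrow> measure M {w \<in> space M. ennreal (L / 2 ^ 210) < ennreal (excess p u w)} \<le> L / 2 ^ 700"
proof
  define F where "F u = (\<integral>\<^sup>+ w. ennreal (excess p u w) \<partial>M)" for u
  have [measurable]: "F \<in> borel_measurable M" unfolding F_def by measurable
  define S where "S = {u \<in> space M. F u \<le> ennreal (L\<^sup>2 / 2 ^ 1000)}"
  show "S \<in> sets M" unfolding S_def by measurable
  have "space M - S = {u \<in> space M. ennreal (L\<^sup>2 / 2 ^ 1000) < F u}" by (auto simp: S_def)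
  also have "measure M \<dots> \<le> L / 2 ^ 1000"
  proof (rule Markov_measure)
    have "(\<integral>\<^sup>+ u. F u \<partial>M) \<le> ennreal (e * L ^ 3)" unfolding F_def by (intro excess_integral) simp
    also have "\<dots> \<le> ennreal (1 / 2 ^ 2000 * L ^ 3)"
      using L_pos e_bounds by (intro ennreal_leI mult_right_mono) auto
    also have "1 / 2 ^ 2000 * L ^ 3 = L / 2 ^ 1000 * (L\<^sup>2 / 2 ^ 1000)"
      by (simp add: power2_eq_square power3_eq_cube)
    finally show "(\<integral>\<^sup>+ u. F u \<partial>M) \<le> ennreal (L / 2 ^ 1000 * (L\<^sup>2 / 2 ^ 1000))" .
  qed (use L_pos in auto)
  finally show "measure M (space M - S) \<le> L / 2 ^ 1000" .
  fix u assume u: "u \<in> S"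
  then have [simp]: "u \<in> space M" by (simp add: S_def)
  show "measure M {w \<in> space M. ennreal (L / 2 ^ 210) < ennreal (excess p u w)} \<le> L / 2 ^ 700"
  proof (rule Markov_measure)
    have "F u \<le> ennreal (L\<^sup>2 / 2 ^ 1000)" using u by (simp add: S_def)
    also have "\<dots> \<le> ennreal (L / 2 ^ 700 * (L / 2 ^ 210))"
      using L_pos by (intro ennreal_leI) (simp add: power2_eq_square)
    finally show "(\<integral>\<^sup>+ w. ennreal (excess p u w) \<partial>M) \<le> ennreal (L / 2 ^ 700 * (L / 2 ^ 210))"
      by (simp add: F_def)
  qed (use L_pos in auto)
qed

text \<open>The height is the distance from one point \<open>p\<close> of an almost diametral pair.
  Points having large excess with \<open>p\<close> or \<open>q\<close> for too many partners are
  deleted; \<open>p\<close> itself may be among them.\<close>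

lemma flat_subspace:
  obtains V p where "V \<in> sets M" "p \<in> space M" "flat_space (restrict_space M V) (dist p) (1 / 2 ^ 200) L"
proof -
  obtain p q where pq: "p \<in> space M" "q \<in> space M" "(1 - 3 * e) * L \<le> dist p q"
    using far_points by blast
  obtain S where S: "S \<in> sets M" "measure M (space M - S) \<le> L / 2 ^ 1000"
    "\<And>u. u \<in> S \<Longrightarrow> measure M {w \<in> space M. ennreal (L / 2 ^ 210) < ennreal (excess p u w)} \<le> L / 2 ^ 700"
    using few_large_excess[OF pq(1)] by blast
  obtain T where T: "T \<in> sets M" "measure M (space M - T) \<le> L / 2 ^ 1000"
    "\<And>u. u \<in> T \<Longrightarrow> measure M {w \<in> space M. ennreal (L / 2 ^ 210) < ennreal (excess q u w)} \<le> L / 2 ^ 700"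
    using few_large_excess[OF pq(2)] by blast
  define V where "V = S \<inter> T"
  have V [measurable]: "V \<in> sets M" using S T by (auto simp: V_def)
  have Vs: "V \<subseteq> space M" using sets.sets_into_space[OF V] .
  define N where "N = restrict_space M V"
  have spN: "space N = V" using Vs by (auto simp: N_def space_restrict_space)
  have setsN: "A \<in> sets N \<longleftrightarrow> A \<in> sets M \<and> A \<subseteq> V" for A
    unfolding N_def using V by (subst sets_restrict_space_iff) (auto simp: Vs Int_absorb2)
  have measN: "measure N A = measure M A" if "A \<subseteq> V" for A
    unfolding N_def using that V Vs by (intro measure_restrict_space) (auto simp: Int_absorb2)
  have intN: "(\<integral>\<^sup>+ x. f x \<partial>N) \<le> (\<integral>\<^sup>+ x. f x \<partial>M)" for f
    unfolding N_def using V Vs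
    by (subst nn_integral_restrict_space) (auto simp: Int_absorb2 indicator_def intro!: nn_integral_mono)
  have NM [measurable]: "(\<lambda>x. x) \<in> N \<rightarrow>\<^sub>M M" unfolding N_def by (rule measurable_restrict_space1) simp
  have p [simp]: "p \<in> space M" by fact
  have distp: "dist p \<in> borel_measurable N" by measurable
  have mm: "measured_metric N"
  proof (intro measured_metric.intro finite_measureI measured_metric_axioms.intro)
    show "emeasure N (space N) \<noteq> \<infinity>"
      using V Vs by (simp add: N_def space_restrict_space emeasure_restrict_space Int_absorb2)
    show "(\<lambda>(x, y). dist x y) \<in> borel_measurable (N \<Otimes>\<^sub>M N)" by measurable
  qed
  have hs: "height_space N (dist p) (1 / 2 ^ 200)"
  proof (intro height_space.intro mm height_space_axioms.intro)
    fix A D assume A: "A \<in> sets N" "0 \<le> D" "\<And>x y. x \<in> A \<Longrightarrow> y \<in> A \<Longrightarrow> dist x y \<le> D"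
    have "measure N A \<le> (1 + e) * D" using A by (simp add: setsN measN mass_le_diam)
    also have "\<dots> \<le> (1 + 1 / 2 ^ 200) * D"
    proof (rule mult_right_mono)
      have "(1::real) / 2 ^ 1000 \<le> 1 / 2 ^ 200" by simp
      then show "1 + e \<le> 1 + 1 / 2 ^ 200" using e_small by linarith
    qed fact
    finally show "measure N A \<le> (1 + 1 / 2 ^ 200) * D" .
  next
    fix x y show "\<bar>dist p x - dist p y\<bar> \<le> dist x y"
      using dist_triangle[of p x y] dist_triangle[of p y x] by (simp add: dist_commute abs_le_iff)
  qed (use distp in auto)
  have "flat_space N (dist p) (1 / 2 ^ 200) L"
  proof (intro flat_space.intro hs flat_space_axioms.intro)
    show "0 < L" by (rule L_pos)
    show "0 \<le> dist p x \<and> dist p x \<le> L" if "x \<in> space N" for x using that spN Vs by (auto simp: diam)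
    show "(1 - 1 / 2 ^ 200) * L \<le> measure N (space N)"
    proof -
      have "measure M (space M) \<le> measure M (V \<union> ((space M - S) \<union> (space M - T)))"
        using S T by (intro finite_measure_mono) (auto simp: V_def)
      also have "\<dots> \<le> measure M V + measure M ((space M - S) \<union> (space M - T))"
        using S T V by (intro measure_Un_le) auto
      also have "\<dots> \<le> measure M V + (measure M (space M - S) + measure M (space M - T))"
        using S T by (intro add_left_mono measure_Un_le) auto
      also have "\<dots> \<le> measure M V + (L / 2 ^ 1000 + L / 2 ^ 1000)" using S T by (intro add_left_mono add_mono)
      finally have "(1 - e) * L \<le> measure M V + (L / 2 ^ 1000 + L / 2 ^ 1000)" using full_mass by linarith
      then have 1: "L - e * L \<le> measure M V + (L / 2 ^ 1000 + L / 2 ^ 1000)"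
        by (simp only: left_diff_distrib mult_1_left)
      have 2: "e * L \<le> L / 2 ^ 1000"
        using mult_right_mono[OF e_small(1), of L] L_pos by simp
      have 3: "L / 2 ^ 1000 + (L / 2 ^ 1000 + L / 2 ^ 1000) \<le> L / 2 ^ 200" using L_pos by simp
      have "a - b \<le> v + (c + c) \<Longrightarrow> b \<le> c \<Longrightarrow> c + (c + c) \<le> d \<Longrightarrow> a - d \<le> v" for a b c d v :: real
        by linarith
      from this[OF 1 2 3] have "(1 - 1 / 2 ^ 200) * L \<le> measure M V"
        by (simp only: left_diff_distrib mult_1_left times_divide_eq_left)
      then show ?thesis by (simp add: spN measN)
    qed
    fix x assume "x \<in> space N"
    then have x: "x \<in> V" and [simp]: "x \<in> space M" using spN Vs by auto
    have "(\<integral>\<^sup>+ y. \<integral>\<^sup>+ z. ennreal (ekernel x y z) \<partial>N \<partial>N) \<le> (\<integral>\<^sup>+ y. \<integral>\<^sup>+ z. ennreal (ekernel x y z) \<partial>M \<partial>N)"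
      by (intro nn_integral_mono intN)
    also have "\<dots> \<le> (\<integral>\<^sup>+ y. \<integral>\<^sup>+ z. ennreal (ekernel x y z) \<partial>M \<partial>M)" by (rule intN)
    also have "\<dots> \<le> ennreal e" by (intro curvature) simp
    also have "\<dots> \<le> ennreal (1 / 2 ^ 200)"
    proof (rule ennreal_leI)
      have "(1::real) / 2 ^ 1000 \<le> 1 / 2 ^ 200" by simp
      then show "e \<le> 1 / 2 ^ 200" using e_small by linarith
    qed
    finally show "(\<integral>\<^sup>+ y. \<integral>\<^sup>+ z. ennreal (ekernel x y z) \<partial>N \<partial>N) \<le> ennreal (1 / 2 ^ 200)" .
    define P where "P = {w \<in> space M. ennreal (L / 2 ^ 210) < ennreal (excess p x w)}"
    define Q where "Q = {w \<in> space M. ennreal (L / 2 ^ 210) < ennreal (excess q x w)}"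
    \<comment> \<open>The tolerance \<open>2 ^ -209\<close> is the sum of the errors
      \<open>3 * e\<close> and \<open>2 ^ -210\<close> in the antipodal case of
      \<open>collinear_or_antipodal\<close>, each of which is at most
      \<open>2 ^ -210\<close>.\<close>
    define R where "R = {w \<in> space M. (1 - 1 / 2 ^ 209) * L \<le> dist x w}"
    have [simp]: "q \<in> space M" by fact
    have [measurable]: "P \<in> sets M" "Q \<in> sets M" "R \<in> sets M" unfolding P_def Q_def R_def by measurable
    have PQR: "measure M P \<le> L / 2 ^ 700" "measure M Q \<le> L / 2 ^ 700" "measure M R \<le> L / 2 ^ 201"
      using S(3)[of x] T(3)[of x] antipodal_small[of x "1 / 2 ^ 209"] x by (auto simp: P_def Q_def R_def V_def)
    have sub: "{y \<in> space N. 1 / 2 ^ 200 * L < height_space.tilt (dist p) x y} \<subseteq> P \<union> (Q \<union> R)"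
    proof
      fix y assume y: "y \<in> {y \<in> space N. 1 / 2 ^ 200 * L < height_space.tilt (dist p) x y}"
      then have [simp]: "y \<in> space M" using spN Vs by auto
      show "y \<in> P \<union> (Q \<union> R)"
      proof (rule ccontr)
        assume n: "y \<notin> P \<union> (Q \<union> R)"
        then have ex: "excess p x y \<le> L / 2 ^ 210" "excess q x y \<le> L / 2 ^ 210"
          using L_pos by (auto simp: P_def Q_def not_less ennreal_le_iff)
        have eL: "3 * e * L \<le> 1 / 2 ^ 210 * L" using e_small L_pos by (intro mult_right_mono) auto
        have "dist x y - \<bar>dist p x - dist p y\<bar> \<le> 2 * (3 * e * L) + 4 * (L / 2 ^ 210) \<or> L - 3 * e * L - L / 2 ^ 210 \<le> dist x y"
          using pq(3) L_pos e_bounds by (intro collinear_or_antipodal[OF ex]) (auto simp: diam algebra_simps)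
        then show False
        proof
          assume "dist x y - \<bar>dist p x - dist p y\<bar> \<le> 2 * (3 * e * L) + 4 * (L / 2 ^ 210)"
          also have "\<dots> \<le> 2 * (1 / 2 ^ 210 * L) + 4 * (L / 2 ^ 210)" using eL by linarith
          also have "\<dots> \<le> 1 / 2 ^ 200 * L" using L_pos by simp
          finally show False using y by (simp add: height_space.tilt_def[OF hs])
        next
          assume "L - 3 * e * L - L / 2 ^ 210 \<le> dist x y"
          moreover have "(1 - 1 / 2 ^ 209) * L = L - 1 / 2 ^ 210 * L - L / 2 ^ 210" by (simp add: algebra_simps)
          ultimately have "y \<in> R" using eL unfolding R_def by simp
          then show False using n by simp
        qed
      qed
    qed
    have "measure N {y \<in> space N. 1 / 2 ^ 200 * L < height_space.tilt (dist p) x y} =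
      measure M {y \<in> space N. 1 / 2 ^ 200 * L < height_space.tilt (dist p) x y}"
      by (intro measN) (auto simp: spN)
    also have "\<dots> \<le> measure M (P \<union> (Q \<union> R))" using sub by (intro finite_measure_mono) auto
    also have "\<dots> \<le> measure M P + measure M (Q \<union> R)" by (intro measure_Un_le) auto
    also have "\<dots> \<le> measure M P + (measure M Q + measure M R)" by (intro add_left_mono measure_Un_le) auto
    also have "\<dots> \<le> L / 2 ^ 700 + (L / 2 ^ 700 + L / 2 ^ 201)" using PQR by (intro add_mono)
    also have "\<dots> \<le> 1 / 2 ^ 200 * L" using L_pos by simp
    finally show "measure N {y \<in> space N. 1 / 2 ^ 200 * L < height_space.tilt (dist p) x y} \<le> 1 / 2 ^ 200 * L" .
  qed simp
  then show thesis using that[OF V p] by (simp add: N_def)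
qed

theorem large_flat_piece:
  obtains B h where "B \<in> sets M" "0 < measure M B"
    "\<And>x. x \<in> B \<Longrightarrow> 0 \<le> h x \<and> h x \<le> L"
    "\<And>x y. x \<in> B \<Longrightarrow> y \<in> B \<Longrightarrow> dist x y \<le> 2 * \<bar>h x - h y\<bar>"
proof -
  obtain V p where V: "V \<in> sets M" "p \<in> space M" "flat_space (restrict_space M V) (dist p) (1 / 2 ^ 200) L"
    using flat_subspace .
  interpret F: flat_space "restrict_space M V" "dist p" "1 / 2 ^ 200" L by fact
  have Vs: "V \<subseteq> space M" using sets.sets_into_space[OF V(1)] .
  have core: "F.core \<in> sets M" "F.core \<subseteq> V"
    using F.sets_core V Vs by (auto simp: sets_restrict_space_iff Int_absorb2)
  have "measure (restrict_space M V) F.core = measure M F.core"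
    using core V Vs by (intro measure_restrict_space) (auto simp: Int_absorb2)
  then have "0 < measure M F.core" using F.core_mass by simp
  then show thesis
  proof (rule that[OF core(1)])
    show "0 \<le> dist p x \<and> dist p x \<le> L" if "x \<in> F.core" for x
      using that core Vs V(2) by (auto simp: diam)
  qed (rule F.core_expanding)
qed

end

subsection \<open>Hausdorff measure\<close>

lemma hausdorff1_pre_antimono: "\<delta> \<le> \<delta>' \<Longrightarrow> hausdorff1_pre \<delta>' A \<le> hausdorff1_pre \<delta> A"
  unfolding hausdorff1_pre_def by (rule INF_superset_mono) (auto intro: order_trans)

lemma hausdorff1_pre_le: "0 < \<delta> \<Longrightarrow> hausdorff1_pre \<delta> A \<le> hausdorff1_outer A"
  unfolding hausdorff1_outer_def by (rule SUP_upper) simp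

lemma hausdorff1_outer_mono: "A \<subseteq> B \<Longrightarrow> hausdorff1_outer A \<le> hausdorff1_outer B"
  unfolding hausdorff1_outer_def by (intro SUP_mono' hausdorff1_pre_mono)

lemma hausdorff1_outer_empty: "hausdorff1_outer {} = 0"
  using outer_measure_space_hausdorff1[of UNIV] by (auto simp: outer_measure_space_def positive_def)

lemma hausdorff1_outer_UN: "hausdorff1_outer (\<Union>i. A i) \<le> (\<Sum>i. hausdorff1_outer (A i))"
  unfolding hausdorff1_outer_def[of "\<Union>i. A i"]
proof (rule SUP_least)
  fix \<delta> :: real assume "\<delta> \<in> {0<..}"
  then show "hausdorff1_pre \<delta> (\<Union>i. A i) \<le> (\<Sum>i. hausdorff1_outer (A i))"
    by (intro order_trans[OF hausdorff1_pre_UN] suminf_le hausdorff1_pre_le) auto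
qed

lemma hausdorff1_pre_Un: "0 < \<delta> \<Longrightarrow> hausdorff1_pre \<delta> (A \<union> B) \<le> hausdorff1_pre \<delta> A + hausdorff1_pre \<delta> B"
proof -
  assume d: "0 < \<delta>"
  have "hausdorff1_pre \<delta> (\<Union>i. binaryset A B i) \<le> (\<Sum>i. hausdorff1_pre \<delta> (binaryset A B i))"
    by (rule hausdorff1_pre_UN)
  also have "\<dots> = hausdorff1_pre \<delta> A + hausdorff1_pre \<delta> B"
    using d by (intro suminf_binaryset_eq) (simp add: hausdorff1_pre_empty)
  finally show ?thesis by (simp add: UN_binaryset_eq)
qed

lemma hausdorff1_outer_Un: "hausdorff1_outer (A \<union> B) \<le> hausdorff1_outer A + hausdorff1_outer B"
proof -
  have "hausdorff1_outer (\<Union>i. binaryset A B i) \<le> (\<Sum>i. hausdorff1_outer (binaryset A B i))"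
    by (rule hausdorff1_outer_UN)
  also have "\<dots> = hausdorff1_outer A + hausdorff1_outer B"
    by (intro suminf_binaryset_eq hausdorff1_outer_empty)
  finally show ?thesis by (simp add: UN_binaryset_eq)
qed

lemma hausdorff1_outer_SUP_nat: "hausdorff1_outer A = (SUP n. hausdorff1_pre (1 / real (Suc n)) A)"
  unfolding hausdorff1_outer_def
proof (rule antisym)
  show "(SUP \<delta>\<in>{0<..}. hausdorff1_pre \<delta> A) \<le> (SUP n. hausdorff1_pre (1 / real (Suc n)) A)"
  proof (rule SUP_least)
    fix \<delta> :: real assume "\<delta> \<in> {0<..}"
    then obtain n where "inverse (real (Suc n)) < \<delta>" using reals_Archimedean by auto
    then show "hausdorff1_pre \<delta> A \<le> (SUP n. hausdorff1_pre (1 / real (Suc n)) A)"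
      by (intro SUP_upper2[of n] hausdorff1_pre_antimono) (auto simp: inverse_eq_divide)
  qed
  show "(SUP n. hausdorff1_pre (1 / real (Suc n)) A) \<le> (SUP \<delta>\<in>{0<..}. hausdorff1_pre \<delta> A)"
    by (rule SUP_least, rule SUP_upper) simp
qed

text \<open>A covering set of diameter below \<open>r\<close> cannot meet both \<open>A\<close> and
  \<open>B\<close>, so a covering of the union splits into a covering of each.\<close>

lemma hausdorff1_pre_separated:
  assumes sep: "\<And>x y. x \<in> A \<Longrightarrow> y \<in> B \<Longrightarrow> r \<le> dist x y" and \<delta>: "\<delta> < r"
  shows "hausdorff1_pre \<delta> A + hausdorff1_pre \<delta> B \<le> hausdorff1_pre \<delta> (A \<union> B)"
  unfolding hausdorff1_pre_def[of \<delta> "A \<union> B"]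
proof (rule INF_greatest)
  fix C :: "nat \<Rightarrow> 'a set"
  assume "C \<in> {C. A \<union> B \<subseteq> (\<Union>n. C n) \<and> (\<forall>n. bounded (C n) \<and> diameter (C n) \<le> \<delta>)}"
  then have C: "A \<subseteq> (\<Union>n. C n)" "B \<subseteq> (\<Union>n. C n)" "\<And>n. bounded (C n)" "\<And>n. diameter (C n) \<le> \<delta>" by auto
  have \<delta>0: "0 \<le> \<delta>" using C(4)[of 0] diameter_ge_0[OF C(3)[of 0]] by linarith
  define CA where "CA n = (if C n \<inter> A = {} then {} else C n)" for n
  define CB where "CB n = (if C n \<inter> B = {} then {} else C n)" for n
  have "C n \<inter> A = {} \<or> C n \<inter> B = {}" for n
  proof (rule ccontr)
    assume "\<not> ?thesis"
    then obtain x y where xy: "x \<in> C n" "x \<in> A" "y \<in> C n" "y \<in> B" by auto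
    then have "r \<le> dist x y" using sep by auto
    also have "\<dots> \<le> diameter (C n)" using xy C(3) by (intro diameter_bounded_bound) auto
    also have "\<dots> < r" using C(4)[of n] \<delta> by linarith
    finally show False by simp
  qed
  then have le: "ennreal (diameter (CA n)) + ennreal (diameter (CB n)) \<le> ennreal (diameter (C n))" for n
    by (auto simp: CA_def CB_def)
  have cov: "A \<subseteq> (\<Union>n. CA n)" "B \<subseteq> (\<Union>n. CB n)"
  proof -
    show "A \<subseteq> (\<Union>n. CA n)"
    proof
      fix x assume x: "x \<in> A"
      then obtain n where "x \<in> C n" using C(1) by auto
      then have "x \<in> CA n" using x by (auto simp: CA_def)
      then show "x \<in> (\<Union>n. CA n)" by blast
    qed
    show "B \<subseteq> (\<Union>n. CB n)"
    proof
      fix x assume x: "x \<in> B"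
      then obtain n where "x \<in> C n" using C(2) by auto
      then have "x \<in> CB n" using x by (auto simp: CB_def)
      then show "x \<in> (\<Union>n. CB n)" by blast
    qed
  qed
  have "hausdorff1_pre \<delta> A \<le> (\<Sum>n. ennreal (diameter (CA n)))"
    unfolding hausdorff1_pre_def using C cov \<delta>0 by (intro INF_lower) (auto simp: CA_def)
  moreover have "hausdorff1_pre \<delta> B \<le> (\<Sum>n. ennreal (diameter (CB n)))"
    unfolding hausdorff1_pre_def using C cov \<delta>0 by (intro INF_lower) (auto simp: CB_def)
  ultimately have "hausdorff1_pre \<delta> A + hausdorff1_pre \<delta> B \<le>
      (\<Sum>n. ennreal (diameter (CA n))) + (\<Sum>n. ennreal (diameter (CB n)))"
    by (rule add_mono)
  also have "\<dots> = (\<Sum>n. ennreal (diameter (CA n)) + ennreal (diameter (CB n)))"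
    by (rule suminf_add) auto
  also have "\<dots> \<le> (\<Sum>n. ennreal (diameter (C n)))" using le by (intro suminf_le) auto
  finally show "hausdorff1_pre \<delta> A + hausdorff1_pre \<delta> B \<le> (\<Sum>n. ennreal (diameter (C n)))" .
qed

lemma hausdorff1_outer_separated:
  assumes sep: "\<And>x y. x \<in> A \<Longrightarrow> y \<in> B \<Longrightarrow> r \<le> dist x y" and r: "0 < r"
  shows "hausdorff1_outer A + hausdorff1_outer B \<le> hausdorff1_outer (A \<union> B)"
proof -
  define d where "d n = min (r / 2) (1 / real (Suc n))" for n
  have d: "0 < d n" "d n < r" "d n \<le> 1 / real (Suc n)" for n using r by (auto simp: d_def)
  have inc: "incseq (\<lambda>n. hausdorff1_pre (1 / real (Suc n)) S)" for S :: "'a set"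
    by (intro incseq_SucI hausdorff1_pre_antimono) (auto intro!: divide_left_mono)
  have "hausdorff1_outer A + hausdorff1_outer B =
    (SUP n. hausdorff1_pre (1 / real (Suc n)) A + hausdorff1_pre (1 / real (Suc n)) B)"
    unfolding hausdorff1_outer_SUP_nat by (intro ennreal_SUP_add[symmetric] inc)
  also have "\<dots> \<le> hausdorff1_outer (A \<union> B)"
  proof (rule SUP_least)
    fix n
    have "hausdorff1_pre (1 / real (Suc n)) A + hausdorff1_pre (1 / real (Suc n)) B \<le>
        hausdorff1_pre (d n) A + hausdorff1_pre (d n) B"
      using d by (intro add_mono hausdorff1_pre_antimono) auto
    also have "\<dots> \<le> hausdorff1_pre (d n) (A \<union> B)"
      using sep d by (intro hausdorff1_pre_separated[of A B r]) auto
    also have "\<dots> \<le> hausdorff1_outer (A \<union> B)" using d by (intro hausdorff1_pre_le)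
    finally show "hausdorff1_pre (1 / real (Suc n)) A + hausdorff1_pre (1 / real (Suc n)) B \<le> hausdorff1_outer (A \<union> B)" .
  qed
  finally show ?thesis .
qed

text \<open>Caratheodory's criterion for metric outer measures: consecutive layers around the boundary
  level have summable measure because every second layer is separated from the next.\<close>

lemma lipschitz_superlevel_sets:
  fixes f :: "'a::metric_space \<Rightarrow> real"
  assumes lip: "\<And>x y. x \<in> X \<Longrightarrow> y \<in> X \<Longrightarrow> \<bar>f x - f y\<bar> \<le> dist x y"
  shows "{x \<in> X. t < f x} \<in> sets (hausdorff1 X)"
proof -
  define U where "U = {x \<in> X. t < f x}"
  have main: "hausdorff1_outer (A \<inter> U) + hausdorff1_outer (A - U) \<le> hausdorff1_outer A" if A: "A \<subseteq> X" for A
  proof (cases "hausdorff1_outer A = top")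
    case False
    then have fin: "hausdorff1_outer A < top" by (simp add: less_top)
    define a where "a n = 1 / real (Suc n)" for n
    have a: "a (Suc n) < a n" "0 < a n" for n by (simp_all add: a_def field_simps)
    define E where "E n = {x \<in> A. t + a n < f x}" for n
    define D where "D n = {x \<in> A. t + a (Suc n) < f x \<and> f x \<le> t + a n}" for n
    have E_le: "hausdorff1_outer (E n) + hausdorff1_outer (A - U) \<le> hausdorff1_outer A" for n
    proof -
      have "a n \<le> dist x y" if "x \<in> E n" "y \<in> A - U" for x y
        using that A lip[of x y] by (auto simp: E_def U_def subset_eq not_less)
      then have "hausdorff1_outer (E n) + hausdorff1_outer (A - U) \<le> hausdorff1_outer (E n \<union> (A - U))"
        using a by (intro hausdorff1_outer_separated[of _ _ "a n"]) auto
      also have "\<dots> \<le> hausdorff1_outer A" by (intro hausdorff1_outer_mono) (auto simp: E_def)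
      finally show ?thesis .
    qed
    have anti: "a n \<le> a m" if "m \<le> n" for m n using that by (simp add: a_def divide_left_mono)
    \<comment> \<open>Layers of one parity: between a new layer and all earlier ones of this parity
      lies an omitted layer, whose width \<open>r\<close> separates them.\<close>
    have layers: "(\<Sum>k<N. hausdorff1_outer (D (2 * k + i))) \<le> hausdorff1_outer (\<Union>k<N. D (2 * k + i))" for N i
    proof (induction N)
      case (Suc N)
      show ?case
      proof (cases N)
        case 0
        then show ?thesis by (simp add: lessThan_Suc)
      next
        case (Suc N')
        define r where "r = a (2 * N' + i + 1) - a (2 * N + i)"
        have r: "0 < r" unfolding r_def using Suc a(1)[of "2 * N' + i + 1"] by simp
        have "r \<le> dist x y" if xy: "x \<in> (\<Union>k<N. D (2 * k + i))" "y \<in> D (2 * N + i)" for x y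
        proof -
          obtain k where k: "k < N" "x \<in> D (2 * k + i)" using xy by auto
          then have "t + a (Suc (2 * k + i)) < f x" "x \<in> X" using A by (auto simp: D_def)
          moreover have "a (2 * N' + i + 1) \<le> a (Suc (2 * k + i))" using k Suc by (intro anti) auto
          moreover have "f y \<le> t + a (2 * N + i)" "y \<in> X" using xy A by (auto simp: D_def)
          ultimately show ?thesis using lip[of x y] unfolding r_def by linarith
        qed
        then have "hausdorff1_outer (\<Union>k<N. D (2 * k + i)) + hausdorff1_outer (D (2 * N + i)) \<le>
          hausdorff1_outer ((\<Union>k<N. D (2 * k + i)) \<union> D (2 * N + i))"
          using r by (intro hausdorff1_outer_separated[of _ _ r])
        then have "(\<Sum>k<N. hausdorff1_outer (D (2 * k + i))) + hausdorff1_outer (D (2 * N + i)) \<le>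
          hausdorff1_outer ((\<Union>k<N. D (2 * k + i)) \<union> D (2 * N + i))"
          using Suc.IH by (meson add_right_mono order_trans)
        then show ?thesis by (simp add: lessThan_Suc Un_commute add.commute)
      qed
    qed (simp add: hausdorff1_outer_empty)
    have half: "(\<Sum>k. hausdorff1_outer (D (2 * k + i))) \<le> hausdorff1_outer A" for i
    proof (rule suminf_le_const)
      fix N show "(\<Sum>k<N. hausdorff1_outer (D (2 * k + i))) \<le> hausdorff1_outer A"
        by (rule order_trans[OF layers]) (intro hausdorff1_outer_mono; auto simp: D_def)
    qed auto
    have tot: "(\<Sum>k<N. hausdorff1_outer (D k)) \<le> hausdorff1_outer A + hausdorff1_outer A" for N
    proof -
      have "(\<Sum>k<N. hausdorff1_outer (D k)) \<le> (\<Sum>k<2*N. hausdorff1_outer (D k))"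
        by (intro sum_mono2) auto
      also have "\<dots> = (\<Sum>k<N. hausdorff1_outer (D (2 * k)) + hausdorff1_outer (D (2 * k + 1)))"
        by (induction N) (simp_all add: ac_simps)
      also have "\<dots> = (\<Sum>k<N. hausdorff1_outer (D (2 * k + 0))) + (\<Sum>k<N. hausdorff1_outer (D (2 * k + 1)))"
        by (simp add: sum.distrib)
      also have "\<dots> \<le> (\<Sum>k. hausdorff1_outer (D (2 * k + 0))) + (\<Sum>k. hausdorff1_outer (D (2 * k + 1)))"
        by (intro add_mono sum_le_suminf) auto
      also have "\<dots> \<le> hausdorff1_outer A + hausdorff1_outer A" by (intro add_mono half)
      finally show ?thesis .
    qed
    have "(\<Sum>k. hausdorff1_outer (D k)) \<le> hausdorff1_outer A + hausdorff1_outer A"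
      by (rule suminf_le_const[OF _ tot]) auto
    then have sfin: "(\<Sum>k. hausdorff1_outer (D k)) < top" using fin by (auto simp: le_less_trans)
    have cover: "A \<inter> U \<subseteq> E n \<union> (\<Union>k. D (k + n))" for n
    proof
      fix x assume x: "x \<in> A \<inter> U"
      show "x \<in> E n \<union> (\<Union>k. D (k + n))"
      proof (cases "x \<in> E n")
        case False
        then have le: "f x \<le> t + a n" using x by (auto simp: E_def)
        obtain m0 where "inverse (real (Suc m0)) < f x - t"
          using reals_Archimedean[of "f x - t"] x by (auto simp: U_def)
        then have ex: "t + a m0 < f x" by (simp add: a_def inverse_eq_divide)
        define m where "m = (LEAST m. t + a m < f x)"
        have m: "t + a m < f x" unfolding m_def using ex by (rule LeastI)
        have "n < m"
        proof (rule ccontr)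
          assume "\<not> n < m"
          then have "a n \<le> a m" by (intro anti) simp
          then show False using m le by linarith
        qed
        then have "\<not> t + a (m - 1) < f x" unfolding m_def by (intro not_less_Least) simp
        then have "x \<in> D (m - 1)" using m x \<open>n < m\<close> by (auto simp: D_def not_less)
        moreover have "m - 1 = (m - 1 - n) + n" using \<open>n < m\<close> by simp
        ultimately show ?thesis by (metis UN_I UNIV_I UnI2)
      qed simp
    qed
    have bound: "hausdorff1_outer (A \<inter> U) + hausdorff1_outer (A - U) \<le>
        hausdorff1_outer A + (\<Sum>k. hausdorff1_outer (D (k + n)))" for n
    proof -
      have "hausdorff1_outer (A \<inter> U) \<le> hausdorff1_outer (E n \<union> (\<Union>k. D (k + n)))"
        by (intro hausdorff1_outer_mono cover)
      also have "\<dots> \<le> hausdorff1_outer (E n) + hausdorff1_outer (\<Union>k. D (k + n))"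
        by (rule hausdorff1_outer_Un)
      also have "\<dots> \<le> hausdorff1_outer (E n) + (\<Sum>k. hausdorff1_outer (D (k + n)))"
        by (intro add_left_mono hausdorff1_outer_UN)
      finally have "hausdorff1_outer (A \<inter> U) + hausdorff1_outer (A - U) \<le>
        hausdorff1_outer (E n) + (\<Sum>k. hausdorff1_outer (D (k + n))) + hausdorff1_outer (A - U)"
        by (rule add_right_mono)
      also have "\<dots> = (hausdorff1_outer (E n) + hausdorff1_outer (A - U)) + (\<Sum>k. hausdorff1_outer (D (k + n)))"
        by (simp add: ac_simps)
      also have "\<dots> \<le> hausdorff1_outer A + (\<Sum>k. hausdorff1_outer (D (k + n)))"
        by (intro add_right_mono E_le)
      finally show ?thesis .
    qed
    \<comment> \<open>Adding the first \<open>n\<close> layers to both sides completes the tail in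
      \<open>bound\<close> to \<open>S\<close>; in the limit the finite \<open>S\<close> can be
      cancelled.\<close>
    define S where "S = (\<Sum>k. hausdorff1_outer (D k))"
    have "(hausdorff1_outer (A \<inter> U) + hausdorff1_outer (A - U)) + (\<Sum>k<n. hausdorff1_outer (D k)) \<le>
        hausdorff1_outer A + S" for n
    proof -
      have "S = (\<Sum>k. hausdorff1_outer (D (k + n))) + (\<Sum>k<n. hausdorff1_outer (D k))"
        unfolding S_def by (intro suminf_offset) auto
      then show ?thesis using add_right_mono[OF bound[of n], of "\<Sum>k<n. hausdorff1_outer (D k)"]
        by (simp add: add.assoc)
    qed
    moreover have "(\<lambda>n. (hausdorff1_outer (A \<inter> U) + hausdorff1_outer (A - U)) + (\<Sum>k<n. hausdorff1_outer (D k)))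
        \<longlonglongrightarrow> (hausdorff1_outer (A \<inter> U) + hausdorff1_outer (A - U)) + S"
      unfolding S_def by (intro tendsto_add tendsto_const summable_LIMSEQ) auto
    ultimately have "(hausdorff1_outer (A \<inter> U) + hausdorff1_outer (A - U)) + S \<le> hausdorff1_outer A + S"
      by (intro LIMSEQ_le_const2) auto
    then show ?thesis using sfin by (auto simp: S_def[symmetric] ennreal_add_left_cancel_le add.commute[of _ S])
  qed simp
  have "hausdorff1_outer (U \<inter> A) + hausdorff1_outer ((X - U) \<inter> A) = hausdorff1_outer A" if A: "A \<in> Pow X" for A
  proof (rule antisym)
    have "(X - U) \<inter> A = A - U" using A by auto
    then show "hausdorff1_outer (U \<inter> A) + hausdorff1_outer ((X - U) \<inter> A) \<le> hausdorff1_outer A"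
      using main[of A] A by (simp add: Int_commute)
    have "A = (U \<inter> A) \<union> ((X - U) \<inter> A)" using A by auto
    then show "hausdorff1_outer A \<le> hausdorff1_outer (U \<inter> A) + hausdorff1_outer ((X - U) \<inter> A)"
      using hausdorff1_outer_Un by metis
  qed
  then show ?thesis unfolding U_def[symmetric] sets_hausdorff1 lambda_system_def by (auto simp: U_def)
qed

lemma lipschitz_measurable:
  fixes f :: "'a::metric_space \<Rightarrow> real"
  assumes "\<And>x y. x \<in> X \<Longrightarrow> y \<in> X \<Longrightarrow> \<bar>f x - f y\<bar> \<le> dist x y"
  shows "f \<in> borel_measurable (hausdorff1 X)"
  using lipschitz_superlevel_sets[OF assms]
  by (intro borel_measurable_iff_greater[THEN iffD2]) (auto simp: space_hausdorff1)

lemma dist_measurable_hausdorff1: "dist z \<in> borel_measurable (hausdorff1 X)"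
  by (rule lipschitz_measurable) (metis abs_dist_diff_le dist_commute)

lemma closed_sets_hausdorff1:
  assumes "closed C"
  shows "C \<inter> X \<in> sets (hausdorff1 X)"
proof (cases "C = {}")
  case False
  have "(\<lambda>x. infdist x C) \<in> borel_measurable (hausdorff1 X)"
  proof (rule lipschitz_measurable)
    fix x y show "\<bar>infdist x C - infdist y C\<bar> \<le> dist x y"
      using infdist_triangle[of x C y] infdist_triangle[of y C x] by (simp add: dist_commute abs_le_iff)
  qed
  then have "{x \<in> space (hausdorff1 X). infdist x C \<le> 0} \<in> sets (hausdorff1 X)" by measurable
  also have "{x \<in> space (hausdorff1 X). infdist x C \<le> 0} = C \<inter> X"
  proof -
    have "infdist x C \<le> 0 \<longleftrightarrow> x \<in> C" for x
      using infdist_nonneg[of x C] in_closed_iff_infdist_zero[OF assms False, of x] by linarith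
    then show ?thesis by (auto simp: space_hausdorff1)
  qed
  finally show ?thesis .
qed simp

subsection \<open>Exhaustion by lineable pieces\<close>

text \<open>Greedy choice: the measure of each new set is at least half of what any admissible set
  could still contribute. The measures of disjoint sets tend to zero, and twice these measures bound
  that of any admissible set disjoint from all.\<close>

lemma (in finite_measure) exhaustion:
  assumes "Q {}"
  obtains A :: "nat \<Rightarrow> 'a set" where "\<And>i. A i \<in> sets M" "\<And>i. Q (A i)" "disjoint_family A"
    "\<And>B. B \<in> sets M \<Longrightarrow> Q B \<Longrightarrow> B \<inter> (\<Union>i. A i) = {} \<Longrightarrow> measure M B = 0"
proof -
  define K where "K U = {B \<in> sets M. Q B \<and> B \<inter> U = {}}" for U
  have "\<exists>B\<in>K U. \<forall>B'\<in>K U. measure M B' \<le> 2 * measure M B" for U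
  proof (cases "\<forall>B\<in>K U. measure M B = 0")
    case True
    have "{} \<in> K U" using assms by (simp add: K_def)
    then show ?thesis using True by force
  next
    case False
    then obtain B0 where B0: "B0 \<in> K U" "0 < measure M B0" using measure_nonneg[of M] by (metis less_le)
    define s where "s = (SUP B\<in>K U. measure M B)"
    have bdd: "bdd_above (measure M ` K U)"
      by (intro bdd_aboveI[of _ "measure M (space M)"]) (auto simp: bounded_measure)
    then have le: "measure M B \<le> s" if "B \<in> K U" for B
      unfolding s_def using that by (rule cSUP_upper2) simp
    have "0 < s" using B0 le by force
    then have "s / 2 < (SUP B\<in>K U. measure M B)" by (simp add: s_def[symmetric])
    then obtain B where "B \<in> K U" "s / 2 < measure M B"
      using bdd B0 by (subst (asm) less_cSUP_iff) auto
    then show ?thesis using le by force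
  qed
  then obtain pick where pick: "pick U \<in> K U" "\<And>B'. B' \<in> K U \<Longrightarrow> measure M B' \<le> 2 * measure M (pick U)" for U
    by metis
  define V where "V = rec_nat {} (\<lambda>n U. U \<union> pick U)"
  define A where "A n = pick (V n)" for n
  have V: "V 0 = {}" "V (Suc n) = V n \<union> A n" for n by (simp_all add: V_def A_def)
  have Am: "A n \<in> sets M" "Q (A n)" "A n \<inter> V n = {}" for n
    using pick(1)[of "V n"] by (auto simp: A_def K_def)
  have VA: "V n = (\<Union>i<n. A i)" for n by (induction n) (auto simp: V lessThan_Suc)
  have disj: "disjoint_family A"
  proof -
    have "A i \<inter> A j = {}" if "i < j" for i j using Am(3)[of j] that unfolding VA by blast
    then show ?thesis unfolding disjoint_family_on_def by (metis Int_commute linorder_neqE_nat)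
  qed
  have "(\<lambda>n. measure M (A n)) sums measure M (\<Union>i. A i)"
    using Am disj by (intro finite_measure_UNION) auto
  then have lim: "(\<lambda>n. 2 * measure M (A n)) \<longlonglongrightarrow> 2 * 0"
    by (intro tendsto_mult tendsto_const summable_LIMSEQ_zero sums_summable)
  have "measure M B = 0" if B: "B \<in> sets M" "Q B" "B \<inter> (\<Union>i. A i) = {}" for B
  proof -
    have "B \<in> K (V n)" for n using B by (auto simp: K_def VA)
    then have "measure M B \<le> 2 * measure M (A n)" for n unfolding A_def by (rule pick(2))
    then have "measure M B \<le> 2 * 0" by (intro LIMSEQ_le_const[OF lim]) blast
    then show ?thesis using measure_nonneg[of M B] by linarith
  qed
  then show thesis using that[of A] Am disj by blast
qed

text \<open>Says that \<open>B\<close> is the image of a bounded set of reals under a 2-Lipschitz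
  map, namely the inverse of \<open>h\<close>. The lower bound 0 only fixes the position for the
  later placement on the line.\<close>

definition lineable :: "'a::metric_space set \<Rightarrow> bool" where
  "lineable B \<longleftrightarrow> (\<exists>h C. (\<forall>x\<in>B. 0 \<le> h x \<and> h x \<le> (C::real)) \<and>
     (\<forall>x\<in>B. \<forall>y\<in>B. dist x y \<le> 2 * \<bar>h x - h y\<bar>))"

lemma lineable_empty: "lineable {}" by (simp add: lineable_def)

locale hausdorff_space = finite_measure M for M :: "'a::metric_space measure" +
  assumes outer: "A \<in> sets M \<Longrightarrow> emeasure M A = hausdorff1_outer A"
    and closed_sets: "closed C \<Longrightarrow> C \<inter> space M \<in> sets M"
begin

text \<open>Finite length yields countable coverings by arbitrarily small sets, hence separability,
  on which the joint measurability of the distance rests.\<close>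

lemma dense_subset:
  obtains D :: "'a set" where "countable D" "\<And>x r. x \<in> space M \<Longrightarrow> 0 < r \<Longrightarrow> \<exists>d\<in>D. dist x d < r" "D \<subseteq> space M"
proof -
  have ex: "\<exists>C :: nat \<Rightarrow> 'a set. space M \<subseteq> (\<Union>i. C i) \<and> (\<forall>i. bounded (C i) \<and> diameter (C i) \<le> 1 / real (Suc n))" for n
  proof -
    have "hausdorff1_pre (1 / real (Suc n)) (space M) \<le> hausdorff1_outer (space M)"
      by (rule hausdorff1_pre_le) simp
    also have "\<dots> = emeasure M (space M)" by (simp add: outer)
    also have "\<dots> < top" by (simp add: less_top[symmetric])
    finally have "hausdorff1_pre (1 / real (Suc n)) (space M) < top" .
    then show ?thesis unfolding hausdorff1_pre_def INF_less_iff by blast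
  qed
  then have "\<exists>C :: nat \<Rightarrow> nat \<Rightarrow> 'a set. \<forall>n. space M \<subseteq> (\<Union>i. C n i) \<and>
      (\<forall>i. bounded (C n i) \<and> diameter (C n i) \<le> 1 / real (Suc n))"
    by (intro choice allI)
  then obtain C :: "nat \<Rightarrow> nat \<Rightarrow> 'a set" where C: "\<And>n. space M \<subseteq> (\<Union>i. C n i)"
      "\<And>n i. bounded (C n i)" "\<And>n i. diameter (C n i) \<le> 1 / real (Suc n)" by blast
  define D where "D = (\<lambda>(n, i). SOME x. x \<in> C n i \<inter> space M) ` {(n, i). C n i \<inter> space M \<noteq> {}}"
  have inD: "(SOME x. x \<in> C n i \<inter> space M) \<in> C n i \<inter> space M" if "C n i \<inter> space M \<noteq> {}" for n i
    using that by (simp only: some_in_eq not_False_eq_True)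
  show thesis
  proof
    show "countable D" unfolding D_def by (intro countable_image) auto
    show "D \<subseteq> space M" unfolding D_def using inD by auto
    fix x and r :: real assume x: "x \<in> space M" and r: "0 < r"
    obtain n where n: "inverse (real (Suc n)) < r" using reals_Archimedean[OF r] by auto
    obtain i where i: "x \<in> C n i" using C(1)[of n] x by auto
    define d where "d = (SOME x. x \<in> C n i \<inter> space M)"
    have ne: "C n i \<inter> space M \<noteq> {}" using i x by auto
    have d: "d \<in> C n i" "d \<in> D" using inD[OF ne] ne by (auto simp: d_def D_def)
    have "dist x d \<le> diameter (C n i)" using i d C(2) by (intro diameter_bounded_bound) auto
    also have "\<dots> < r" using C(3)[of n i] n by (simp add: inverse_eq_divide)
    finally show "\<exists>d\<in>D. dist x d < r" using d by blast
  qed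
qed

lemma dist_measurable_1: "(\<lambda>x. dist z x) \<in> borel_measurable M"
proof (rule borel_measurable_iff_le[THEN iffD2], rule allI)
  fix a
  have "{w \<in> space M. dist z w \<le> a} = cball z a \<inter> space M" by auto
  then show "{w \<in> space M. dist z w \<le> a} \<in> sets M" using closed_sets[OF closed_cball] by simp
qed

text \<open>As the infimum of \<open>dist d x + dist d y\<close> over a countable dense set, the
  distance is built from measurable functions of one variable.\<close>

lemma measured_metric: "measured_metric M"
proof (intro measured_metric.intro measured_metric_axioms.intro)
  show "finite_measure M" by unfold_locales
  obtain D :: "'a set" where D: "countable D" "\<And>x r. x \<in> space M \<Longrightarrow> 0 < r \<Longrightarrow> \<exists>d\<in>D. dist x d < r" "D \<subseteq> space M"
    using dense_subset by blast
  have eq: "ennreal (dist x y) = (INF d\<in>D. ennreal (dist d x + dist d y))" if x: "x \<in> space M" for x y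
  proof (rule antisym)
    show "ennreal (dist x y) \<le> (INF d\<in>D. ennreal (dist d x + dist d y))"
      by (intro INF_greatest ennreal_leI) (simp add: dist_triangle3)
    show "(INF d\<in>D. ennreal (dist d x + dist d y)) \<le> ennreal (dist x y)"
    proof (rule ennreal_le_epsilon)
      fix e :: real assume e: "0 < e"
      obtain d where d: "d \<in> D" "dist x d < e / 2" using D(2)[OF x, of "e / 2"] e by auto
      have "(INF d\<in>D. ennreal (dist d x + dist d y)) \<le> ennreal (dist d x + dist d y)"
        using d by (intro INF_lower)
      also have "\<dots> \<le> ennreal (dist x y + e)"
        using d dist_triangle[of d y x] by (intro ennreal_leI) (simp add: dist_commute)
      also have "\<dots> = ennreal (dist x y) + ennreal e" using e by simp
      finally show "(INF d\<in>D. ennreal (dist d x + dist d y)) \<le> ennreal (dist x y) + ennreal e" .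
    qed
  qed
  have [measurable]: "dist d \<in> borel_measurable M" for d by (rule dist_measurable_1)
  have "(\<lambda>p. INF d\<in>D. ennreal (dist d (fst p) + dist d (snd p))) \<in> borel_measurable (M \<Otimes>\<^sub>M M)"
    using D(1) by (intro borel_measurable_INF) measurable
  then have "(\<lambda>p. ennreal (dist (fst p) (snd p))) \<in> borel_measurable (M \<Otimes>\<^sub>M M)"
    by (rule measurable_cong[THEN iffD1, rotated]) (auto simp: space_pair_measure eq)
  then have "(\<lambda>p. enn2real (ennreal (dist (fst p) (snd p)))) \<in> borel_measurable (M \<Otimes>\<^sub>M M)"
    by measurable
  then show "(\<lambda>(x, y). dist x y) \<in> borel_measurable (M \<Otimes>\<^sub>M M)"
    by (simp add: split_beta')
qed

end

sublocale hausdorff_space \<subseteq> measured_metric M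
  by (rule measured_metric)

section \<open>Passage to the density situation\<close>

context hausdorff_space begin

text \<open>For almost every \<open>x\<close> the double integral is finite, so its part over
  triples close to \<open>x\<close> tends to zero by dominated convergence. Countably many scales
  exhaust the space, so one of them works on a set of positive measure.\<close>

lemma small_scale_curvature:
  assumes fin: "(\<integral>\<^sup>+ x. \<integral>\<^sup>+ y. \<integral>\<^sup>+ z. ennreal (ekernel x y z) \<partial>M \<partial>M \<partial>M) < top"
    and pos: "0 < measure M (space M)" and e: "0 < e"
  obtains A n where "A \<in> sets M" "0 < measure M A"
    "\<And>x. x \<in> A \<Longrightarrow> (\<integral>\<^sup>+ y. \<integral>\<^sup>+ z. (if max (dist x y) (dist x z) < 1 / real (Suc n) then ennreal (ekernel x y z) else 0) \<partial>M \<partial>M) \<le> ennreal e"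
proof -
  define g where "g n x p = (if max (dist x (fst p)) (dist x (snd p)) < 1 / real (Suc n)
    then ennreal (ekernel x (fst p) (snd p)) else 0)" for n and x :: 'a and p
  define F where "F n x = (\<integral>\<^sup>+ p. g n x p \<partial>(M \<Otimes>\<^sub>M M))" for n x
  have gm: "g n x \<in> borel_measurable (M \<Otimes>\<^sub>M M)" if [simp]: "x \<in> space M" for n x
    unfolding g_def by measurable
  have F_eq: "F n x = (\<integral>\<^sup>+ y. \<integral>\<^sup>+ z. (if max (dist x y) (dist x z) < 1 / real (Suc n) then ennreal (ekernel x y z) else 0) \<partial>M \<partial>M)"
    if x: "x \<in> space M" for n x
    unfolding F_def nn_integral_fst[OF gm[OF x], symmetric] by (simp only: g_def fst_conv snd_conv)
  have Fm [measurable]: "F n \<in> borel_measurable M" for n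
  proof -
    have "(\<lambda>x. \<integral>\<^sup>+ y. \<integral>\<^sup>+ z. (if max (dist x y) (dist x z) < 1 / real (Suc n) then ennreal (ekernel x y z) else 0) \<partial>M \<partial>M) \<in> borel_measurable M"
      by measurable
    then show ?thesis by (rule measurable_cong[THEN iffD1, rotated]) (simp add: F_eq)
  qed
  have ae: "AE x in M. (\<integral>\<^sup>+ y. \<integral>\<^sup>+ z. ennreal (ekernel x y z) \<partial>M \<partial>M) \<noteq> \<infinity>"
    using fin by (intro nn_integral_noteq_infinite) auto
  have ae2: "AE x in M. \<exists>n. F n x \<le> ennreal e"
    using ae
  proof (rule AE_mp, intro AE_I2 impI)
    fix x assume x [simp]: "x \<in> space M" and "(\<integral>\<^sup>+ y. \<integral>\<^sup>+ z. ennreal (ekernel x y z) \<partial>M \<partial>M) \<noteq> \<infinity>"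
    moreover have km: "(\<lambda>p. ennreal (ekernel x (fst p) (snd p))) \<in> borel_measurable (M \<Otimes>\<^sub>M M)"
      by measurable
    have "(\<integral>\<^sup>+ p. ennreal (ekernel x (fst p) (snd p)) \<partial>(M \<Otimes>\<^sub>M M)) =
        (\<integral>\<^sup>+ y. \<integral>\<^sup>+ z. ennreal (ekernel x y z) \<partial>M \<partial>M)"
      unfolding nn_integral_fst[OF km, symmetric] by (simp only: fst_conv snd_conv)
    ultimately have fin': "(\<integral>\<^sup>+ p. ennreal (ekernel x (fst p) (snd p)) \<partial>(M \<Otimes>\<^sub>M M)) < \<infinity>"
      by (simp add: less_top)
    have "(\<lambda>n. F n x) \<longlonglongrightarrow> (\<integral>\<^sup>+ p. 0 \<partial>(M \<Otimes>\<^sub>M M))"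
      unfolding F_def
    proof (rule nn_integral_dominated_convergence[where w = "\<lambda>p. ennreal (ekernel x (fst p) (snd p))"])
      show "AE p in M \<Otimes>\<^sub>M M. (\<lambda>n. g n x p) \<longlonglongrightarrow> 0"
      proof (intro AE_I2)
        fix p :: "'a \<times> 'a"
        define \<rho> where "\<rho> = max (dist x (fst p)) (dist x (snd p))"
        show "(\<lambda>n. g n x p) \<longlonglongrightarrow> 0"
        proof (cases "\<rho> = 0")
          case True
          then have "g n x p = 0" for n by (simp add: g_def \<rho>_def[symmetric] ekernel_def)
          then show ?thesis by simp
        next
          case False
          then have "0 < \<rho>" by (auto simp: \<rho>_def less_max_iff_disj)
          then obtain N where N: "inverse (real (Suc N)) < \<rho>" using reals_Archimedean by auto
          have "g n x p = 0" if "N \<le> n" for n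
          proof -
            have "1 / real (Suc n) \<le> 1 / real (Suc N)" using that by (intro divide_left_mono) auto
            then show ?thesis using N by (simp add: g_def \<rho>_def[symmetric] inverse_eq_divide)
          qed
          then show ?thesis by (intro tendsto_eventually) (auto simp: eventually_sequentially)
        qed
      qed
    qed (use fin' km gm[OF x] in \<open>auto simp: g_def\<close>)
    then have "eventually (\<lambda>n. F n x < ennreal e) sequentially"
      using e by (intro order_tendstoD) auto
    then show "\<exists>n. F n x \<le> ennreal e" by (auto simp: eventually_sequentially intro: less_imp_le)
  qed
  define S where "S n = {x \<in> space M. F n x \<le> ennreal e}" for n
  have Sm: "S n \<in> sets M" for n unfolding S_def by measurable
  have "\<exists>n. 0 < measure M (S n)"
  proof (rule ccontr)
    assume "\<not> ?thesis"
    then have "measure M (S n) = 0" for n using measure_nonneg[of M "S n"] by (metis less_le)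
    then have "S n \<in> null_sets M" for n using Sm by (auto simp: null_sets_def emeasure_eq_measure)
    then have "(\<Union>n. S n) \<in> null_sets M" by (rule null_sets_UN)
    moreover have "space M - (\<Union>n. S n) \<in> null_sets M"
      using ae2 Sm by (subst AE_iff_null_sets) (auto simp: S_def)
    ultimately have "(\<Union>n. S n) \<union> (space M - (\<Union>n. S n)) \<in> null_sets M" by (rule null_sets.Un)
    moreover have "(\<Union>n. S n) \<union> (space M - (\<Union>n. S n)) = space M" by (auto simp: S_def)
    ultimately have "measure M (space M) = 0" by (simp add: measure_eq_0_null_sets)
    then show False using pos by simp
  qed
  then obtain n where "0 < measure M (S n)" by blast
  then show thesis
    by (rule that[OF Sm]) (auto simp: S_def F_eq)
qed

end

lemma hausdorff1_pre_le_diam: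
  assumes "\<And>x y. x \<in> B \<Longrightarrow> y \<in> B \<Longrightarrow> dist x y \<le> D" "0 \<le> D" "D \<le> \<delta>"
  shows "hausdorff1_pre \<delta> B \<le> ennreal D"
proof -
  define C where "C n = (if n = (0::nat) then B else {})" for n
  have bd: "bounded B" unfolding bounded_two_points using assms(1) by blast
  have diam: "diameter B \<le> D"
    using assms(1,2) unfolding diameter_def by (auto intro!: cSUP_least)
  have "hausdorff1_pre \<delta> B \<le> (\<Sum>n. ennreal (diameter (C n)))"
    unfolding hausdorff1_pre_def using bd diam assms by (intro INF_lower) (auto simp: C_def)
  also have "\<dots> = (\<Sum>n\<in>{0}. ennreal (diameter (C n)))" by (intro suminf_finite) (auto simp: C_def)
  also have "\<dots> \<le> ennreal D" using diam by (simp add: C_def ennreal_leI)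
  finally show ?thesis .
qed

context hausdorff_space begin

lemma measure_le_diam_zero:
  assumes "B \<in> sets M" "\<And>x y. x \<in> B \<Longrightarrow> y \<in> B \<Longrightarrow> dist x y \<le> 0"
  shows "measure M B = 0"
proof -
  have "hausdorff1_outer B \<le> 0"
    unfolding hausdorff1_outer_def using hausdorff1_pre_le_diam[of B 0] assms(2)
    by (intro SUP_least) auto
  then show ?thesis using outer[OF assms(1)] by (simp add: measure_def)
qed

text \<open>After removing a maximal disjoint family of small sets that carry too much mass, a positive
  amount of mass is left, because the removed sets are cheap to cover.\<close>

lemma regular_piece:
  assumes A0: "A0 \<in> sets M" "0 < measure M A0" and e: "0 < e" "e < 1" and \<delta>0: "0 < \<delta>0"
  obtains V L where "V \<in> sets M" "V \<subseteq> A0" "0 < L" "L \<le> \<delta>0"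
    "\<And>x y. x \<in> V \<Longrightarrow> y \<in> V \<Longrightarrow> dist x y \<le> L" "(1 - e) * L \<le> measure M V"
    "\<And>B D. B \<in> sets M \<Longrightarrow> B \<subseteq> V \<Longrightarrow> 0 \<le> D \<Longrightarrow> D \<le> L \<Longrightarrow> (\<And>x y. x \<in> B \<Longrightarrow> y \<in> B \<Longrightarrow> dist x y \<le> D) \<Longrightarrow>
      measure M B \<le> (1 + e) * D"
proof -
  define m where "m = measure M A0"
  have "ennreal (m / (1 + e)) < ennreal m"
    using A0 e by (intro ennreal_lessI) (auto simp: m_def field_simps)
  also have "\<dots> = hausdorff1_outer A0" using outer[OF A0(1)] by (simp add: m_def emeasure_eq_measure)
  finally obtain \<delta>1 where \<delta>1: "0 < \<delta>1" "ennreal (m / (1 + e)) < hausdorff1_pre \<delta>1 A0"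
    unfolding hausdorff1_outer_def less_SUP_iff by auto
  define \<delta> where "\<delta> = min \<delta>0 \<delta>1"
  have \<delta>: "0 < \<delta>" "\<delta> \<le> \<delta>0" using \<delta>0 \<delta>1 by (auto simp: \<delta>_def)
  have pre: "ennreal (m / (1 + e)) < hausdorff1_pre \<delta> A0"
    by (rule less_le_trans[OF \<delta>1(2) hausdorff1_pre_antimono]) (simp add: \<delta>_def)
  \<comment> \<open>The last clause admits the empty set, from which the exhaustion has to start,
    and asks of other sets a strict excess of mass.\<close>
  define Q where "Q B \<longleftrightarrow> B \<subseteq> A0 \<and> (\<exists>D\<ge>0. D \<le> \<delta> \<and> (\<forall>x\<in>B. \<forall>y\<in>B. dist x y \<le> D) \<and> (1 + e) * D \<le> measure M B
      \<and> (B = {} \<or> (1 + e) * D < measure M B))" for B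
  have "Q {}" unfolding Q_def using \<delta> by auto
  then obtain A :: "nat \<Rightarrow> 'a set" where A: "\<And>i. A i \<in> sets M" "\<And>i. Q (A i)" "disjoint_family A"
    and max: "\<And>B. B \<in> sets M \<Longrightarrow> Q B \<Longrightarrow> B \<inter> (\<Union>i. A i) = {} \<Longrightarrow> measure M B = 0"
    using exhaustion[of Q] by blast
  define U where "U = (\<Union>i. A i)"
  have U: "U \<in> sets M" "U \<subseteq> A0" using A(1,2) unfolding U_def Q_def by blast+
  define P where "P = A0 - U"
  have P: "P \<in> sets M" using U A0 by (auto simp: P_def)
  have preA: "hausdorff1_pre \<delta> (A i) \<le> ennreal (1 / (1 + e)) * emeasure M (A i)" for i
  proof -
    obtain D where D: "0 \<le> D" "D \<le> \<delta>" "\<forall>x\<in>A i. \<forall>y\<in>A i. dist x y \<le> D" "(1 + e) * D \<le> measure M (A i)"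
      using A(2)[of i] unfolding Q_def by blast
    have "hausdorff1_pre \<delta> (A i) \<le> ennreal D" using D by (intro hausdorff1_pre_le_diam) auto
    also have "\<dots> \<le> ennreal (1 / (1 + e) * measure M (A i))"
      using D e by (intro ennreal_leI) (simp add: field_simps)
    also have "\<dots> = ennreal (1 / (1 + e)) * emeasure M (A i)"
      using e by (simp add: emeasure_eq_measure flip: ennreal_mult)
    finally show ?thesis .
  qed
  \<comment> \<open>If nothing were left, the sets \<open>A i\<close> would themselves form a
    covering of cost at most \<open>m / (1 + e)\<close>, contrary to the choice of
    \<open>\<delta>1\<close>.\<close>
  have p: "0 < measure M P"
  proof (rule ccontr)
    assume "\<not> ?thesis"
    then have p0: "measure M P = 0" using measure_nonneg[of M P] by linarith
    have "hausdorff1_pre \<delta> A0 \<le> hausdorff1_pre \<delta> (U \<union> P)"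
      by (intro hausdorff1_pre_mono) (auto simp: P_def)
    also have "\<dots> \<le> hausdorff1_pre \<delta> U + hausdorff1_pre \<delta> P" by (rule hausdorff1_pre_Un[OF \<delta>(1)])
    also have "hausdorff1_pre \<delta> P \<le> hausdorff1_outer P" by (rule hausdorff1_pre_le[OF \<delta>(1)])
    also have "hausdorff1_outer P = 0" using p0 outer[OF P] by (simp add: emeasure_eq_measure)
    also have "hausdorff1_pre \<delta> U \<le> (\<Sum>i. hausdorff1_pre \<delta> (A i))" unfolding U_def by (rule hausdorff1_pre_UN)
    also have "\<dots> \<le> (\<Sum>i. ennreal (1 / (1 + e)) * emeasure M (A i))" by (intro suminf_le preA) auto
    also have "\<dots> = ennreal (1 / (1 + e)) * emeasure M U"
      unfolding ennreal_suminf_cmult U_def using A by (subst suminf_emeasure) auto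
    also have "\<dots> \<le> ennreal (1 / (1 + e)) * emeasure M A0"
      using U A0 by (intro mult_left_mono emeasure_mono) auto
    also have "\<dots> = ennreal (m / (1 + e))"
      using e by (simp add: m_def emeasure_eq_measure flip: ennreal_mult)
    finally show False using pre by (simp add: add_left_mono add_right_mono)
  qed
  have "hausdorff1_pre \<delta> P \<le> hausdorff1_outer P" by (rule hausdorff1_pre_le[OF \<delta>(1)])
  also have "\<dots> = ennreal (measure M P)" using outer[OF P] by (simp add: emeasure_eq_measure)
  also have "\<dots> < ennreal (measure M P / (1 - e))"
    using p e by (intro ennreal_lessI) (auto simp: field_simps)
  finally have "hausdorff1_pre \<delta> P < ennreal (measure M P / (1 - e))" .
  then obtain C :: "nat \<Rightarrow> 'a set" where C: "P \<subseteq> (\<Union>n. C n)" "\<And>n. bounded (C n)" "\<And>n. diameter (C n) \<le> \<delta>"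
    and sumC: "(\<Sum>n. ennreal (diameter (C n))) < ennreal (measure M P / (1 - e))"
    unfolding hausdorff1_pre_def INF_less_iff by blast
  \<comment> \<open>Taking closures makes the pieces measurable without enlarging the
    diameters.\<close>
  define V where "V n = P \<inter> (closure (C n) \<inter> space M)" for n
  have V: "V n \<in> sets M" for n unfolding V_def using P closed_sets[OF closed_closure] by blast
  have Vd: "dist x y \<le> diameter (C n)" if "x \<in> V n" "y \<in> V n" for x y n
  proof -
    have "dist x y \<le> diameter (closure (C n))"
      using that C by (intro diameter_bounded_bound) (auto simp: V_def)
    then show ?thesis using C by (simp add: diameter_closure)
  qed
  \<comment> \<open>The diameters sum to less than \<open>measure M P / (1 - e)\<close>, so the
    pieces cannot all be this light.\<close>
  have "\<exists>n. (1 - e) * diameter (C n) < measure M (V n)"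
  proof (rule ccontr)
    assume "\<not> ?thesis"
    then have le: "measure M (V n) \<le> (1 - e) * diameter (C n)" for n by (simp add: not_less)
    have "emeasure M P \<le> emeasure M (\<Union>n. V n)"
    proof (rule emeasure_mono)
      show "P \<subseteq> (\<Union>n. V n)"
      proof
        fix x assume x: "x \<in> P"
        then obtain n where "x \<in> C n" using C(1) by auto
        then have "x \<in> V n"
          using x sets.sets_into_space[OF P] subsetD[OF closure_subset] by (auto simp: V_def)
        then show "x \<in> (\<Union>n. V n)" by (rule UN_I[OF UNIV_I])
      qed
    qed (use V in auto)
    also have "\<dots> \<le> (\<Sum>n. emeasure M (V n))" using V by (intro emeasure_subadditive_countably) auto
    also have "\<dots> \<le> (\<Sum>n. ennreal (1 - e) * ennreal (diameter (C n)))"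
      using le e C(2) by (intro suminf_le) (auto simp: emeasure_eq_measure diameter_ge_0 ennreal_leI simp flip: ennreal_mult)
    also have "\<dots> = ennreal (1 - e) * (\<Sum>n. ennreal (diameter (C n)))" by simp
    also have "\<dots> < ennreal (1 - e) * ennreal (measure M P / (1 - e))"
      using sumC e by (intro ennreal_mult_strict_left_mono) auto
    also have "\<dots> = emeasure M P" using e by (simp add: emeasure_eq_measure flip: ennreal_mult)
    finally show False by simp
  qed
  then obtain n where n: "(1 - e) * diameter (C n) < measure M (V n)" by blast
  define L where "L = diameter (C n)"
  have L: "0 < L"
  proof (rule ccontr)
    assume "\<not> ?thesis"
    then have "L = 0" using diameter_ge_0[OF C(2)[of n]] by (simp add: L_def)
    then show False using n measure_le_diam_zero[OF V[of n]] Vd[of _ n] by (simp add: L_def)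
  qed
  show thesis
  proof (rule that[of "V n" L])
    fix B D assume B: "B \<in> sets M" "B \<subseteq> V n" "0 \<le> D" "D \<le> L" "\<And>x y. x \<in> B \<Longrightarrow> y \<in> B \<Longrightarrow> dist x y \<le> D"
    show "measure M B \<le> (1 + e) * D"
    proof (rule ccontr)
      assume "\<not> ?thesis"
      then have lt: "(1 + e) * D < measure M B" by simp
      then have "Q B" unfolding Q_def using B C(3)[of n] by (auto simp: V_def P_def L_def intro!: exI[of _ D])
      then have "measure M B = 0" using B by (intro max) (auto simp: V_def P_def U_def)
      moreover have "0 \<le> (1 + e) * D" using B e by simp
      ultimately show False using lt by simp
    qed
  qed (use V n L C(3)[of n] \<delta> Vd[of _ n] in \<open>auto simp: L_def V_def P_def\<close>)
qed

lemma lineable_piece: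
  assumes fin: "(\<integral>\<^sup>+ x. \<integral>\<^sup>+ y. \<integral>\<^sup>+ z. ennreal (ekernel x y z) \<partial>M \<partial>M \<partial>M) < top"
    and pos: "0 < measure M (space M)"
  obtains B where "B \<in> sets M" "0 < measure M B" "lineable B"
proof -
  define e :: real where "e = 1 / 2 ^ 2000"
  have e: "0 < e" "e \<le> 1 / 2 ^ 2000" by (simp_all add: e_def)
  have "(1::real) / 2 ^ 2000 < 1" by simp
  then have e1: "e < 1" unfolding e_def .
  obtain A0 n where A0: "A0 \<in> sets M" "0 < measure M A0"
    and curv: "\<And>x. x \<in> A0 \<Longrightarrow> (\<integral>\<^sup>+ y. \<integral>\<^sup>+ z. (if max (dist x y) (dist x z) < 1 / real (Suc n)
      then ennreal (ekernel x y z) else 0) \<partial>M \<partial>M) \<le> ennreal e"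
    using small_scale_curvature[OF fin pos e(1)] by blast
  \<comment> \<open>Half the cut-off radius: in a set of diameter at most \<open>\<delta>0\<close>
    all triples pass the strict inequality in \<open>curv\<close>.\<close>
  define \<delta>0 where "\<delta>0 = 1 / real (Suc n) / 2"
  have \<delta>0: "0 < \<delta>0" "\<delta>0 < 1 / real (Suc n)" by (simp_all add: \<delta>0_def field_simps)
  obtain V L where V: "V \<in> sets M" "V \<subseteq> A0" and L: "0 < L" "L \<le> \<delta>0"
    and diam: "\<And>x y. x \<in> V \<Longrightarrow> y \<in> V \<Longrightarrow> dist x y \<le> L" and full: "(1 - e) * L \<le> measure M V"
    and reg: "\<And>B D. B \<in> sets M \<Longrightarrow> B \<subseteq> V \<Longrightarrow> 0 \<le> D \<Longrightarrow> D \<le> L \<Longrightarrow> (\<And>x y. x \<in> B \<Longrightarrow> y \<in> B \<Longrightarrow> dist x y \<le> D) \<Longrightarrow>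
      measure M B \<le> (1 + e) * D"
    using regular_piece[OF A0 e(1) e1 \<delta>0(1)] by metis
  have Vs: "V \<subseteq> space M" using sets.sets_into_space[OF V(1)] .
  define N where "N = restrict_space M V"
  have spN: "space N = V" using Vs by (auto simp: N_def space_restrict_space)
  have setsN: "A \<in> sets N \<longleftrightarrow> A \<in> sets M \<and> A \<subseteq> V" for A
    unfolding N_def using V by (subst sets_restrict_space_iff) (auto simp: Vs Int_absorb2)
  have measN: "measure N A = measure M A" if "A \<subseteq> V" for A
    unfolding N_def using that V Vs by (intro measure_restrict_space) (auto simp: Int_absorb2)
  have intN: "(\<integral>\<^sup>+ x. f x \<partial>N) = (\<integral>\<^sup>+ x. f x * indicator V x \<partial>M)" for f
    unfolding N_def using V Vs by (subst nn_integral_restrict_space) (auto simp: Int_absorb2)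
  have NM [measurable]: "(\<lambda>x. x) \<in> N \<rightarrow>\<^sub>M M" unfolding N_def by (rule measurable_restrict_space1) simp
  have mm: "measured_metric N"
  proof (intro measured_metric.intro finite_measureI measured_metric_axioms.intro)
    show "emeasure N (space N) \<noteq> \<infinity>"
      using V Vs by (simp add: N_def space_restrict_space emeasure_restrict_space Int_absorb2)
    show "(\<lambda>(x, y). dist x y) \<in> borel_measurable (N \<Otimes>\<^sub>M N)" by measurable
  qed
  have "curved_space N L e"
  proof (intro curved_space.intro mm curved_space_axioms.intro L e)
    show "dist x y \<le> L" if "x \<in> space N" "y \<in> space N" for x y using that spN diam by auto
    show "(1 - e) * L \<le> measure N (space N)" using full by (simp add: spN measN)
    show "measure N A \<le> (1 + e) * D" if A: "A \<in> sets N" "0 \<le> D" "\<And>x y. x \<in> A \<Longrightarrow> y \<in> A \<Longrightarrow> dist x y \<le> D" for A D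
    proof -
      \<comment> \<open>\<open>reg\<close> is restricted to \<open>D \<le> L\<close>, but
        \<open>L\<close> bounds all distances anyway.\<close>
      have "measure M A \<le> (1 + e) * min D L"
        using A diam L by (intro reg) (auto simp: setsN subset_eq)
      also have "\<dots> \<le> (1 + e) * D" using e by (intro mult_left_mono) auto
      finally show ?thesis using A by (simp add: setsN measN)
    qed
    fix x assume x: "x \<in> space N"
    have "(\<integral>\<^sup>+ y. \<integral>\<^sup>+ z. ennreal (ekernel x y z) \<partial>N \<partial>N) =
      (\<integral>\<^sup>+ y. (\<integral>\<^sup>+ z. ennreal (ekernel x y z) * indicator V z \<partial>M) * indicator V y \<partial>M)"
      by (simp only: intN)
    also have "\<dots> \<le> (\<integral>\<^sup>+ y. \<integral>\<^sup>+ z. (if max (dist x y) (dist x z) < 1 / real (Suc n)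
      then ennreal (ekernel x y z) else 0) \<partial>M \<partial>M)"
    proof (rule nn_integral_mono)
      fix y assume "y \<in> space M"
      show "(\<integral>\<^sup>+ z. ennreal (ekernel x y z) * indicator V z \<partial>M) * indicator V y \<le>
        (\<integral>\<^sup>+ z. (if max (dist x y) (dist x z) < 1 / real (Suc n) then ennreal (ekernel x y z) else 0) \<partial>M)"
      proof (cases "y \<in> V")
        case True
        have "ennreal (ekernel x y z) * indicator V z \<le>
          (if max (dist x y) (dist x z) < 1 / real (Suc n) then ennreal (ekernel x y z) else 0)" for z
        proof (cases "z \<in> V")
          case z: True
          have "dist x y \<le> L" "dist x z \<le> L" using x True z diam by (auto simp: spN)
          then have "max (dist x y) (dist x z) < 1 / real (Suc n)" using L \<delta>0 by linarith
          then show ?thesis using z by simp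
        qed simp
        then show ?thesis using True by (auto intro!: nn_integral_mono)
      qed simp
    qed
    also have "\<dots> \<le> ennreal e" using x V by (intro curv) (auto simp: spN)
    finally show "(\<integral>\<^sup>+ y. \<integral>\<^sup>+ z. ennreal (ekernel x y z) \<partial>N \<partial>N) \<le> ennreal e" .
  qed
  then interpret N: curved_space N L e .
  obtain B h where B: "B \<in> sets N" "0 < measure N B" "\<And>x. x \<in> B \<Longrightarrow> 0 \<le> h x \<and> h x \<le> L"
    "\<And>x y. x \<in> B \<Longrightarrow> y \<in> B \<Longrightarrow> dist x y \<le> 2 * \<bar>h x - h y\<bar>"
    using N.large_flat_piece by blast
  show thesis
  proof (rule that[of B])
    show "lineable B" unfolding lineable_def using B(3,4) by blast
  qed (use B(1,2) measN in \<open>auto simp: setsN\<close>)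
qed

end

lemma nn_integral_restrict_space_le:
  assumes "V \<in> sets M"
  shows "(\<integral>\<^sup>+ x. f x \<partial>restrict_space M V) \<le> (\<integral>\<^sup>+ x. f x \<partial>M)"
proof -
  have "V \<inter> space M \<in> sets M" using assms by blast
  then show ?thesis
    by (subst nn_integral_restrict_space) (auto simp: indicator_def intro!: nn_integral_mono)
qed

lemma nn_integral_3_restrict_space_le:
  assumes "V \<in> sets M"
  shows "(\<integral>\<^sup>+ x. \<integral>\<^sup>+ y. \<integral>\<^sup>+ z. f x y z \<partial>restrict_space M V \<partial>restrict_space M V \<partial>restrict_space M V)
    \<le> (\<integral>\<^sup>+ x. \<integral>\<^sup>+ y. \<integral>\<^sup>+ z. f x y z \<partial>M \<partial>M \<partial>M)"
  by (rule order_trans[OF nn_integral_restrict_space_le[OF assms]]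
      nn_integral_mono order_trans[OF nn_integral_restrict_space_le[OF assms]])+
    simp

lemma hausdorff_space_restrict:
  assumes V: "V \<in> sets M" "emeasure M V < top"
    and outer: "\<And>A. A \<in> sets M \<Longrightarrow> emeasure M A = hausdorff1_outer A"
    and closed_sets: "\<And>C. closed C \<Longrightarrow> C \<inter> space M \<in> sets M"
  shows "hausdorff_space (restrict_space M V)"
proof -
  have Vs: "V \<subseteq> space M" using sets.sets_into_space[OF V(1)] .
  have setsN: "A \<in> sets (restrict_space M V) \<longleftrightarrow> A \<in> sets M \<and> A \<subseteq> V" for A
    using V by (subst sets_restrict_space_iff) (auto simp: Vs Int_absorb2)
  have meas: "emeasure (restrict_space M V) A = emeasure M A" if "A \<subseteq> V" for A
    using that V Vs by (intro emeasure_restrict_space) (auto simp: Int_absorb2)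
  have sp: "space (restrict_space M V) = V" using Vs by (auto simp: space_restrict_space)
  show ?thesis
  proof (intro hausdorff_space.intro finite_measureI hausdorff_space_axioms.intro)
    show "emeasure (restrict_space M V) (space (restrict_space M V)) \<noteq> \<infinity>"
      using V by (simp add: sp meas)
    show "emeasure (restrict_space M V) A = hausdorff1_outer A" if "A \<in> sets (restrict_space M V)" for A
      using that by (simp add: setsN meas outer)
    show "C \<inter> space (restrict_space M V) \<in> sets (restrict_space M V)" if "closed C" for C
    proof -
      have "C \<inter> V = (C \<inter> space M) \<inter> V" using Vs by blast
      then show ?thesis using closed_sets[OF that] V unfolding sp setsN by auto
    qed
  qed
qed

text \<open>A remainder of positive measure would itself satisfy the hypotheses of
  \<open>lineable_piece\<close> and contain a lineable set missed by the exhaustion.\<close>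

lemma (in hausdorff_space) lineable_exhaustion:
  assumes fin: "(\<integral>\<^sup>+ x. \<integral>\<^sup>+ y. \<integral>\<^sup>+ z. ennreal (ekernel x y z) \<partial>M \<partial>M \<partial>M) < top"
  obtains B :: "nat \<Rightarrow> 'a set" where "\<And>i. B i \<in> sets M" "\<And>i. lineable (B i)" "hausdorff1_outer (space M - (\<Union>i. B i)) = 0"
proof -
  obtain B :: "nat \<Rightarrow> 'a set" where B: "\<And>i. B i \<in> sets M" "\<And>i. lineable (B i)"
    and max: "\<And>A. A \<in> sets M \<Longrightarrow> lineable A \<Longrightarrow> A \<inter> (\<Union>i. B i) = {} \<Longrightarrow> measure M A = 0"
    by (rule exhaustion[of lineable, OF lineable_empty]) blast
  define R where "R = space M - (\<Union>i. B i)"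
  have R: "R \<in> sets M" using B by (auto simp: R_def)
  have "measure M R = 0"
  proof (rule ccontr)
    assume "measure M R \<noteq> 0"
    then have pos: "0 < measure M R" using measure_nonneg[of M R] by linarith
    define N where "N = restrict_space M R"
    have Rs: "R \<subseteq> space M" by (auto simp: R_def)
    have setsN: "A \<in> sets N \<longleftrightarrow> A \<in> sets M \<and> A \<subseteq> R" for A
      unfolding N_def using R by (subst sets_restrict_space_iff) (auto simp: Rs Int_absorb2)
    have meas: "measure N A = measure M A" if "A \<subseteq> R" for A
      unfolding N_def using that R Rs by (intro measure_restrict_space) (auto simp: Int_absorb2)
    have sp: "space N = R" using Rs by (auto simp: N_def space_restrict_space)
    interpret N: hausdorff_space N
      unfolding N_def by (intro hausdorff_space_restrict R outer closed_sets) (simp_all add: emeasure_eq_measure)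
    have "(\<integral>\<^sup>+ x. \<integral>\<^sup>+ y. \<integral>\<^sup>+ z. ennreal (ekernel x y z) \<partial>N \<partial>N \<partial>N) < top"
      unfolding N_def by (rule le_less_trans[OF nn_integral_3_restrict_space_le[OF R] fin])
    then obtain A where "A \<in> sets N" "0 < measure N A" "lineable A"
      using pos by (elim N.lineable_piece) (auto simp: sp meas)
    moreover from this have "A \<in> sets M" "A \<subseteq> R" "measure N A = measure M A" by (auto simp: setsN meas)
    moreover from this have "A \<inter> (\<Union>i. B i) = {}" unfolding R_def by blast
    ultimately show False using max[of A] by simp
  qed
  then have "hausdorff1_outer R = 0" using outer[OF R] by (simp add: emeasure_eq_measure)
  then show thesis unfolding R_def by (rule that[OF B])
qed

section \<open>Stringing the pieces along the real line\<close>

lemma lineable_subset: "lineable B \<Longrightarrow> A \<subseteq> B \<Longrightarrow> lineable A"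
  unfolding lineable_def subset_eq by simp metis

text \<open>Each set \<open>A n\<close> is placed in its own interval; the intervals are far enough apart that
  the resulting map into the real line does not decrease distances.\<close>

lemma rectifiable_of_lineable:
  fixes X :: "'a::metric_space set" and A :: "nat \<Rightarrow> 'a set"
  assumes lin: "\<And>n. lineable (A n)" and sub: "\<And>n. A n \<subseteq> X" and null: "hausdorff1_outer (X - (\<Union>n. A n)) = 0"
  shows "rectifiable X"
proof -
  define D where "D = disjointed A"
  have D: "(\<Union>n. D n) = (\<Union>n. A n)" "disjoint_family D" unfolding D_def
    by (simp_all add: UN_disjointed_eq disjoint_family_disjointed)
  have "lineable (D n)" for n unfolding D_def by (rule lineable_subset[OF lin disjointed_subset])
  then have "\<forall>n. \<exists>g. (\<forall>x\<in>D n. 0 \<le> fst g x \<and> fst g x \<le> snd g) \<and>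
      (\<forall>x\<in>D n. \<forall>y\<in>D n. dist x y \<le> 2 * \<bar>fst g x - fst g y\<bar>)"
    unfolding lineable_def by (metis fst_conv snd_conv)
  from choice[OF this] obtain g where g:
    "\<And>n. (\<forall>x\<in>D n. 0 \<le> fst (g n) x \<and> fst (g n) x \<le> (snd (g n) :: real)) \<and>
      (\<forall>x\<in>D n. \<forall>y\<in>D n. dist x y \<le> 2 * \<bar>fst (g n) x - fst (g n) y\<bar>)" by blast
  define h where "h n = fst (g n)" for n
  define C where "C n = max 0 (snd (g n))" for n
  have h: "0 \<le> h n x" "h n x \<le> C n" if "x \<in> D n" for n x
    using g[of n] that by (auto simp: h_def C_def)
  have dist_h: "dist x y \<le> 2 * \<bar>h n x - h n y\<bar>" if "x \<in> D n" "y \<in> D n" for n x y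
    using g[of n] that unfolding h_def by blast
  have C0: "0 \<le> C n" for n by (simp add: C_def)
  fix z :: 'a
  have "\<exists>R\<ge>0. \<forall>x\<in>D n. dist z x \<le> R" for n
  proof (cases "D n = {}")
    case False
    then obtain p where p: "p \<in> D n" by blast
    have "dist z x \<le> dist z p + 2 * C n" if x: "x \<in> D n" for x
    proof -
      have "\<bar>h n p - h n x\<bar> \<le> C n" using h[OF p] h[OF x] by linarith
      then have "dist p x \<le> 2 * C n" using dist_h[OF p x] by simp
      then show ?thesis using dist_triangle[of z x p] by simp
    qed
    then show ?thesis using C0[of n] by (intro exI[of _ "dist z p + 2 * C n"]) simp
  qed auto
  then have "\<exists>R. \<forall>n. 0 \<le> R n \<and> (\<forall>x\<in>D n. dist z x \<le> R n)" by (intro choice) blast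
  then obtain R :: "nat \<Rightarrow> real" where R: "\<And>n. 0 \<le> R n" "\<And>n x. x \<in> D n \<Longrightarrow> dist z x \<le> R n" by blast
  \<comment> \<open>Piece \<open>n\<close> occupies an interval of length \<open>2 * C n\<close>
    starting at \<open>a n\<close>. Between the intervals of pieces \<open>n\<close> and
    \<open>m\<close> there remains at least \<open>R n + R m\<close>, which bounds the distance of
    their points through \<open>z\<close>.\<close>
  define a where "a m = (\<Sum>j<m. 2 * C j + 2 * R j) + R m" for m
  have gap: "2 * C n + R n + R m \<le> a m - a n" if "n < m" for n m
  proof -
    have "(\<Sum>j<Suc n. 2 * C j + 2 * R j) \<le> (\<Sum>j<m. 2 * C j + 2 * R j)"
      using that C0 R(1) by (intro sum_mono2) auto
    then show ?thesis by (simp add: a_def)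
  qed
  define Y where "Y = (\<Union>n. D n)"
  define k where "k x = (SOME n. x \<in> D n)" for x
  have k: "x \<in> D (k x)" if "x \<in> Y" for x 
  proof -
    have "\<exists>n. x \<in> D n" using that by (simp add: Y_def)
    then show ?thesis unfolding k_def by (rule someI_ex)
  qed
  define H where "H x = a (k x) + 2 * h (k x) x" for x
  have far: "dist x y \<le> H y - H x" if x: "x \<in> Y" and y: "y \<in> Y" and lt: "k x < k y" for x y
    using gap[OF lt] h[OF k[OF x]] h[OF k[OF y]] R(2)[OF k[OF x]] R(2)[OF k[OF y]] dist_triangle3[of x y z]
    unfolding H_def by linarith
  have exp: "dist x y \<le> \<bar>H x - H y\<bar>" if x: "x \<in> Y" and y: "y \<in> Y" for x y
  proof -
    consider "k x < k y" | "k y < k x" | "k x = k y" by linarith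
    then show ?thesis
    proof cases
      case 3
      then have "dist x y \<le> 2 * \<bar>h (k y) x - h (k y) y\<bar>" using dist_h[of x "k y" y] k[OF x] k[OF y] by simp
      moreover have "H x - H y = 2 * (h (k y) x - h (k y) y)" unfolding H_def 3 by simp
      ultimately show ?thesis by (simp only: abs_mult abs_numeral)
    next
      case 1
      then show ?thesis using far[OF x y] by linarith
    next
      case 2
      then show ?thesis using far[OF y x] by (simp add: dist_commute)
    qed
  qed
  have inj: "inj_on H Y"
  proof (rule inj_onI)
    fix x y assume "x \<in> Y" "y \<in> Y" "H x = H y"
    then show "x = y" using exp[of x y] by simp
  qed
  define f where "f = inv_into Y H"
  have f: "f (H x) = x" if "x \<in> Y" for x unfolding f_def using inj that by (rule inv_into_f_f)
  have img: "f ` (H ` Y) = Y" using f by force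
  have "1-lipschitz_on (H ` Y) f"
    by (rule lipschitz_onI) (auto simp: f exp dist_real_def)
  moreover have "Y = (\<Union>n. A n)" by (simp add: Y_def D)
  moreover have "(\<Union>n. A n) \<subseteq> X" using sub by blast
  ultimately show ?thesis unfolding rectifiable_def
    using img null by (intro exI[of _ "H ` Y"] exI[of _ f] exI[of _ 1]) simp
qed

subsection \<open>Menger curvature and excess\<close>

text \<open>The right-hand side is the squared curvature of a triangle with sides \<open>a\<close>,
  \<open>b\<close>, \<open>c\<close>. Apart from the common factor \<open>b + c - a\<close>, the
  factors \<open>a\<close>, \<open>c\<close>, \<open>a\<close>, \<open>c\<close> are bounded one by
  one by \<open>a + b + c\<close>, \<open>a + c - b\<close>, \<open>a + b - c\<close> and
  \<open>b\<close>.\<close>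

lemma excess_sorted_bound:
  fixes a b c :: real
  assumes "0 < c" "c \<le> b" "b \<le> a" "a \<le> b + c"
  shows "(b + c - a) / b ^ 3 \<le> (a + b + c) * (b + c - a) * (a + c - b) * (a + b - c) / (a\<^sup>2 * b\<^sup>2 * c\<^sup>2)"
proof -
  have "(b + c - a) * (a\<^sup>2 * c\<^sup>2) \<le> (b + c - a) * ((a + b + c) * (a + c - b) * (a + b - c) * b)"
  proof (rule mult_left_mono)
    have "a * c * a * c \<le> (a + b + c) * (a + c - b) * (a + b - c) * b"
      using assms by (intro mult_mono mult_nonneg_nonneg) auto
    then show "a\<^sup>2 * c\<^sup>2 \<le> (a + b + c) * (a + c - b) * (a + b - c) * b"
      by (simp add: power2_eq_square ac_simps)
  qed (use assms in simp)
  then have "(b + c - a) * (a\<^sup>2 * c\<^sup>2) * b\<^sup>2 \<le> (b + c - a) * ((a + b + c) * (a + c - b) * (a + b - c) * b) * b\<^sup>2"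
    by (rule mult_right_mono) simp
  then show ?thesis using assms
    by (simp add: divide_le_eq le_divide_eq power2_eq_square power3_eq_cube ac_simps)
qed

text \<open>The cosine rule with the squared sine written as \<open>(1 - C) * (1 + C)\<close>. By
  Heron's formula the numerator is sixteen times the squared area of the comparison
  triangle.\<close>

lemma menger_curvature_squared:
  assumes "z1 \<noteq> z2" "z2 \<noteq> z3" "z1 \<noteq> z3"
  defines "a \<equiv> dist z1 z2" and "b \<equiv> dist z2 z3" and "c \<equiv> dist z1 z3"
  shows "(menger_curvature z1 z2 z3)\<^sup>2 = (a + b + c) * (a + b - c) * (a + c - b) * (b + c - a) / (a\<^sup>2 * b\<^sup>2 * c\<^sup>2)"
proof -
  have pos: "0 < a" "0 < b" "0 < c" using assms by auto
  have tri: "c \<le> a + b" "a \<le> b + c" "b \<le> a + c"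
    unfolding a_def b_def c_def by (metis dist_triangle dist_commute add.commute)+
  define C where "C = (a\<^sup>2 + b\<^sup>2 - c\<^sup>2) / (2 * a * b)"
  have 1: "1 - C = (c + a - b) * (c + b - a) / (2 * a * b)"
    using pos by (simp add: C_def field_simps power2_eq_square)
  have 2: "1 + C = (a + b + c) * (a + b - c) / (2 * a * b)"
    using pos by (simp add: C_def field_simps power2_eq_square)
  have "0 \<le> 1 - C" unfolding 1 using pos tri by (intro divide_nonneg_pos mult_nonneg_nonneg) auto
  moreover have "0 \<le> 1 + C" unfolding 2 using pos tri by (intro divide_nonneg_pos mult_nonneg_nonneg) auto
  ultimately have C: "-1 \<le> C" "C \<le> 1" by auto
  have "(menger_curvature z1 z2 z3)\<^sup>2 = 4 * (sin (arccos C))\<^sup>2 / c\<^sup>2"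
    by (simp add: menger_curvature_def menger_angle_def C_def a_def b_def c_def power_divide power_mult_distrib)
  also have "(sin (arccos C))\<^sup>2 = (1 - C) * (1 + C)"
    unfolding sin_squared_eq cos_arccos[OF C] by (simp add: power2_eq_square algebra_simps)
  also have "4 * ((1 - C) * (1 + C)) / c\<^sup>2 = (a + b + c) * (a + b - c) * (a + c - b) * (b + c - a) / (a\<^sup>2 * b\<^sup>2 * c\<^sup>2)"
    unfolding 1 2 using pos by (simp add: field_simps power2_eq_square)
  finally show ?thesis .
qed

text \<open>The longer of the two sides at \<open>z3\<close> is at least the middle side of the
  triangle, so the bound for sorted sides applies. The arguments appear in the order of integration
  in \<open>menger_c2\<close>, outermost first.\<close>

lemma ekernel_le_menger_curvature:
  assumes "z1 \<noteq> z2" "z2 \<noteq> z3" "z1 \<noteq> z3"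
  shows "ekernel z3 z2 z1 \<le> (menger_curvature z1 z2 z3)\<^sup>2"
proof -
  define a b c where abc: "a = dist z1 z2" "b = dist z2 z3" "c = dist z1 z3"
  have pos: "0 < a" "0 < b" "0 < c" using assms by (auto simp: abc)
  have tri: "c \<le> a + b" "a \<le> b + c" "b \<le> a + c"
    unfolding abc by (metis dist_triangle dist_commute add.commute)+
  have e: "ekernel z3 z2 z1 = (a + b + c - 2 * max a (max b c)) / max b c ^ 3"
    by (simp add: ekernel_def excess_def abc dist_commute max.commute max.left_commute)
  define m where "m = (a + b + c) * (a + b - c) * (a + c - b) * (b + c - a) / (a\<^sup>2 * b\<^sup>2 * c\<^sup>2)"
  have m: "(menger_curvature z1 z2 z3)\<^sup>2 = m"
    unfolding m_def abc by (rule menger_curvature_squared[OF assms])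
  have key: "ekernel z3 z2 z1 \<le> m"
    if s: "0 < w" "w \<le> v" "v \<le> u" "u \<le> v + w" "max a (max b c) = u" "a + b + c = u + v + w" "v \<le> max b c"
      "(u + v + w) * (v + w - u) * (u + w - v) * (u + v - w) / (u\<^sup>2 * v\<^sup>2 * w\<^sup>2) = m" for u v w
  proof -
    have "ekernel z3 z2 z1 = (v + w - u) / max b c ^ 3" unfolding e s(5,6) by simp
    also have "\<dots> \<le> (v + w - u) / v ^ 3"
      using s by (intro divide_left_mono power_mono mult_pos_pos zero_less_power) auto
    also have "\<dots> \<le> m" unfolding s(8)[symmetric] using s by (intro excess_sorted_bound) auto
    finally show ?thesis .
  qed
  consider "a \<le> b" "b \<le> c" | "a \<le> c" "c \<le> b" | "b \<le> a" "a \<le> c" | "b \<le> c" "c \<le> a" | "c \<le> a" "a \<le> b" | "c \<le> b" "b \<le> a"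
    by linarith
  then have "ekernel z3 z2 z1 \<le> m"
  proof cases
    case 1 then show ?thesis using pos tri by (intro key[of a b c]) (auto simp: m_def ac_simps)
  next
    case 2 then show ?thesis using pos tri by (intro key[of a c b]) (auto simp: m_def ac_simps)
  next
    case 3 then show ?thesis using pos tri by (intro key[of b a c]) (auto simp: m_def ac_simps)
  next
    case 4 then show ?thesis using pos tri by (intro key[of b c a]) (auto simp: m_def ac_simps)
  next
    case 5 then show ?thesis using pos tri by (intro key[of c a b]) (auto simp: m_def ac_simps)
  next
    case 6 then show ?thesis using pos tri by (intro key[of c b a]) (auto simp: m_def ac_simps)
  qed
  then show ?thesis by (simp add: m)
qed

lemma ekernel_degenerate: "z1 = z2 \<or> z2 = z3 \<or> z1 = z3 \<Longrightarrow> ekernel z3 z2 z1 = 0"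
  by (auto simp: ekernel_def excess_def dist_commute)

lemma ekernel_integral_le_menger_c2:
  "(\<integral>\<^sup>+ x. \<integral>\<^sup>+ y. \<integral>\<^sup>+ z. ennreal (ekernel x y z) \<partial>hausdorff1 X \<partial>hausdorff1 X \<partial>hausdorff1 X) \<le> menger_c2 X"
  unfolding menger_c2_def
proof (intro nn_integral_mono)
  fix x y z assume "x \<in> space (hausdorff1 X)" "y \<in> space (hausdorff1 X)" "z \<in> space (hausdorff1 X)"
  then have X: "x \<in> X" "y \<in> X" "z \<in> X" by (simp_all add: space_hausdorff1)
  show "ennreal (ekernel x y z) \<le> ennreal ((menger_curvature z y x)\<^sup>2) * indicator (menger_triples \<infinity> X) (z, y, x)"
  proof (cases "z \<noteq> y \<and> y \<noteq> x \<and> z \<noteq> x")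
    case True
    then have "(z, y, x) \<in> menger_triples \<infinity> X" using X by (subst menger_triples_top) auto
    then show ?thesis using True by (simp add: ennreal_leI ekernel_le_menger_curvature)
  next
    case False
    then have "ekernel x y z = 0" by (intro ekernel_degenerate) auto
    then show ?thesis by simp
  qed
qed

subsection \<open>Sigma-finiteness\<close>

text \<open>Without \<open>\<sigma>\<close>-finiteness Fubini's theorem is not available; the measurability of the inner integrals comes
  from lower semicontinuity, by Fatou's lemma.\<close>

lemma lsc_measurable_hausdorff1:
  fixes f :: "'a::metric_space \<Rightarrow> ennreal"
  assumes lsc: "\<And>s l. (\<And>n. s n \<in> X) \<Longrightarrow> l \<in> X \<Longrightarrow> s \<longlonglongrightarrow> l \<Longrightarrow> f l \<le> liminf (\<lambda>n. f (s n))"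
  shows "f \<in> borel_measurable (hausdorff1 X)"
proof (rule borel_measurableI_le)
  fix a
  define S where "S = {x \<in> X. f x \<le> a}"
  have "l \<in> S" if "l \<in> closure S" "l \<in> X" for l
  proof -
    obtain s where s: "\<And>n. s n \<in> S" "s \<longlonglongrightarrow> l" using \<open>l \<in> closure S\<close> unfolding closure_sequential by blast
    have "f l \<le> liminf (\<lambda>n. f (s n))" using s that by (intro lsc) (auto simp: S_def)
    also have "\<dots> \<le> liminf (\<lambda>n::nat. a)" using s(1) by (intro Liminf_mono) (auto simp: S_def)
    also have "\<dots> = a" by (simp add: Liminf_const)
    finally show ?thesis using that by (simp add: S_def)
  qed
  moreover have "S \<subseteq> closure S" "S \<subseteq> X" using closure_subset[of S] by (auto simp: S_def)
  ultimately have "closure S \<inter> X = S" by blast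
  then have "S \<in> sets (hausdorff1 X)" using closed_sets_hausdorff1[OF closed_closure, of S X] by simp
  then show "{x \<in> space (hausdorff1 X). f x \<le> a} \<in> sets (hausdorff1 X)" by (simp add: S_def space_hausdorff1)
qed

text \<open>Continuity can fail only where all three points coincide, and there division by zero
  gives the kernel its least value 0.\<close>

lemma ekernel_lsc:
  assumes "s \<longlonglongrightarrow> x" "t \<longlonglongrightarrow> y"
  shows "ennreal (ekernel x y z) \<le> liminf (\<lambda>n. ennreal (ekernel (s n) (t n) z))"
proof (cases "max (dist x y) (dist x z) = 0")
  case True
  then have "ekernel x y z = 0" by (simp add: ekernel_def)
  then show ?thesis by simp
next
  case False
  then have "(\<lambda>n. ekernel (s n) (t n) z) \<longlonglongrightarrow> ekernel x y z"
    unfolding ekernel_def excess_def using assms by (intro tendsto_intros) auto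
  then have "(\<lambda>n. ennreal (ekernel (s n) (t n) z)) \<longlonglongrightarrow> ennreal (ekernel x y z)" by (rule tendsto_ennrealI)
  then have "liminf (\<lambda>n. ennreal (ekernel (s n) (t n) z)) = ennreal (ekernel x y z)"
    by (intro lim_imp_Liminf) auto
  then show ?thesis by simp
qed

lemma measurable_ekernel_hausdorff1: "(\<lambda>z. ennreal (ekernel x y z)) \<in> borel_measurable (hausdorff1 X)"
proof -
  have [measurable]: "dist w \<in> borel_measurable (hausdorff1 X)" for w :: 'a by (rule dist_measurable_hausdorff1)
  show ?thesis unfolding ekernel_def excess_def by measurable
qed

definition ekernel_int1 :: "'a::metric_space set \<Rightarrow> 'a \<Rightarrow> 'a \<Rightarrow> ennreal" where
  "ekernel_int1 X x y = (\<integral>\<^sup>+ z. ennreal (ekernel x y z) \<partial>hausdorff1 X)"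

definition ekernel_int2 :: "'a::metric_space set \<Rightarrow> 'a \<Rightarrow> ennreal" where
  "ekernel_int2 X x = (\<integral>\<^sup>+ y. ekernel_int1 X x y \<partial>hausdorff1 X)"

lemma ekernel_int1_lsc:
  assumes "s \<longlonglongrightarrow> x" "t \<longlonglongrightarrow> y"
  shows "ekernel_int1 X x y \<le> liminf (\<lambda>n. ekernel_int1 X (s n) (t n))"
proof -
  have "ekernel_int1 X x y \<le> (\<integral>\<^sup>+ z. liminf (\<lambda>n. ennreal (ekernel (s n) (t n) z)) \<partial>hausdorff1 X)"
    unfolding ekernel_int1_def by (intro nn_integral_mono ekernel_lsc assms)
  also have "\<dots> \<le> liminf (\<lambda>n. ekernel_int1 X (s n) (t n))"
    unfolding ekernel_int1_def by (intro nn_integral_liminf measurable_ekernel_hausdorff1)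
  finally show ?thesis .
qed

lemma measurable_ekernel_int1: "ekernel_int1 X x \<in> borel_measurable (hausdorff1 X)"
  by (intro lsc_measurable_hausdorff1 ekernel_int1_lsc tendsto_const)

lemma measurable_ekernel_int2:
  fixes X :: "'a::metric_space set"
  shows "ekernel_int2 X \<in> borel_measurable (hausdorff1 X)"
proof (rule lsc_measurable_hausdorff1)
  fix s and x :: 'a assume "s \<longlonglongrightarrow> x"
  then have "ekernel_int2 X x \<le> (\<integral>\<^sup>+ y. liminf (\<lambda>n. ekernel_int1 X (s n) y) \<partial>hausdorff1 X)"
    unfolding ekernel_int2_def by (intro nn_integral_mono ekernel_int1_lsc tendsto_const)
  also have "\<dots> \<le> liminf (\<lambda>n. ekernel_int2 X (s n))"
    unfolding ekernel_int2_def by (intro nn_integral_liminf measurable_ekernel_int1)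
  finally show "ekernel_int2 X x \<le> liminf (\<lambda>n. ekernel_int2 X (s n))" .
qed

definition sigma_finite_hausdorff1 :: "'a::metric_space set \<Rightarrow> bool" where
  "sigma_finite_hausdorff1 S \<longleftrightarrow> (\<exists>C :: nat \<Rightarrow> 'a set. S \<subseteq> (\<Union>n. C n) \<and> (\<forall>n. hausdorff1_outer (C n) < top))"

lemma sigma_finite_hausdorff1_subset:
  "sigma_finite_hausdorff1 S \<Longrightarrow> T \<subseteq> S \<Longrightarrow> sigma_finite_hausdorff1 T"
  unfolding sigma_finite_hausdorff1_def by blast

lemma sigma_finite_hausdorff1_finite: "hausdorff1_outer S < top \<Longrightarrow> sigma_finite_hausdorff1 S"
  unfolding sigma_finite_hausdorff1_def by (intro exI[of _ "\<lambda>_. S"]) auto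

lemma sigma_finite_hausdorff1_UN:
  fixes S :: "nat \<Rightarrow> 'a::metric_space set"
  assumes "\<And>i. sigma_finite_hausdorff1 (S i)"
  shows "sigma_finite_hausdorff1 (\<Union>i. S i)"
proof -
  have "\<forall>i. \<exists>C :: nat \<Rightarrow> 'a set. S i \<subseteq> (\<Union>n. C n) \<and> (\<forall>n. hausdorff1_outer (C n) < top)"
    using assms unfolding sigma_finite_hausdorff1_def by blast
  from choice[OF this] obtain C :: "nat \<Rightarrow> nat \<Rightarrow> 'a set" where
    C: "\<And>i. S i \<subseteq> (\<Union>n. C i n)" "\<And>i n. hausdorff1_outer (C i n) < top" by blast
  define D where "D m = (case prod_decode m of (i, n) \<Rightarrow> C i n)" for m
  have "x \<in> (\<Union>m. D m)" if "x \<in> S i" for x i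
  proof -
    obtain n where "x \<in> C i n" using C(1) \<open>x \<in> S i\<close> by blast
    then have "x \<in> D (prod_encode (i, n))" by (simp add: D_def)
    then show ?thesis by blast
  qed
  moreover have "hausdorff1_outer (D m) < top" for m
    unfolding D_def using C(2) by (auto split: prod.split)
  ultimately show ?thesis unfolding sigma_finite_hausdorff1_def by (intro exI[of _ D]) blast
qed

lemma sigma_finite_hausdorff1_Un:
  assumes "sigma_finite_hausdorff1 S" "sigma_finite_hausdorff1 T"
  shows "sigma_finite_hausdorff1 (S \<union> T)"
proof -
  have "sigma_finite_hausdorff1 (\<Union>i. if i = (0::nat) then S else T)"
    using assms by (intro sigma_finite_hausdorff1_UN) simp
  then show ?thesis by (rule sigma_finite_hausdorff1_subset) (auto split: if_splits)
qed

text \<open>Markov's inequality bounds the length of each level set where \<open>f\<close> is at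
  least \<open>1 / real (Suc n)\<close>.\<close>

lemma sigma_finite_positive_set:
  assumes f: "f \<in> borel_measurable (hausdorff1 X)" and fin: "(\<integral>\<^sup>+ x. f x \<partial>hausdorff1 X) < top"
  shows "sigma_finite_hausdorff1 {x \<in> X. 0 < f x}"
proof -
  define A where "A n = {x \<in> space (hausdorff1 X). 1 \<le> of_nat (Suc n) * f x}" for n
  have A: "A n \<in> sets (hausdorff1 X)" for n unfolding A_def using f by measurable
  have "hausdorff1_outer (A n) < top" for n
  proof -
    have "hausdorff1_outer (A n) = emeasure (hausdorff1 X) (A n)" by (rule emeasure_hausdorff1[OF A, symmetric])
    also have "\<dots> = emeasure (hausdorff1 X) ({x \<in> space (hausdorff1 X). 1 \<le> of_nat (Suc n) * f x})"
      by (simp add: A_def)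
    also have "\<dots> \<le> of_nat (Suc n) * (\<integral>\<^sup>+ x. f x * indicator (space (hausdorff1 X)) x \<partial>hausdorff1 X)"
      using f by (intro nn_integral_Markov_inequality borel_measurable_times_ennreal borel_measurable_indicator) simp_all
    also have "\<dots> = of_nat (Suc n) * (\<integral>\<^sup>+ x. f x \<partial>hausdorff1 X)"
      by (intro arg_cong2[where f = "(*)"] nn_integral_cong) auto
    also have "\<dots> < top" using fin by (simp add: ennreal_mult_less_top of_nat_less_top del: of_nat_Suc)
    finally show ?thesis .
  qed
  moreover have "{x \<in> X. 0 < f x} \<subseteq> (\<Union>n. A n)"
  proof
    fix x assume x: "x \<in> {x \<in> X. 0 < f x}"
    have "\<exists>n. 1 \<le> of_nat (Suc n) * f x"
    proof (cases "f x")
      case (real r)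
      then have "0 < r" using x by auto
      then obtain n where "inverse (real (Suc n)) < r" using reals_Archimedean by blast
      then have "1 \<le> real (Suc n) * r" by (simp add: field_simps)
      then have "ennreal 1 \<le> ennreal (real (Suc n) * r)" by (rule ennreal_leI)
      also have "\<dots> = of_nat (Suc n) * f x"
        using \<open>0 < r\<close> by (simp add: real ennreal_mult ennreal_of_nat_eq_real_of_nat del: of_nat_Suc)
      finally show ?thesis by auto
    next
      case top
      then show ?thesis by (intro exI[of _ 0]) simp
    qed
    then show "x \<in> (\<Union>n. A n)" using x by (auto simp: A_def space_hausdorff1)
  qed
  ultimately show ?thesis unfolding sigma_finite_hausdorff1_def by blast
qed

section \<open>Covering by thin annuli\<close>

lemma hausdorff1_pre_UN_lessThan:
  fixes n :: nat
  shows "0 < \<delta> \<Longrightarrow> hausdorff1_pre \<delta> (\<Union>i<n. A i) \<le> (\<Sum>i<n. hausdorff1_pre \<delta> (A i))"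
proof (induction n)
  case (Suc n)
  have "hausdorff1_pre \<delta> (\<Union>i<Suc n. A i) \<le> hausdorff1_pre \<delta> (\<Union>i<n. A i) + hausdorff1_pre \<delta> (A n)"
    using hausdorff1_pre_Un[OF Suc.prems, of "\<Union>i<n. A i" "A n"] by (simp add: lessThan_Suc Un_commute)
  also have "\<dots> \<le> (\<Sum>i<Suc n. hausdorff1_pre \<delta> (A i))" using Suc by (simp add: add_right_mono)
  finally show ?case .
qed (simp add: hausdorff1_pre_empty)

text \<open>Of two points in a thin annulus around \<open>p\<close> which are collinear with \<open>p\<close>, either both lie close
  together or \<open>p\<close> lies between them; three points of the latter kind are not collinear.\<close>

lemma collinear_annulus:
  assumes p: "excess p a b = 0" "excess p a w = 0" "excess p b w = 0" and ab: "excess a b w = 0"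
    and t: "0 < t" and r: "t \<le> dist p a" "dist p a < t + s" "t \<le> dist p b" "dist p b < t + s" "t \<le> dist p w" "dist p w < t + s"
  shows "dist a b < s \<or> dist a w < s \<or> dist b w < s"
proof -
  have opp: "dist x y < s \<or> dist x y = dist p x + dist p y"
    if "excess p x y = 0" "t \<le> dist p x" "dist p x < t + s" "t \<le> dist p y" "dist p y < t + s" for x y
    using that by (auto simp: excess_def max_def split: if_splits)
  show ?thesis
  proof (rule ccontr)
    assume "\<not> ?thesis"
    then have eq: "dist a b = dist p a + dist p b" "dist a w = dist p a + dist p w" "dist b w = dist p b + dist p w"
      using opp[OF p(1) r(1-4)] opp[OF p(2) r(1,2,5,6)] opp[OF p(3) r(3-6)] by blast+
    have "max (dist a b) (max (dist b w) (dist a w)) < dist p a + dist p b + dist p w"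
      using t r unfolding eq max_less_iff_conj by (intro conjI; linarith)
    moreover have "2 * (dist p a + dist p b + dist p w) = 2 * max (dist a b) (max (dist b w) (dist a w))"
      using ab unfolding excess_def by (simp add: eq)
    moreover have "m < x \<Longrightarrow> 2 * x \<noteq> 2 * m" for m x :: real by linarith
    ultimately show False by blast
  qed
qed

lemma sigma_finite_of_finite_curvature:
  fixes X :: "'a::metric_space set"
  assumes fin: "(\<integral>\<^sup>+ x. \<integral>\<^sup>+ y. \<integral>\<^sup>+ z. ennreal (ekernel x y z) \<partial>hausdorff1 X \<partial>hausdorff1 X \<partial>hausdorff1 X) < top"
  shows "sigma_finite_hausdorff1 X"
proof -
  let ?H = "hausdorff1 X"
  have small: "sigma_finite_hausdorff1 {x \<in> X. f x = \<infinity>}"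
    if f: "f \<in> borel_measurable ?H" and fin: "(\<integral>\<^sup>+ x. f x \<partial>?H) < top" for f
    by (rule sigma_finite_hausdorff1_subset[OF sigma_finite_positive_set[OF f fin]]) auto
  \<comment> \<open>Three tiers of exceptional sets, each \<sigma>-finite once the previous points
    are generic: base points with infinite double integral, second points with infinite inner
    integral, third points with positive excess.\<close>
  define N0 where "N0 = {x \<in> X. ekernel_int2 X x = \<infinity>}"
  define N where "N x = {y \<in> X. ekernel_int1 X x y = \<infinity>}" for x
  define J where "J x y = {z \<in> X. 0 < ennreal (ekernel x y z)}" for x y
  have N0: "sigma_finite_hausdorff1 N0"
    unfolding N0_def using fin
    by (intro small measurable_ekernel_int2) (simp add: ekernel_int2_def ekernel_int1_def)
  have N: "sigma_finite_hausdorff1 (N x)" if "x \<in> X" "x \<notin> N0" for x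
    unfolding N_def using that
    by (intro small measurable_ekernel_int1) (simp add: N0_def ekernel_int2_def less_top)
  have J: "sigma_finite_hausdorff1 (J x y)" if "y \<in> X" "y \<notin> N x" for x y
    unfolding J_def using that
    by (intro sigma_finite_positive_set measurable_ekernel_hausdorff1) (simp add: N_def ekernel_int1_def less_top)
  have Jexcess: "excess x y z = 0" if "z \<in> X" "z \<notin> J x y" for x y z
  proof (rule ccontr)
    assume ne: "excess x y z \<noteq> 0"
    then have "0 < excess x y z" using excess_nonneg[of x y z] by linarith
    moreover have "0 < max (dist x y) (dist x z)"
      using ne by (auto simp: excess_def less_max_iff_disj)
    ultimately have "0 < ekernel x y z" unfolding ekernel_def by (intro divide_pos_pos zero_less_power)
    then show False using that by (simp add: J_def)
  qed
  show ?thesis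
  proof (cases "X \<subseteq> N0")
    case True
    then show ?thesis by (rule sigma_finite_hausdorff1_subset[OF N0])
  next
    case False
    then obtain p where p: "p \<in> X" "p \<notin> N0" by blast
    define S where "S n i = {w \<in> X. real i / real n \<le> dist p w \<and> dist p w < real i / real n + 1 / real n}" for n i :: nat
    \<comment> \<open>Either exceptional sets, together with at most one ball, cover the annulus, or
      it contains generic \<open>a\<close> and \<open>b\<close> at distance at least
      \<open>1 / real n\<close>. Then a further point outside the sets \<open>J\<close> has zero
      excess with all pairs from \<open>p\<close>, \<open>a\<close>, \<open>b\<close>, and
      \<open>collinear_annulus\<close> puts it near \<open>a\<close> or \<open>b\<close>.\<close>
    have cell: "\<exists>E a b. sigma_finite_hausdorff1 E \<and> S n i \<subseteq> E \<union> ball a (1 / real n) \<union> ball b (1 / real n)"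
      if n: "0 < n" and i: "0 < i" for n i
    proof (cases "S n i \<subseteq> N0 \<union> N p")
      case True
      then show ?thesis using sigma_finite_hausdorff1_Un[OF N0 N[OF p]] by blast
    next
      case False
      then obtain a where a: "a \<in> S n i" "a \<notin> N0" "a \<notin> N p" by blast
      have aX: "a \<in> X" using a by (simp add: S_def)
      show ?thesis
      proof (cases "S n i \<subseteq> N p \<union> N a \<union> J p a \<union> ball a (1 / real n)")
        case True
        then show ?thesis
          using sigma_finite_hausdorff1_Un[OF sigma_finite_hausdorff1_Un[OF N[OF p] N[OF aX a(2)]] J[OF aX a(3)]]
          by blast
      next
        case False
        then obtain b where b: "b \<in> S n i" "b \<notin> N p" "b \<notin> N a" "b \<notin> J p a" "b \<notin> ball a (1 / real n)" by blast
        have bX: "b \<in> X" using b by (simp add: S_def)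
        have "S n i \<subseteq> (J p a \<union> J p b \<union> J a b) \<union> ball a (1 / real n) \<union> ball b (1 / real n)"
        proof
          fix w assume w: "w \<in> S n i"
          then have wX: "w \<in> X" by (simp add: S_def)
          show "w \<in> (J p a \<union> J p b \<union> J a b) \<union> ball a (1 / real n) \<union> ball b (1 / real n)"
          proof (rule ccontr)
            assume nw: "\<not> ?thesis"
            have "dist a b < 1 / real n \<or> dist a w < 1 / real n \<or> dist b w < 1 / real n"
            proof (rule collinear_annulus[where p = p and t = "real i / real n"])
              show "excess p a b = 0" "excess p a w = 0" "excess p b w = 0" "excess a b w = 0"
                using Jexcess[OF bX b(4)] Jexcess[OF wX] nw by auto
            qed (use a b w n i in \<open>auto simp: S_def\<close>)
            then show False using nw b(5) by auto
          qed
        qed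
        then show ?thesis
          using sigma_finite_hausdorff1_Un[OF sigma_finite_hausdorff1_Un[OF J[OF aX a(3)] J[OF bX b(2)]] J[OF bX b(3)]]
          by blast
      qed
    qed
    have "\<exists>E a b. sigma_finite_hausdorff1 E \<and> (0 < n \<longrightarrow> 0 < i \<longrightarrow> S n i \<subseteq> E \<union> ball a (1 / real n) \<union> ball b (1 / real n))" for n i
      using cell[of n i] sigma_finite_hausdorff1_finite[of "{}"] by (cases "0 < n \<and> 0 < i") (auto simp: hausdorff1_outer_empty)
    then have "\<exists>E. \<forall>q. sigma_finite_hausdorff1 (E q) \<and>
        (\<exists>a b. 0 < fst q \<longrightarrow> 0 < snd q \<longrightarrow> S (fst q) (snd q) \<subseteq> E q \<union> ball a (1 / real (fst q)) \<union> ball b (1 / real (fst q)))"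
      by (intro choice) (auto; blast)
    then obtain E' where E': "\<And>q. sigma_finite_hausdorff1 (E' q)"
      "\<And>q. \<exists>a b. 0 < fst q \<longrightarrow> 0 < snd q \<longrightarrow> S (fst q) (snd q) \<subseteq> E' q \<union> ball a (1 / real (fst q)) \<union> ball b (1 / real (fst q))"
      by blast
    \<comment> \<open>A single \<sigma>-finite set for all widths and radii, so that it can be
      removed before the width tends to zero.\<close>
    define E where "E = (\<Union>k. E' (prod_decode k))"
    have E: "sigma_finite_hausdorff1 E" unfolding E_def by (rule sigma_finite_hausdorff1_UN[OF E'(1)])
    have E'_sub: "E' q \<subseteq> E" for q unfolding E_def by (metis UNIV_I UN_upper prod_encode_inverse)
    have preS: "hausdorff1_pre (2 / real n) (S n i - E) \<le> ennreal (4 / real n)" if n: "0 < n" and i: "0 < i" for n i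
    proof -
      obtain a b where ab: "S n i \<subseteq> E' (n, i) \<union> ball a (1 / real n) \<union> ball b (1 / real n)"
        using E'(2)[of "(n, i)"] n i by auto
      have bl: "hausdorff1_pre (2 / real n) (ball c (1 / real n)) \<le> ennreal (2 / real n)" for c :: 'a
      proof (rule hausdorff1_pre_le_diam)
        fix x y assume "x \<in> ball c (1 / real n)" "y \<in> ball c (1 / real n)"
        then have "dist c x < 1 / real n" "dist c y < 1 / real n" by auto
        moreover have "2 / real n = 1 / real n + 1 / real n" by simp
        ultimately show "dist x y \<le> 2 / real n" using dist_triangle3[of x y c] by linarith
      qed simp_all
      have "hausdorff1_pre (2 / real n) (S n i - E) \<le> hausdorff1_pre (2 / real n) (ball a (1 / real n) \<union> ball b (1 / real n))"
        using ab E'_sub[of "(n, i)"] by (intro hausdorff1_pre_mono) blast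
      also have "\<dots> \<le> hausdorff1_pre (2 / real n) (ball a (1 / real n)) + hausdorff1_pre (2 / real n) (ball b (1 / real n))"
        using n by (intro hausdorff1_pre_Un) simp
      also have "\<dots> \<le> ennreal (2 / real n) + ennreal (2 / real n)" by (intro add_mono bl)
      also have "\<dots> = ennreal (4 / real n)" by (simp flip: ennreal_plus)
      finally show ?thesis .
    qed
    define Y where "Y k = {w \<in> X - E. 1 / real (Suc k) \<le> dist p w \<and> dist p w < real (Suc k)}" for k
    have "hausdorff1_outer (Y k) \<le> ennreal (4 * real (Suc k))" for k
      unfolding hausdorff1_outer_def
    proof (rule SUP_least)
      fix \<delta> :: real assume "\<delta> \<in> {0<..}"
      then have "0 < \<delta> / 2" by simp
      then obtain m where m: "inverse (real (Suc m)) < \<delta> / 2" using reals_Archimedean by blast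
      \<comment> \<open>The factor \<open>Suc k\<close> keeps \<open>Y k\<close> out of the
        innermost annulus \<open>i = 0\<close>, where \<open>cell\<close> says nothing; the factor
        \<open>Suc m\<close> makes \<open>2 / real n\<close> at most
        \<open>\<delta>\<close>.\<close>
      define n where "n = Suc k * Suc m"
      have n: "0 < n" "Suc k \<le> n" "Suc m \<le> n" by (simp_all add: n_def)
      have "2 / real n \<le> 2 * inverse (real (Suc m))"
        using n by (simp add: inverse_eq_divide divide_left_mono)
      then have n\<delta>: "2 / real n \<le> \<delta>" using m by linarith
      define T where "T i = (if i = 0 then {} else S n i - E)" for i
      have "Y k \<subseteq> (\<Union>i<n * Suc k. T i)"
      proof
        fix w assume w: "w \<in> Y k"
        define i where "i = nat \<lfloor>real n * dist p w\<rfloor>"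
        have i: "real i \<le> real n * dist p w" "real n * dist p w < real i + 1"
          unfolding i_def using zero_le_dist[of p w] by simp_all
        have "real n * dist p w < real n * real (Suc k)"
          using w n by (intro mult_strict_left_mono) (auto simp: Y_def)
        then have "real i < real (n * Suc k)" using i unfolding of_nat_mult by linarith
        then have "i < n * Suc k" by (simp only: of_nat_less_iff)
        moreover have "i \<noteq> 0"
        proof
          assume "i = 0"
          then have "real n * dist p w < 1" using i by simp
          moreover have "1 \<le> real (Suc k) * dist p w" using w by (simp add: Y_def field_simps)
          moreover have "real (Suc k) * dist p w \<le> real n * dist p w"
            using n by (intro mult_right_mono) (simp_all only: of_nat_le_iff zero_le_dist)
          ultimately show False by linarith
        qed
        moreover have "w \<in> S n i" using w i n by (auto simp: S_def Y_def field_simps)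
        ultimately show "w \<in> (\<Union>i<n * Suc k. T i)" using w by (auto simp: T_def Y_def)
      qed
      then have "hausdorff1_pre \<delta> (Y k) \<le> hausdorff1_pre (2 / real n) (\<Union>i<n * Suc k. T i)"
        by (rule order_trans[OF hausdorff1_pre_mono hausdorff1_pre_antimono[OF n\<delta>]])
      also have "\<dots> \<le> (\<Sum>i<n * Suc k. hausdorff1_pre (2 / real n) (T i))"
        using n by (intro hausdorff1_pre_UN_lessThan) simp
      \<comment> \<open>There are \<open>n * Suc k\<close> annuli at cost \<open>4 / real n\<close>
        each, so the total does not depend on the width.\<close>
      also have "\<dots> \<le> (\<Sum>i<n * Suc k. ennreal (4 / real n))"
        using n by (intro sum_mono) (auto simp: T_def hausdorff1_pre_empty preS)
      also have "\<dots> = ennreal (4 * real (Suc k))"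
        using n by (simp add: ennreal_of_nat_eq_real_of_nat flip: ennreal_mult del: of_nat_Suc mult_Suc_right)
      finally show "hausdorff1_pre \<delta> (Y k) \<le> ennreal (4 * real (Suc k))" .
    qed
    then have "sigma_finite_hausdorff1 (Y k)" for k
      by (intro sigma_finite_hausdorff1_finite) (meson ennreal_less_top order_le_less_trans)
    moreover have "sigma_finite_hausdorff1 {p}"
    proof (rule sigma_finite_hausdorff1_finite)
      have "hausdorff1_outer {p} \<le> 0"
        unfolding hausdorff1_outer_def using hausdorff1_pre_le_diam[of "{p}" 0] by (intro SUP_least) auto
      then show "hausdorff1_outer {p} < top" by simp
    qed
    ultimately have "sigma_finite_hausdorff1 (E \<union> ({p} \<union> (\<Union>k. Y k)))"
      by (intro sigma_finite_hausdorff1_Un E sigma_finite_hausdorff1_UN)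
    moreover have "X \<subseteq> E \<union> ({p} \<union> (\<Union>k. Y k))"
    proof
      fix w assume w: "w \<in> X"
      show "w \<in> E \<union> ({p} \<union> (\<Union>k. Y k))"
      proof (cases "w \<in> E \<or> w = p")
        case False
        then have "0 < dist p w" by auto
        then obtain k1 where k1: "inverse (real (Suc k1)) < dist p w" using reals_Archimedean by blast
        obtain k2 where k2: "dist p w < real k2" using reals_Archimedean2 by blast
        define k where "k = max k1 k2"
        have "1 / real (Suc k) \<le> 1 / real (Suc k1)" by (intro divide_left_mono) (auto simp: k_def)
        then have "1 / real (Suc k) \<le> dist p w" using k1 by (simp add: inverse_eq_divide)
        moreover have "dist p w < real (Suc k)" using k2 by (simp add: k_def)
        ultimately have "w \<in> Y k" using w False by (simp add: Y_def)
        then show ?thesis by blast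
      qed auto
    qed
    ultimately show ?thesis by (rule sigma_finite_hausdorff1_subset)
  qed
qed

text \<open>The hull is the intersection, over all scales, of the unions of the closed sets of an
  almost optimal covering; closures keep the diameters. The slack 1 in the cost is harmless for
  finiteness.\<close>

lemma measurable_hull:
  assumes fin: "hausdorff1_outer S < top"
  obtains G where "G \<in> sets (hausdorff1 X)" "S \<inter> X \<subseteq> G" "hausdorff1_outer G < top"
proof -
  have "\<exists>C :: nat \<Rightarrow> 'a set. S \<subseteq> (\<Union>i. C i) \<and> (\<forall>i. bounded (C i) \<and> diameter (C i) \<le> 1 / real (Suc n)) \<and>
      (\<Sum>i. ennreal (diameter (C i))) < hausdorff1_outer S + 1" for n
  proof -
    have "hausdorff1_pre (1 / real (Suc n)) S \<le> hausdorff1_outer S" by (rule hausdorff1_pre_le) simp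
    also have "\<dots> < hausdorff1_outer S + 1" using fin by (simp add: less_top ennreal_add_left_cancel_less)
    finally show ?thesis unfolding hausdorff1_pre_def INF_less_iff by blast
  qed
  then have "\<exists>C :: nat \<Rightarrow> nat \<Rightarrow> 'a set. \<forall>n. S \<subseteq> (\<Union>i. C n i) \<and>
      (\<forall>i. bounded (C n i) \<and> diameter (C n i) \<le> 1 / real (Suc n)) \<and> (\<Sum>i. ennreal (diameter (C n i))) < hausdorff1_outer S + 1"
    by (intro choice allI)
  then obtain C :: "nat \<Rightarrow> nat \<Rightarrow> 'a set" where C: "\<And>n. S \<subseteq> (\<Union>i. C n i)"
      "\<And>n i. bounded (C n i)" "\<And>n i. diameter (C n i) \<le> 1 / real (Suc n)"
      "\<And>n. (\<Sum>i. ennreal (diameter (C n i))) < hausdorff1_outer S + 1" by blast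
  define G where "G = (\<Inter>n. \<Union>i. closure (C n i) \<inter> X)"
  show thesis
  proof
    have U: "(\<Union>i. closure (C n i) \<inter> X) \<in> sets (hausdorff1 X)" for n
      by (intro sets.countable_UN image_subsetI closed_sets_hausdorff1 closed_closure)
    show "G \<in> sets (hausdorff1 X)" unfolding G_def by (intro sets.countable_INT image_subsetI U) simp
    show "S \<inter> X \<subseteq> G"
    proof
      fix x assume x: "x \<in> S \<inter> X"
      have "x \<in> (\<Union>i. closure (C n i) \<inter> X)" for n
      proof -
        obtain i where "x \<in> C n i" using C(1)[of n] x by auto
        then have "x \<in> closure (C n i) \<inter> X" using x subsetD[OF closure_subset] by auto
        then show ?thesis by blast
      qed
      then show "x \<in> G" by (simp add: G_def)
    qed
    have "hausdorff1_outer G \<le> hausdorff1_outer S + 1"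
      unfolding hausdorff1_outer_SUP_nat[of G]
    proof (rule SUP_least)
      fix n
      have "G \<subseteq> (\<Union>i. closure (C n i))" by (auto simp: G_def)
      then have "hausdorff1_pre (1 / real (Suc n)) G \<le> (\<Sum>i. ennreal (diameter (closure (C n i))))"
        unfolding hausdorff1_pre_def using C(2,3)
        by (intro INF_lower) (auto simp: diameter_closure simp del: of_nat_Suc)
      also have "\<dots> = (\<Sum>i. ennreal (diameter (C n i)))" using C(2) by (simp add: diameter_closure)
      also have "\<dots> \<le> hausdorff1_outer S + 1" by (intro less_imp_le C(4))
      finally show "hausdorff1_pre (1 / real (Suc n)) G \<le> hausdorff1_outer S + 1" .
    qed
    also have "\<dots> < top" using fin by simp
    finally show "hausdorff1_outer G < top" .
  qed
qed

theorem theorem1p1: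
  fixes X :: "'a::metric_space set"
  assumes "menger_c2 X < \<infinity>"
  shows "rectifiable X"
proof -
  let ?H = "hausdorff1 X"
  have fin: "(\<integral>\<^sup>+ x. \<integral>\<^sup>+ y. \<integral>\<^sup>+ z. ennreal (ekernel x y z) \<partial>?H \<partial>?H \<partial>?H) < top"
    using le_less_trans[OF ekernel_integral_le_menger_c2 assms] by simp
  obtain S :: "nat \<Rightarrow> 'a set" where S: "X \<subseteq> (\<Union>n. S n)" "\<And>n. hausdorff1_outer (S n) < top"
    using sigma_finite_of_finite_curvature[OF fin] unfolding sigma_finite_hausdorff1_def by blast
  have "\<exists>B :: nat \<Rightarrow> 'a set. (\<forall>i. B i \<subseteq> X \<and> lineable (B i)) \<and> hausdorff1_outer (S n \<inter> X - (\<Union>i. B i)) = 0" for n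
  proof -
    \<comment> \<open>\<open>S n\<close> is an arbitrary set of finite outer measure; restricting
      the measure calls for a measurable one.\<close>
    obtain G where G: "G \<in> sets ?H" "S n \<inter> X \<subseteq> G" "hausdorff1_outer G < top"
      by (rule measurable_hull[OF S(2)])
    have GX: "G \<subseteq> X" using sets.sets_into_space[OF G(1)] by (simp add: space_hausdorff1)
    define M where "M = restrict_space ?H G"
    have sp: "space M = G" using GX by (auto simp: M_def space_restrict_space space_hausdorff1)
    interpret M: hausdorff_space M
      unfolding M_def using G
      by (intro hausdorff_space_restrict) (simp_all add: emeasure_hausdorff1 space_hausdorff1 closed_sets_hausdorff1)
    have "(\<integral>\<^sup>+ x. \<integral>\<^sup>+ y. \<integral>\<^sup>+ z. ennreal (ekernel x y z) \<partial>M \<partial>M \<partial>M) < top"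
      unfolding M_def by (rule le_less_trans[OF nn_integral_3_restrict_space_le[OF G(1)] fin])
    then obtain B :: "nat \<Rightarrow> 'a set" where B: "\<And>i. B i \<in> sets M" "\<And>i. lineable (B i)"
        "hausdorff1_outer (space M - (\<Union>i. B i)) = 0"
      by (rule M.lineable_exhaustion) blast
    have "hausdorff1_outer (S n \<inter> X - (\<Union>i. B i)) \<le> hausdorff1_outer (space M - (\<Union>i. B i))"
      using G(2) by (intro hausdorff1_outer_mono) (auto simp: sp)
    moreover have "B i \<subseteq> X" for i using sets.sets_into_space[OF B(1)[of i]] GX by (simp add: sp)
    ultimately show ?thesis using B by (intro exI[of _ B]) auto
  qed
  then have "\<exists>B :: nat \<Rightarrow> nat \<Rightarrow> 'a set. \<forall>n. (\<forall>i. B n i \<subseteq> X \<and> lineable (B n i)) \<and>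
      hausdorff1_outer (S n \<inter> X - (\<Union>i. B n i)) = 0"
    by (intro choice allI)
  then obtain B :: "nat \<Rightarrow> nat \<Rightarrow> 'a set" where B: "\<And>n i. B n i \<subseteq> X" "\<And>n i. lineable (B n i)"
      "\<And>n. hausdorff1_outer (S n \<inter> X - (\<Union>i. B n i)) = 0" by blast
  define A where "A k = B (fst (prod_decode k)) (snd (prod_decode k))" for k
  have BA: "B n i \<subseteq> (\<Union>k. A k)" for n i
  proof -
    have "B n i = A (prod_encode (n, i))" by (simp add: A_def)
    then show ?thesis by blast
  qed
  show ?thesis
  proof (rule rectifiable_of_lineable[of A])
    have "X - (\<Union>k. A k) \<subseteq> (\<Union>n. S n \<inter> X - (\<Union>i. B n i))"
    proof
      fix x assume x: "x \<in> X - (\<Union>k. A k)"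
      then obtain n where "x \<in> S n" using S(1) by blast
      moreover have "x \<notin> (\<Union>i. B n i)" using x BA by blast
      ultimately show "x \<in> (\<Union>n. S n \<inter> X - (\<Union>i. B n i))" using x by blast
    qed
    then have "hausdorff1_outer (X - (\<Union>k. A k)) \<le> hausdorff1_outer (\<Union>n. S n \<inter> X - (\<Union>i. B n i))"
      by (rule hausdorff1_outer_mono)
    also have "\<dots> \<le> (\<Sum>n. hausdorff1_outer (S n \<inter> X - (\<Union>i. B n i)))" by (rule hausdorff1_outer_UN)
    also have "\<dots> = 0" by (simp add: B(3))
    finally show "hausdorff1_outer (X - (\<Union>k. A k)) = 0" by simp
  qed (use B in \<open>auto simp: A_def\<close>)
qed

end
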